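(* Let $n\ge 3$ and let the directions $\varphi_1,\dots,\varphi_n$ be as in the context. Let $0<\theta<\varsigma<\pi/2$. Suppose that each of the operators $\mathcal{A}^{\Pi^{\varsigma}}$ and $\mathcal{A}^{\Pi^{\theta}}$, where $\Pi^\theta$ and $\Pi^\varsigma$ are the polyhedral layers (admitting an inscribed ball) with face directions $\varphi_1,\dots,\varphi_n$ and face-to-axis angles $\theta$ and $\varsigma$ respectively, has at least $k$ eigenvalues (counted with multiplicity) below its own essential spectrum threshold. Then $$\lambda_j(\mathcal{A}^{\Pi^{\theta}})\le \lambda_j(\mathcal{A}^{\Pi^{\varsigma}})\qquad\text{for all } 1\le j\le k.$$
   Context: For a domain $\Omega\subset\mathbb{R}^3$, let $H_0^1(\Omega)$ be the Sobolev space of $H^1(\Omega)$ functions with zero trace on $\partial\Omega$. The Dirichlet Laplacian $\mathcal{A}^{\Omega}$ is the self-adjoint operator in $L_2(\Omega)$ generated by the closed positive form $\mathfrak{a}_\Omega[u,v]=(\nabla u,\nabla v)_{L_2(\Omega)}$ with domain $H_0^1(\Omega)$. Use cylindrical coordinates $(r,\varphi,z)$ in $\mathbb{R}^3$ with $r\ge0$. Fix directions $0\le\varphi_1<\varphi_2<\dots<\varphi_n<2\pi$ such that each of the consecutive gaps $\varphi_{j+1}-\varphi_j$ ($1\le j\le n-1$) and $\varphi_1+2\pi-\varphi_n$ is less than $\pi$. For $\theta\in(0,\pi/2)$ let $$\Upsilon^\theta=\{(r,\varphi,z): z\sin\theta-r\cos\theta\cos(\varphi-\varphi_j)>0,\ 1\le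 j\le n\}.$$ This is a convex polyhedral angle with $n$ faces and apex at the origin, each face making the angle $\theta$ with the $z$-axis; a ball centred on the $z$-axis can be inscribed in it. The corresponding polyhedral layer of unit width is $\Pi^\theta=\{x\in\Upsilon^\theta:\operatorname{dist}(x,\partial\Upsilon^\theta)\in(0,1)\}$. The essential spectrum of $\mathcal{A}^{\Pi^\theta}$ is a ray $[\Lambda_\dagger(\Pi^\theta),+\infty)$, whose left end (the threshold) equals the first eigenvalue of the Dirichlet Laplacian in the planar V-shaped waveguide of unit width (the set of points inside a planar angle at distance less than one from its boundary) whose angle equals the smallest inner dihedral angle of $\Upsilon^\theta$. $\lambda_j(\mathcal{A}^{\Pi^\theta})$ denotes the $j$-th eigenvalue below this threshold, the eigenvalues being listed in nondecreasing order and counted with multiplicity. *)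

theory Defs
  imports "HOL-Analysis.Analysis" "HOL-Library.Extended_Nat" "HOL-Library.Extended_Real"
begin

section \<open>The complex space \<open>L\<^sub>2\<close>\<close>

text \<open>Elements are represented by functions; equality in \<open>L\<^sub>2\<close> is equality almost everywhere.\<close>

definition L2 :: "'a measure \<Rightarrow> ('a \<Rightarrow> complex) set" where
  "L2 M = {f. f \<in> borel_measurable M \<and> integrable M (\<lambda>x. (cmod (f x))\<^sup>2)}"

definition L2_inner :: "'a measure \<Rightarrow> ('a \<Rightarrow> complex) \<Rightarrow> ('a \<Rightarrow> complex) \<Rightarrow> complex" where
  "L2_inner M f g = (LINT x|M. f x * cnj (g x))"

definition L2_norm :: "'a measure \<Rightarrow> ('a \<Rightarrow> complex) \<Rightarrow> real" where
  "L2_norm M f = sqrt (LINT x|M. (cmod (f x))\<^sup>2)"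

definition L2_independent :: "'a measure \<Rightarrow> nat \<Rightarrow> (nat \<Rightarrow> 'a \<Rightarrow> complex) \<Rightarrow> bool" where
  "L2_independent M m u \<longleftrightarrow>
     (\<forall>c :: nat \<Rightarrow> complex. (AE x in M. (\<Sum>i<m. c i * u i x) = 0) \<longrightarrow> (\<forall>i<m. c i = 0))"

definition L2_dim :: "'a measure \<Rightarrow> ('a \<Rightarrow> complex) set \<Rightarrow> enat" where
  "L2_dim M V = (SUP m \<in> {m. \<exists>u. (\<forall>i<m. u i \<in> V) \<and> L2_independent M m u}. enat m)"

section \<open>Spectra of operators in \<open>L\<^sub>2\<close>\<close>

text \<open>An (unbounded) operator in \<open>L\<^sub>2\<close> is given by its graph.\<close>

type_synonym 'a L2_operator = "(('a \<Rightarrow> complex) \<times> ('a \<Rightarrow> complex)) set"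

text \<open>The a priori estimate says that \<open>A - \<mu>\<close> is injective with a bounded inverse on its range, the
  other condition that it is onto.\<close>

definition resolvent_set :: "'a measure \<Rightarrow> 'a L2_operator \<Rightarrow> complex set" where
  "resolvent_set M A = {\<mu>.
     (\<exists>C. \<forall>(u, w) \<in> A. L2_norm M u \<le> C * L2_norm M (\<lambda>x. w x - \<mu> * u x)) \<and>
     (\<forall>f \<in> L2 M. \<exists>(u, w) \<in> A. AE x in M. w x - \<mu> * u x = f x)}"

definition spectrum :: "'a measure \<Rightarrow> 'a L2_operator \<Rightarrow> complex set" where
  "spectrum M A = - resolvent_set M A"

definition eigenspace :: "'a L2_operator \<Rightarrow> complex \<Rightarrow> ('a \<Rightarrow> complex) set" where
  "eigenspace A \<mu> = {u. (u, \<lambda>x. \<mu> * u x) \<in> A}"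

definition eigen_mult :: "'a measure \<Rightarrow> 'a L2_operator \<Rightarrow> complex \<Rightarrow> enat" where
  "eigen_mult M A \<mu> = L2_dim M (eigenspace A \<mu>)"

definition discrete_spectrum :: "'a measure \<Rightarrow> 'a L2_operator \<Rightarrow> complex set" where
  "discrete_spectrum M A =
     {\<mu>. \<mu> isolated_in spectrum M A \<and> 0 < eigen_mult M A \<mu> \<and> eigen_mult M A \<mu> < \<infinity>}"

definition essential_spectrum :: "'a measure \<Rightarrow> 'a L2_operator \<Rightarrow> complex set" where
  "essential_spectrum M A = spectrum M A - discrete_spectrum M A"

text \<open>The remaining notions are meant for self-adjoint operators, whose spectrum is real.\<close>

definition threshold :: "'a measure \<Rightarrow> 'a L2_operator \<Rightarrow> ereal" where
  "threshold M A = (INF t \<in> {t. complex_of_real t \<in> essential_spectrum M A}. ereal t)"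

text \<open>The number of eigenvalues in a set of reals, counted with multiplicity (points that are not
  eigenvalues contribute \<open>0\<close>).\<close>

definition eigen_count :: "'a measure \<Rightarrow> 'a L2_operator \<Rightarrow> real set \<Rightarrow> enat" where
  "eigen_count M A S =
     (SUP F \<in> {F. finite F \<and> F \<subseteq> S}. \<Sum>t\<in>F. eigen_mult M A (complex_of_real t))"

definition has_eigenvalues_below_threshold :: "'a measure \<Rightarrow> 'a L2_operator \<Rightarrow> nat \<Rightarrow> bool" where
  "has_eigenvalues_below_threshold M A k \<longleftrightarrow>
     enat k \<le> eigen_count M A {t. ereal t < threshold M A}"

text \<open>In the nondecreasing list with multiplicities, the \<open>j\<close>-th entry (\<open>j \<ge> 1\<close>) is the least
  eigenvalue \<open>t\<close> such that at least \<open>j\<close> entries are \<open>\<le> t\<close>.\<close>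

definition nth_eigenvalue :: "'a measure \<Rightarrow> 'a L2_operator \<Rightarrow> nat \<Rightarrow> real" where
  "nth_eigenvalue M A j =
     (LEAST t. ereal t < threshold M A \<and> 0 < eigen_mult M A (complex_of_real t) \<and>
               enat j \<le> eigen_count M A {..t})"

section \<open>Sobolev spaces and the Dirichlet Laplacian\<close>

definition partial_deriv :: "'n::finite \<Rightarrow> (real^'n \<Rightarrow> complex) \<Rightarrow> real^'n \<Rightarrow> complex" where
  "partial_deriv i f x = frechet_derivative f (at x) (axis i 1)"

primrec C_k :: "nat \<Rightarrow> (real^'n::finite \<Rightarrow> complex) \<Rightarrow> bool" where
  "C_k 0 f \<longleftrightarrow> continuous_on UNIV f"
| "C_k (Suc k) f \<longleftrightarrow> (\<forall>x. f differentiable (at x)) \<and> (\<forall>i. C_k k (partial_deriv i f))"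

definition test_functions :: "(real^'n::finite) set \<Rightarrow> (real^'n \<Rightarrow> complex) set" where
  "test_functions \<Omega> = {f. (\<forall>k. C_k k f) \<and>
     compact (closure {x. f x \<noteq> 0}) \<and> closure {x. f x \<noteq> 0} \<subseteq> \<Omega>}"

definition is_weak_partial ::
  "(real^'n::finite) set \<Rightarrow> 'n \<Rightarrow> (real^'n \<Rightarrow> complex) \<Rightarrow> (real^'n \<Rightarrow> complex) \<Rightarrow> bool" where
  "is_weak_partial \<Omega> i u g \<longleftrightarrow> g \<in> L2 (lebesgue_on \<Omega>) \<and>
     (\<forall>f \<in> test_functions \<Omega>.
        (LINT x|lebesgue_on \<Omega>. u x * partial_deriv i f x) = - (LINT x|lebesgue_on \<Omega>. g x * f x))"

definition H1 :: "(real^'n::finite) set \<Rightarrow> (real^'n \<Rightarrow> complex) set" where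
  "H1 \<Omega> = {u \<in> L2 (lebesgue_on \<Omega>). \<forall>i. \<exists>g. is_weak_partial \<Omega> i u g}"

text \<open>Weak derivatives of \<open>H\<^sup>1\<close> functions on open sets are unique almost everywhere.\<close>

definition weak_partial ::
  "(real^'n::finite) set \<Rightarrow> 'n \<Rightarrow> (real^'n \<Rightarrow> complex) \<Rightarrow> real^'n \<Rightarrow> complex" where
  "weak_partial \<Omega> i u = (SOME g. is_weak_partial \<Omega> i u g)"

definition dirichlet_form ::
  "(real^'n::finite) set \<Rightarrow> (real^'n \<Rightarrow> complex) \<Rightarrow> (real^'n \<Rightarrow> complex) \<Rightarrow> complex" where
  "dirichlet_form \<Omega> u v =
     (\<Sum>i\<in>UNIV. L2_inner (lebesgue_on \<Omega>) (weak_partial \<Omega> i u) (weak_partial \<Omega> i v))"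

definition H1_norm :: "(real^'n::finite) set \<Rightarrow> (real^'n \<Rightarrow> complex) \<Rightarrow> real" where
  "H1_norm \<Omega> u = sqrt ((L2_norm (lebesgue_on \<Omega>) u)\<^sup>2 +
     (\<Sum>i\<in>UNIV. (L2_norm (lebesgue_on \<Omega>) (weak_partial \<Omega> i u))\<^sup>2))"

text \<open>Zero trace on the boundary of a domain is understood as usual: \<open>H\<^sub>0\<^sup>1(\<Omega>)\<close> is the closure of
  the test functions in \<open>H\<^sup>1(\<Omega>)\<close>.\<close>

definition H10 :: "(real^'n::finite) set \<Rightarrow> (real^'n \<Rightarrow> complex) set" where
  "H10 \<Omega> = {u \<in> H1 \<Omega>. \<exists>f :: nat \<Rightarrow> real^'n \<Rightarrow> complex. (\<forall>m. f m \<in> test_functions \<Omega>) \<and>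
     (\<lambda>m. H1_norm \<Omega> (\<lambda>x. u x - f m x)) \<longlonglongrightarrow> 0}"

text \<open>The operator generated by the form \<open>dirichlet_form \<Omega>\<close> with domain \<open>H10 \<Omega>\<close>, in the sense of
  the first representation theorem.\<close>

definition dirichlet_laplacian :: "(real^'n::finite) set \<Rightarrow> (real^'n) L2_operator" where
  "dirichlet_laplacian \<Omega> = {(u, w). u \<in> H10 \<Omega> \<and> w \<in> L2 (lebesgue_on \<Omega>) \<and>
     (\<forall>v \<in> H10 \<Omega>. dirichlet_form \<Omega> u v = L2_inner (lebesgue_on \<Omega>) w v)}"

abbreviation at_least_eigenvalues :: "(real^'n::finite) set \<Rightarrow> nat \<Rightarrow> bool" where
  "at_least_eigenvalues \<Omega> k \<equiv>
     has_eigenvalues_below_threshold (lebesgue_on \<Omega>) (dirichlet_laplacian \<Omega>) k"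

abbreviation dirichlet_eigenvalue :: "(real^'n::finite) set \<Rightarrow> nat \<Rightarrow> real" where
  "dirichlet_eigenvalue \<Omega> j \<equiv> nth_eigenvalue (lebesgue_on \<Omega>) (dirichlet_laplacian \<Omega>) j"

section \<open>Polyhedral angles and layers\<close>

definition admissible_directions :: "nat \<Rightarrow> (nat \<Rightarrow> real) \<Rightarrow> bool" where
  "admissible_directions n \<phi> \<longleftrightarrow>
     0 \<le> \<phi> 1 \<and> \<phi> n < 2 * pi \<and>
     (\<forall>j\<in>{1..<n}. \<phi> j < \<phi> (j + 1) \<and> \<phi> (j + 1) - \<phi> j < pi) \<and>
     \<phi> 1 + 2 * pi - \<phi> n < pi"

definition cylindrical :: "real \<Rightarrow> real \<Rightarrow> real \<Rightarrow> real^3" where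
  "cylindrical r \<psi> z = vector [r * cos \<psi>, r * sin \<psi>, z]"

definition polyhedral_angle :: "nat \<Rightarrow> (nat \<Rightarrow> real) \<Rightarrow> real \<Rightarrow> (real^3) set" where
  "polyhedral_angle n \<phi> \<theta> = {cylindrical r \<psi> z | r \<psi> z. r \<ge> 0 \<and>
     (\<forall>j\<in>{1..n}. z * sin \<theta> - r * cos \<theta> * cos (\<psi> - \<phi> j) > 0)}"

definition polyhedral_layer :: "nat \<Rightarrow> (nat \<Rightarrow> real) \<Rightarrow> real \<Rightarrow> (real^3) set" where
  "polyhedral_layer n \<phi> \<theta> = {x \<in> polyhedral_angle n \<phi> \<theta>.
     infdist x (frontier (polyhedral_angle n \<phi> \<theta>)) \<in> {0<..<1}}"

end

theory Submission
  imports Defs "HOL-Computational_Algebra.Polynomial"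
begin

text \<open>
  With \<open>e\<^sub>j = (cos \<phi>\<^sub>j, sin \<phi>\<^sub>j)\<close> and \<open>M(x) = max\<^sub>j e\<^sub>j \<cdot> (x\<^sub>1, x\<^sub>2)\<close>, the distance from a point of the
  angle to its boundary is \<open>d = x\<^sub>3 sin \<theta> - cos \<theta> M(x)\<close>, so the layer is \<open>0 < d < 1\<close>
  (lemma \<open>polyhedral_layer_eq\<close>).  Map the layer with angle \<open>\<theta>\<close> to the one with angle \<open>\<sigma>\<close> by keeping \<open>d\<close>
  and multiplying \<open>(x\<^sub>1, x\<^sub>2)\<close> by \<open>cos \<sigma> / cos \<theta>\<close>.  This map has a constant Jacobian.  On the points
  nearest to a given face it is linear, and in Cartesian coordinates adapted to the face (its normal,
  its horizontal direction and its line of steepest ascent) it is diagonal with the entries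
  \<open>1\<close>, \<open>cos \<sigma> / cos \<theta>\<close> and \<open>tan \<theta> / tan \<sigma>\<close>, all at most \<open>1\<close>.  Composition with it therefore changes
  the squared \<open>L\<^sub>2\<close> norm by a constant factor and does not increase the Rayleigh quotient, and the
  variational principle gives the inequality between the eigenvalues.

  The map is only piecewise linear.  It is replaced by a diffeomorphism in which \<open>M\<close> is smoothed to
  \<open>\<delta> ln (\<Sum>\<^sub>j exp (e\<^sub>j \<cdot> x / \<delta>))\<close>: the Jacobian stays the same constant, and the contraction estimate
  (lemma \<open>contraction_real\<close>) uses only that the gradient, a convex combination of the \<open>e\<^sub>j\<close>, has length
  at most \<open>1\<close>.  A test function on the second layer pulls back to a test function on the first one as
  soon as \<open>\<delta>\<close> is small compared with the distance from its support to the boundary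
  (lemma \<open>layer_transport\<close>).  So it suffices to transport the span of finitely many test functions
  close to the first \<open>j\<close> eigenfunctions (lemma \<open>approximate_family\<close>).

  On the spectral side one needs that a \<open>j\<close>-dimensional space on which the Rayleigh quotient is at most
  \<open>\<Lambda>\<close>, where \<open>\<Lambda>\<close> is below the threshold, forces \<open>j\<close> eigenvalues in \<open>(-\<infinity>, \<Lambda>]\<close>
  (theorem \<open>minmax_upper\<close>).  If there are fewer, some vector of the space is orthogonal to all the
  eigenvectors found so far, and lemma \<open>bottom_is_eigenvalue\<close> shows that the infimum of the Rayleigh
  quotient over their orthogonal complement is a further eigenvalue.  The resolvents used there exist
  because the spectrum below the threshold consists of isolated points.  That the Dirichlet form is
  sesquilinear rests on the uniqueness of weak derivatives, a consequence of lemma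
  \<open>fundamental_lemma\<close>.
\<close>

section \<open>The space \<open>L\<^sub>2\<close>\<close>

lemma L2_measurable: "f \<in> L2 M \<Longrightarrow> f \<in> borel_measurable M"
  by (simp add: L2_def)

lemma L2_sq_integrable: "f \<in> L2 M \<Longrightarrow> integrable M (\<lambda>x. (cmod (f x))\<^sup>2)"
  by (simp add: L2_def)

lemma L2_inner_integrable:
  assumes f: "f \<in> L2 M" and g: "g \<in> L2 M"
  shows "integrable M (\<lambda>x. f x * cnj (g x))"
proof (rule Bochner_Integration.integrable_bound)
  show "integrable M (\<lambda>x. (cmod (f x))\<^sup>2 + (cmod (g x))\<^sup>2)"
    using f g by (intro Bochner_Integration.integrable_add L2_sq_integrable)
  have [measurable]: "f \<in> borel_measurable M" "g \<in> borel_measurable M"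
    using f g by (auto simp: L2_measurable)
  show "(\<lambda>x. f x * cnj (g x)) \<in> borel_measurable M"
  proof (rule borel_measurable_times)
    show "(\<lambda>x. cnj (g x)) \<in> borel_measurable M"
      by (rule borel_measurable_continuous_on[where f=cnj]) (auto intro: continuous_intros)
  qed simp
  have "cmod (f x) * cmod (g x) \<le> (cmod (f x))\<^sup>2 + (cmod (g x))\<^sup>2" for x
  proof -
    have "0 \<le> (cmod (f x) - cmod (g x))\<^sup>2" "0 \<le> cmod (f x) * cmod (g x)" by simp_all
    then show ?thesis by (simp only: power2_diff)
  qed
  then show "AE x in M. norm (f x * cnj (g x)) \<le> norm ((cmod (f x))\<^sup>2 + (cmod (g x))\<^sup>2)"
    by (intro AE_I2) (simp add: norm_mult)
qed

lemma L2_lin: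
  assumes f: "f \<in> L2 M" and g: "g \<in> L2 M"
  shows "(\<lambda>x. c * f x + d * g x) \<in> L2 M"
proof -
  have [measurable]: "f \<in> borel_measurable M" "g \<in> borel_measurable M"
    using f g by (auto simp: L2_measurable)
  have "integrable M (\<lambda>x. (cmod (c * f x + d * g x))\<^sup>2)"
  proof (rule Bochner_Integration.integrable_bound)
    show "integrable M (\<lambda>x. 2 * (cmod c)\<^sup>2 * (cmod (f x))\<^sup>2 + 2 * (cmod d)\<^sup>2 * (cmod (g x))\<^sup>2)"
      using f g by (intro Bochner_Integration.integrable_add integrable_mult_right L2_sq_integrable)
    have "(cmod (c * f x + d * g x))\<^sup>2 \<le> 2 * (cmod c)\<^sup>2 * (cmod (f x))\<^sup>2 + 2 * (cmod d)\<^sup>2 * (cmod (g x))\<^sup>2" for x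
    proof -
      let ?p = "cmod (c * f x)" and ?q = "cmod (d * g x)"
      have "(cmod (c * f x + d * g x))\<^sup>2 \<le> (?p + ?q)\<^sup>2"
        by (intro power_mono norm_triangle_ineq) simp
      also have "\<dots> \<le> 2 * ?p\<^sup>2 + 2 * ?q\<^sup>2"
        using zero_le_power2[of "?p - ?q"] by (simp add: power2_diff power2_sum)
      finally show ?thesis by (simp add: norm_mult power_mult_distrib)
    qed
    then show "AE x in M. norm ((cmod (c * f x + d * g x))\<^sup>2)
        \<le> norm (2 * (cmod c)\<^sup>2 * (cmod (f x))\<^sup>2 + 2 * (cmod d)\<^sup>2 * (cmod (g x))\<^sup>2)"
      by (intro AE_I2) simp
  qed simp
  then show ?thesis by (simp add: L2_def)
qed

lemma L2_zero [simp]: "(\<lambda>x. 0) \<in> L2 M"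
  by (simp add: L2_def)

lemma L2_add: "f \<in> L2 M \<Longrightarrow> g \<in> L2 M \<Longrightarrow> (\<lambda>x. f x + g x) \<in> L2 M"
  using L2_lin[of f M g 1 1] by simp

lemma L2_diff: "f \<in> L2 M \<Longrightarrow> g \<in> L2 M \<Longrightarrow> (\<lambda>x. f x - g x) \<in> L2 M"
  using L2_lin[of f M g 1 "-1"] by simp

lemma L2_scale: "f \<in> L2 M \<Longrightarrow> (\<lambda>x. c * f x) \<in> L2 M"
  using L2_lin[of f M f c 0] by simp

lemma L2_sum:
  assumes "\<And>i. i \<in> I \<Longrightarrow> f i \<in> L2 M"
  shows "(\<lambda>x. \<Sum>i\<in>I. c i * f i x) \<in> L2 M"
  using assms
proof (induction I rule: infinite_finite_induct)
  case (insert i I)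
  then have "(\<lambda>x. c i * f i x + 1 * (\<Sum>i\<in>I. c i * f i x)) \<in> L2 M"
    by (intro L2_lin) auto
  then show ?case using insert by simp
qed simp_all

lemma L2_inner_lin_left:
  assumes "f \<in> L2 M" "g \<in> L2 M" "h \<in> L2 M"
  shows "L2_inner M (\<lambda>x. c * f x + d * g x) h = c * L2_inner M f h + d * L2_inner M g h"
proof -
  have "L2_inner M (\<lambda>x. c * f x + d * g x) h
      = (LINT x|M. c * (f x * cnj (h x)) + d * (g x * cnj (h x)))"
    unfolding L2_inner_def by (intro arg_cong[where f="integral\<^sup>L M"]) (auto simp: algebra_simps)
  also have "\<dots> = c * L2_inner M f h + d * L2_inner M g h"
    unfolding L2_inner_def using assms
    by (subst Bochner_Integration.integral_add)
       (auto intro!: integrable_mult_right L2_inner_integrable)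
  finally show ?thesis .
qed

lemma L2_inner_commute: "L2_inner M g f = cnj (L2_inner M f g)"
  unfolding L2_inner_def
  by (subst Bochner_Integration.integral_cnj[symmetric]) (simp add: mult.commute)

lemma L2_inner_diff_left:
  assumes "f \<in> L2 M" "g \<in> L2 M" "h \<in> L2 M"
  shows "L2_inner M (\<lambda>x. f x - g x) h = L2_inner M f h - L2_inner M g h"
  using L2_inner_lin_left[OF assms, of 1 "-1"] by simp

lemma L2_inner_scale_left:
  assumes "f \<in> L2 M" "h \<in> L2 M"
  shows "L2_inner M (\<lambda>x. c * f x) h = c * L2_inner M f h"
  using L2_inner_lin_left[of f M f h c 0] assms by simp

lemma L2_inner_lin_right:
  assumes "f \<in> L2 M" "g \<in> L2 M" "h \<in> L2 M"
  shows "L2_inner M h (\<lambda>x. c * f x + d * g x) = cnj c * L2_inner M h f + cnj d * L2_inner M h g"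
  by (subst (1 2 3) L2_inner_commute) (simp add: L2_inner_lin_left assms)

lemma L2_inner_diff_right:
  assumes "f \<in> L2 M" "g \<in> L2 M" "h \<in> L2 M"
  shows "L2_inner M h (\<lambda>x. f x - g x) = L2_inner M h f - L2_inner M h g"
  using L2_inner_lin_right[OF assms, of 1 "-1"] by simp

lemma L2_inner_scale_right:
  assumes "f \<in> L2 M" "h \<in> L2 M"
  shows "L2_inner M h (\<lambda>x. c * f x) = cnj c * L2_inner M h f"
  using L2_inner_lin_right[of f M f h c 0] assms by simp

lemma L2_inner_sum_left:
  assumes "\<And>i. i \<in> I \<Longrightarrow> f i \<in> L2 M" "h \<in> L2 M"
  shows "L2_inner M (\<lambda>x. \<Sum>i\<in>I. c i * f i x) h = (\<Sum>i\<in>I. c i * L2_inner M (f i) h)"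
  using assms
proof (induction I rule: infinite_finite_induct)
  case (insert i I)
  then have "L2_inner M (\<lambda>x. c i * f i x + 1 * (\<Sum>i\<in>I. c i * f i x)) h
     = c i * L2_inner M (f i) h + 1 * L2_inner M (\<lambda>x. \<Sum>i\<in>I. c i * f i x) h"
    by (intro L2_inner_lin_left L2_sum) auto
  then show ?case using insert by simp
qed (simp_all add: L2_inner_def)

lemma L2_inner_sum_right:
  assumes "\<And>i. i \<in> I \<Longrightarrow> f i \<in> L2 M" "h \<in> L2 M"
  shows "L2_inner M h (\<lambda>x. \<Sum>i\<in>I. c i * f i x) = (\<Sum>i\<in>I. cnj (c i) * L2_inner M h (f i))"
  by (subst (1 2) L2_inner_commute) (simp add: L2_inner_sum_left assms)

lemma L2_norm_nonneg [simp]: "0 \<le> L2_norm M f"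
  by (simp add: L2_norm_def)

lemma L2_norm_sq: "(L2_norm M f)\<^sup>2 = (LINT x|M. (cmod (f x))\<^sup>2)"
  by (simp add: L2_norm_def)

lemma L2_inner_self: "L2_inner M f f = complex_of_real ((L2_norm M f)\<^sup>2)"
  unfolding L2_norm_sq L2_inner_def
  by (subst integral_complex_of_real[symmetric]) (simp add: complex_mult_cnj cmod_power2)

lemma L2_inner_cong:
  assumes "AE x in M. f x = f' x" "AE x in M. g x = g' x"
    "f \<in> borel_measurable M" "f' \<in> borel_measurable M" "g \<in> borel_measurable M" "g' \<in> borel_measurable M"
  shows "L2_inner M f g = L2_inner M f' g'"
proof -
  have cnj: "(\<lambda>x. cnj (h x)) \<in> borel_measurable M" if "h \<in> borel_measurable M" for h
    using that by (rule borel_measurable_continuous_on[where f=cnj, rotated]) (auto intro: continuous_intros)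
  show ?thesis
  unfolding L2_inner_def using assms
  by (intro integral_cong_AE borel_measurable_times cnj) auto
qed

lemma L2_norm_cong:
  assumes "AE x in M. f x = f' x" "f \<in> borel_measurable M" "f' \<in> borel_measurable M"
  shows "L2_norm M f = L2_norm M f'"
proof -
  have "of_real ((L2_norm M f)\<^sup>2) = (of_real ((L2_norm M f')\<^sup>2) :: complex)"
    unfolding L2_inner_self[symmetric] by (intro L2_inner_cong assms)
  then show ?thesis
    using of_real_eq_iff L2_norm_nonneg power2_eq_iff_nonneg by metis
qed

lemma L2_norm_eq_0:
  assumes "f \<in> L2 M"
  shows "L2_norm M f = 0 \<longleftrightarrow> (AE x in M. f x = 0)"
proof -
  have "L2_norm M f = 0 \<longleftrightarrow> (LINT x|M. (cmod (f x))\<^sup>2) = 0"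
    by (simp add: L2_norm_def)
  also have "\<dots> \<longleftrightarrow> (AE x in M. (cmod (f x))\<^sup>2 = 0)"
    by (rule integral_nonneg_eq_0_iff_AE[OF L2_sq_integrable[OF assms]]) simp
  finally show ?thesis by simp
qed

lemma L2_norm_diff_sq:
  assumes f: "f \<in> L2 M" and g: "g \<in> L2 M"
  shows "(L2_norm M (\<lambda>x. f x - g x))\<^sup>2
    = (L2_norm M f)\<^sup>2 - 2 * Re (L2_inner M f g) + (L2_norm M g)\<^sup>2"
proof -
  have "complex_of_real ((L2_norm M (\<lambda>x. f x - g x))\<^sup>2)
     = L2_inner M f f - L2_inner M f g - cnj (L2_inner M f g) + L2_inner M g g"
    unfolding L2_inner_self[symmetric] using f g
    by (simp add: L2_inner_diff_left L2_inner_diff_right L2_diff flip: L2_inner_commute)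
  then have "Re (complex_of_real ((L2_norm M (\<lambda>x. f x - g x))\<^sup>2))
     = Re (L2_inner M f f - L2_inner M f g - cnj (L2_inner M f g) + L2_inner M g g)" by simp
  then show ?thesis by (simp add: L2_inner_self)
qed

text \<open>This form of the Cauchy-Schwarz inequality serves both the inner product and the quadratic forms
  \<open>a - c\<close> that are nonnegative on a subspace.\<close>

lemma Cauchy_Schwarz_discriminant:
  fixes \<alpha> \<gamma> :: real and \<beta> :: complex
  assumes pos: "\<And>t::complex. 0 \<le> \<alpha> - 2 * Re (cnj t * \<beta>) + (cmod t)\<^sup>2 * \<gamma>" and "0 \<le> \<gamma>"
  shows "(cmod \<beta>)\<^sup>2 \<le> \<alpha> * \<gamma>"
proof (cases "\<gamma> = 0")
  case True
  show ?thesis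
  proof (rule ccontr)
    assume "\<not> ?thesis"
    then have b: "0 < (cmod \<beta>)\<^sup>2" using True by simp
    define s where "s = (\<bar>\<alpha>\<bar> + 1) / (2 * (cmod \<beta>)\<^sup>2)"
    have "Re (cnj (of_real s * \<beta>) * \<beta>) = s * (cmod \<beta>)\<^sup>2"
      unfolding cmod_power2 by (simp add: power2_eq_square algebra_simps)
    then have "0 \<le> \<alpha> - 2 * (s * (cmod \<beta>)\<^sup>2)"
      using pos[of "of_real s * \<beta>"] True by simp
    moreover have "2 * (s * (cmod \<beta>)\<^sup>2) = \<bar>\<alpha>\<bar> + 1"
      using b by (simp add: s_def field_simps)
    ultimately show False by linarith
  qed
next
  case False
  then have g: "0 < \<gamma>" using assms by simp
  have "Re (cnj (\<beta> / of_real \<gamma>) * \<beta>) = (cmod \<beta>)\<^sup>2 / \<gamma>"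
    unfolding cmod_power2 by (simp add: power2_eq_square add_divide_distrib)
  moreover have "(cmod (\<beta> / of_real \<gamma>))\<^sup>2 * \<gamma> = (cmod \<beta>)\<^sup>2 / \<gamma>"
    using g by (simp add: norm_divide power_divide power2_eq_square)
  ultimately have "0 \<le> \<alpha> - (cmod \<beta>)\<^sup>2 / \<gamma>"
    using pos[of "\<beta> / of_real \<gamma>"] by linarith
  then show ?thesis using g by (simp add: field_simps)
qed

lemma L2_norm_scale: "L2_norm M (\<lambda>x. c * f x) = cmod c * L2_norm M f"
  by (simp add: L2_norm_def norm_mult power_mult_distrib real_sqrt_mult)

lemma L2_Cauchy_Schwarz:
  assumes f: "f \<in> L2 M" and g: "g \<in> L2 M"
  shows "cmod (L2_inner M f g) \<le> L2_norm M f * L2_norm M g"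
proof -
  have "(cmod (L2_inner M f g))\<^sup>2 \<le> (L2_norm M f)\<^sup>2 * (L2_norm M g)\<^sup>2"
  proof (rule Cauchy_Schwarz_discriminant)
    fix t :: complex
    have "0 \<le> (L2_norm M (\<lambda>x. f x - t * g x))\<^sup>2" by simp
    also have "\<dots> = (L2_norm M f)\<^sup>2 - 2 * Re (cnj t * L2_inner M f g) + (cmod t)\<^sup>2 * (L2_norm M g)\<^sup>2"
      using f g by (subst L2_norm_diff_sq) (auto simp: L2_scale L2_inner_scale_right L2_norm_scale power_mult_distrib)
    finally show "0 \<le> (L2_norm M f)\<^sup>2 - 2 * Re (cnj t * L2_inner M f g) + (cmod t)\<^sup>2 * (L2_norm M g)\<^sup>2" .
  qed simp
  then show ?thesis
    by (metis L2_norm_nonneg mult_nonneg_nonneg power2_le_imp_le power_mult_distrib)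
qed

lemma L2_Cauchy_Schwarz_Re:
  assumes "f \<in> L2 M" "g \<in> L2 M"
  shows "Re (L2_inner M f g) \<le> L2_norm M f * L2_norm M g"
  using L2_Cauchy_Schwarz[OF assms] complex_Re_le_cmod order_trans by blast

lemma L2_norm_diff_triangle:
  assumes f: "f \<in> L2 M" and g: "g \<in> L2 M"
  shows "L2_norm M (\<lambda>x. f x - g x) \<le> L2_norm M f + L2_norm M g"
proof (rule power2_le_imp_le)
  have "L2_inner M f g = - L2_inner M (\<lambda>x. (-1) * f x) g"
    using L2_inner_scale_left[OF f g, of "-1"] by simp
  then have "- Re (L2_inner M f g) \<le> L2_norm M f * L2_norm M g"
    using L2_Cauchy_Schwarz_Re[OF L2_scale[OF f, of "-1"] g] L2_norm_scale[of M "-1" f] by simp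
  then show "(L2_norm M (\<lambda>x. f x - g x))\<^sup>2 \<le> (L2_norm M f + L2_norm M g)\<^sup>2"
    by (simp add: L2_norm_diff_sq[OF f g] power2_sum)
qed simp

lemma L2_norm_add_triangle:
  assumes f: "f \<in> L2 M" and g: "g \<in> L2 M"
  shows "L2_norm M (\<lambda>x. f x + g x) \<le> L2_norm M f + L2_norm M g"
  using L2_norm_diff_triangle[OF f L2_scale[OF g, of "-1"]] L2_norm_scale[of M "-1" g] by simp

lemma L2_norm_sum_triangle:
  assumes "\<And>i. i \<in> I \<Longrightarrow> f i \<in> L2 M"
  shows "L2_norm M (\<lambda>x. \<Sum>i\<in>I. c i * f i x) \<le> (\<Sum>i\<in>I. cmod (c i) * L2_norm M (f i))"
  using assms
proof (induction I rule: infinite_finite_induct)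
  case (insert i I)
  have "L2_norm M (\<lambda>x. c i * f i x + (\<Sum>i\<in>I. c i * f i x))
     \<le> L2_norm M (\<lambda>x. c i * f i x) + L2_norm M (\<lambda>x. \<Sum>i\<in>I. c i * f i x)"
    using insert by (intro L2_norm_add_triangle L2_scale L2_sum) auto
  then show ?case using insert by (fastforce simp: L2_norm_scale)
qed (simp_all add: L2_norm_def)

text \<open>A positive weight \<open>w\<close> in \<open>L\<^sub>2\<close> turns an \<open>L\<^sub>2\<close>-Cauchy sequence \<open>f\<^sub>n\<close> into an \<open>L\<^sub>1\<close>-Cauchy
  sequence \<open>w f\<^sub>n\<close>, which has an almost everywhere convergent subsequence; Fatou's lemma then gives
  convergence in \<open>L\<^sub>2\<close>.\<close>

lemma L2_complete:
  assumes "sigma_finite_measure M" and f: "\<And>n::nat. f n \<in> L2 M"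
    and cauchy: "\<And>e. e > 0 \<Longrightarrow> \<exists>N. \<forall>i\<ge>N. \<forall>j\<ge>N. L2_norm M (\<lambda>x. f i x - f j x) < e"
  obtains g where "g \<in> L2 M" "(\<lambda>n. L2_norm M (\<lambda>x. f n x - g x)) \<longlonglongrightarrow> 0"
proof -
  interpret sigma_finite_measure M by fact
  obtain w :: "'a \<Rightarrow> real" where w: "w \<in> borel_measurable M" "\<And>x. w x > 0" "\<And>x. w x \<le> 1" "integrable M w"
    using obtain_positive_integrable_function by blast
  have [measurable]: "w \<in> borel_measurable M" "f n \<in> borel_measurable M" for n
    using w f by (auto simp: L2_measurable)
  define W where "W = (\<lambda>x. complex_of_real (w x))"
  have W: "W \<in> L2 M"
  proof -
    have "integrable M (\<lambda>x. (w x)\<^sup>2)"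
    proof (rule Bochner_Integration.integrable_bound[OF w(4)])
      show "AE x in M. norm ((w x)\<^sup>2) \<le> norm (w x)"
        using w(2,3) by (intro AE_I2) (simp add: power2_eq_square mult_left_le less_imp_le)
    qed simp
    then show ?thesis by (simp add: L2_def W_def)
  qed
  have intW: "integrable M (\<lambda>x. f n x * W x)" for n
    using L2_inner_integrable[OF f W] by (simp add: W_def)
  have cauchy1: "\<exists>N. \<forall>i\<ge>N. \<forall>j\<ge>N. (LINT x|M. norm (f i x * W x - f j x * W x)) < e" if "e > 0" for e
  proof -
    have pos: "0 < e / (L2_norm M W + 1)" using that by (simp add: add_nonneg_pos)
    obtain N where N: "\<And>i j. i \<ge> N \<Longrightarrow> j \<ge> N \<Longrightarrow> L2_norm M (\<lambda>x. f i x - f j x) < e / (L2_norm M W + 1)"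
      using cauchy[OF pos] by blast
    have "(LINT x|M. norm (f i x * W x - f j x * W x)) < e" if "i \<ge> N" "j \<ge> N" for i j
    proof -
      let ?h = "\<lambda>x. complex_of_real (cmod (f i x - f j x))"
      have h: "?h \<in> L2 M" using L2_diff[OF f f, of i j] by (simp add: L2_def)
      have "complex_of_real (LINT x|M. norm (f i x * W x - f j x * W x)) = L2_inner M ?h W"
        unfolding L2_inner_def integral_complex_of_real[symmetric]
        using w(2) by (intro arg_cong[where f="integral\<^sup>L M"])
          (auto simp: W_def norm_mult less_imp_le simp flip: left_diff_distrib)
      then have "(LINT x|M. norm (f i x * W x - f j x * W x)) \<le> L2_norm M ?h * L2_norm M W"
        using L2_Cauchy_Schwarz_Re[OF h W] by (metis Re_complex_of_real)
      also have "L2_norm M ?h = L2_norm M (\<lambda>x. f i x - f j x)" by (simp add: L2_norm_def)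
      also have "\<dots> * L2_norm M W \<le> L2_norm M (\<lambda>x. f i x - f j x) * (L2_norm M W + 1)"
        by (intro mult_left_mono) auto
      also have "\<dots> < e"
        using N[OF that] by (simp add: pos_less_divide_eq add_nonneg_pos)
      finally show ?thesis .
    qed
    then show ?thesis by blast
  qed
  obtain r where r: "strict_mono r" "AE x in M. Cauchy (\<lambda>i. f (r i) x * W x)"
    using cauchy_L1_AE_cauchy_subseq[OF intW cauchy1] by blast
  define g where "g x = lim (\<lambda>i. f (r i) x)" for x
  have gm [measurable]: "g \<in> borel_measurable M"
    unfolding g_def by measurable
  have conv: "AE x in M. (\<lambda>i. f (r i) x) \<longlonglongrightarrow> g x"
    using r(2)
  proof eventually_elim
    case (elim x)
    have W0: "W x \<noteq> 0" using w(2)[of x] by (simp add: W_def)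
    from elim have "convergent (\<lambda>i. f (r i) x * W x)" by (rule Cauchy_convergent)
    then obtain l where "(\<lambda>i. f (r i) x * W x) \<longlonglongrightarrow> l" by (auto simp: convergent_def)
    then have "(\<lambda>i. f (r i) x * W x / W x) \<longlonglongrightarrow> l / W x" using W0 by (intro tendsto_divide) auto
    then have "(\<lambda>i. f (r i) x) \<longlonglongrightarrow> l / W x" using W0 by simp
    then show ?case unfolding g_def by (metis limI)
  qed
  have bound: "(\<integral>\<^sup>+x. ennreal ((cmod (f n x - g x))\<^sup>2) \<partial>M) \<le> ennreal (e\<^sup>2)"
    if e: "e > 0" and N: "\<And>j. j \<ge> N \<Longrightarrow> L2_norm M (\<lambda>x. f n x - f j x) < e" for n N e
  proof -
    have "(\<integral>\<^sup>+x. ennreal ((cmod (f n x - g x))\<^sup>2) \<partial>M)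
        = (\<integral>\<^sup>+x. liminf (\<lambda>i. ennreal ((cmod (f n x - f (r i) x))\<^sup>2)) \<partial>M)"
    proof (rule nn_integral_cong_AE)
      show "AE x in M. ennreal ((cmod (f n x - g x))\<^sup>2) = liminf (\<lambda>i. ennreal ((cmod (f n x - f (r i) x))\<^sup>2))"
        using conv
      proof eventually_elim
        case (elim x)
        have "(\<lambda>i. ennreal ((cmod (f n x - f (r i) x))\<^sup>2)) \<longlonglongrightarrow> ennreal ((cmod (f n x - g x))\<^sup>2)"
          using elim by (intro tendsto_intros tendsto_ennrealI)
        then show ?case by (rule lim_imp_Liminf[symmetric, rotated]) simp
      qed
    qed
    also have "\<dots> \<le> liminf (\<lambda>i. \<integral>\<^sup>+x. ennreal ((cmod (f n x - f (r i) x))\<^sup>2) \<partial>M)"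
      by (intro nn_integral_liminf) measurable
    also have "\<dots> \<le> ennreal (e\<^sup>2)"
    proof (rule Liminf_le)
      show "\<forall>\<^sub>F i in sequentially. (\<integral>\<^sup>+x. ennreal ((cmod (f n x - f (r i) x))\<^sup>2) \<partial>M) \<le> ennreal (e\<^sup>2)"
        using eventually_ge_at_top[of N]
      proof eventually_elim
        case (elim i)
        have "(\<integral>\<^sup>+x. ennreal ((cmod (f n x - f (r i) x))\<^sup>2) \<partial>M)
            = ennreal ((L2_norm M (\<lambda>x. f n x - f (r i) x))\<^sup>2)"
          unfolding L2_norm_sq
          by (rule nn_integral_eq_integral) (auto intro!: L2_sq_integrable L2_diff f)
        also have "\<dots> \<le> ennreal (e\<^sup>2)"
          using N[of "r i"] elim seq_suble[OF r(1), of i] e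
          by (intro ennreal_leI power_mono) (auto intro: less_imp_le)
        finally show ?case .
      qed
    qed simp
    finally show ?thesis .
  qed
  have dL2: "(\<lambda>x. f n x - g x) \<in> L2 M" and dn: "L2_norm M (\<lambda>x. f n x - g x) \<le> e"
    if e: "e > 0" and N: "\<And>j. j \<ge> N \<Longrightarrow> L2_norm M (\<lambda>x. f n x - f j x) < e" for n N e
  proof -
    have b: "(\<integral>\<^sup>+x. ennreal ((cmod (f n x - g x))\<^sup>2) \<partial>M) \<le> ennreal (e\<^sup>2)" using bound[OF that] .
    then have i: "integrable M (\<lambda>x. (cmod (f n x - g x))\<^sup>2)"
      by (intro integrableI_bounded) (auto simp: less_top[symmetric] top_unique)
    then show "(\<lambda>x. f n x - g x) \<in> L2 M" by (simp add: L2_def)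
    have "ennreal ((L2_norm M (\<lambda>x. f n x - g x))\<^sup>2) \<le> ennreal (e\<^sup>2)"
      unfolding L2_norm_sq using b by (subst nn_integral_eq_integral[OF i, symmetric]) auto
    then show "L2_norm M (\<lambda>x. f n x - g x) \<le> e"
      using e by (simp add: power2_le_iff_abs_le)
  qed
  show ?thesis
  proof
    obtain N where "\<And>i j. i \<ge> N \<Longrightarrow> j \<ge> N \<Longrightarrow> L2_norm M (\<lambda>x. f i x - f j x) < 1"
      using cauchy[of 1] by auto
    from dL2[of 1 N N, OF _ this] have "(\<lambda>x. f N x - g x) \<in> L2 M" by simp
    from L2_diff[OF f[of N] this] show "g \<in> L2 M" by simp
    show "(\<lambda>n. L2_norm M (\<lambda>x. f n x - g x)) \<longlonglongrightarrow> 0"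
    proof (rule LIMSEQ_I)
      fix e :: real assume "e > 0"
      then have e2: "e / 2 > 0" by simp
      obtain N where N: "\<And>i j. i \<ge> N \<Longrightarrow> j \<ge> N \<Longrightarrow> L2_norm M (\<lambda>x. f i x - f j x) < e / 2"
        using cauchy[OF e2] by blast
      have "L2_norm M (\<lambda>x. f n x - g x) \<le> e / 2" if "n \<ge> N" for n
        using dn[OF e2, of N n] N[OF that] by blast
      then show "\<exists>no. \<forall>n\<ge>no. norm (L2_norm M (\<lambda>x. f n x - g x) - 0) < e"
        using \<open>e > 0\<close> by (intro exI[of _ N]) fastforce
    qed
  qed
qed

section \<open>Operators generated by forms\<close>

lemma homogeneous_system_nontrivial:
  fixes a :: "nat \<Rightarrow> 'b \<Rightarrow> complex"
  assumes "finite J" "p < card J"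
  shows "\<exists>c. (\<exists>k\<in>J. c k \<noteq> 0) \<and> (\<forall>i<p. (\<Sum>k\<in>J. c k * a i k) = 0)"
  using assms
proof (induction p arbitrary: J a)
  case 0
  then have "J \<noteq> {}" by auto
  then show ?case by (intro exI[of _ "\<lambda>_. 1"]) auto
next
  case (Suc p)
  show ?case
  proof (cases "\<forall>k\<in>J. a p k = 0")
    case True
    obtain c where c: "\<exists>k\<in>J. c k \<noteq> 0" "\<forall>i<p. (\<Sum>k\<in>J. c k * a i k) = 0"
      using Suc.IH[of J a] Suc.prems by auto
    have "(\<Sum>k\<in>J. c k * a i k) = 0" if "i < Suc p" for i
      using c(2) True that by (cases "i = p") auto
    with c(1) show ?thesis by blast
  next
    case False
    then obtain k0 where k0: "k0 \<in> J" "a p k0 \<noteq> 0" by blast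
    let ?J = "J - {k0}"
    define a' where "a' i k = a i k - a i k0 * a p k / a p k0" for i k
    have "p < card ?J" using Suc.prems k0 by simp
    then obtain c where c: "\<exists>k\<in>?J. c k \<noteq> 0" "\<forall>i<p. (\<Sum>k\<in>?J. c k * a' i k) = 0"
      using Suc.IH[of ?J a'] Suc.prems by auto
    define c' where "c' = c(k0 := - (\<Sum>k\<in>?J. c k * a p k) / a p k0)"
    have split: "(\<Sum>k\<in>J. c' k * a i k) = c' k0 * a i k0 + (\<Sum>k\<in>?J. c k * a i k)" for i
      using Suc.prems(1) k0(1) by (subst sum.remove[of J k0]) (auto simp: c'_def)
    have "(\<Sum>k\<in>J. c' k * a i k) = 0" if "i < Suc p" for i
    proof (cases "i = p")
      case True
      then show ?thesis unfolding split using k0(2) by (simp add: c'_def)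
    next
      case False
      with that have "i < p" by simp
      then have "0 = (\<Sum>k\<in>?J. c k * a' i k)" using c(2) by simp
      also have "\<dots> = (\<Sum>k\<in>?J. c k * a i k - (c k * a p k) * (a i k0 / a p k0))"
        by (intro sum.cong) (auto simp: a'_def algebra_simps)
      also have "\<dots> = (\<Sum>k\<in>?J. c k * a i k) - (\<Sum>k\<in>?J. c k * a p k) * (a i k0 / a p k0)"
        unfolding sum_subtractf by (simp only: sum_distrib_right)
      finally show ?thesis unfolding split by (simp add: c'_def)
    qed
    moreover have "\<exists>k\<in>J. c' k \<noteq> 0" using c(1) by (auto simp: c'_def)
    ultimately show ?thesis by blast
  qed
qed

lemma Re_of_real_mult: "Re (of_real r * z) = r * Re z"
  by simp

text \<open>The setting of the first representation theorem; the Dirichlet form on \<open>H\<^sub>0\<^sup>1\<close> is the instance used below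
  (lemma \<open>dirichlet_form_operator\<close>).\<close>

locale form_operator = sigma_finite_measure M for M :: "'a measure" +
  fixes H :: "('a \<Rightarrow> complex) set" and a :: "('a \<Rightarrow> complex) \<Rightarrow> ('a \<Rightarrow> complex) \<Rightarrow> complex"
  assumes H_L2: "u \<in> H \<Longrightarrow> u \<in> L2 M"
    and H_zero: "(\<lambda>x. 0) \<in> H"
    and H_lin: "u \<in> H \<Longrightarrow> v \<in> H \<Longrightarrow> (\<lambda>x. c * u x + d * v x) \<in> H"
    and a_lin: "u \<in> H \<Longrightarrow> v \<in> H \<Longrightarrow> w \<in> H \<Longrightarrow> a (\<lambda>x. c * u x + d * v x) w = c * a u w + d * a v w"
    and a_commute: "a v u = cnj (a u v)"
    and a_nonneg: "0 \<le> Re (a u u)"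
begin

abbreviation ip :: "('a \<Rightarrow> complex) \<Rightarrow> ('a \<Rightarrow> complex) \<Rightarrow> complex" where "ip \<equiv> L2_inner M"
abbreviation nrm :: "('a \<Rightarrow> complex) \<Rightarrow> real" where "nrm \<equiv> L2_norm M"

definition A :: "'a L2_operator" where
  "A = {(u, w). u \<in> H \<and> w \<in> L2 M \<and> (\<forall>v\<in>H. a u v = ip w v)}"

lemma a_lin_right:
  assumes "u \<in> H" "v \<in> H" "w \<in> H"
  shows "a w (\<lambda>x. c * u x + d * v x) = cnj c * a w u + cnj d * a w v"
  by (subst (1 2 3) a_commute) (simp add: a_lin assms)

lemma A_H: "(u, w) \<in> A \<Longrightarrow> u \<in> H"
  and A_L2: "(u, w) \<in> A \<Longrightarrow> w \<in> L2 M"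
  and A_form: "(u, w) \<in> A \<Longrightarrow> v \<in> H \<Longrightarrow> a u v = ip w v"
  by (auto simp: A_def)

lemma A_dom_L2: "(u, w) \<in> A \<Longrightarrow> u \<in> L2 M"
  using A_H H_L2 by blast

lemma A_lin:
  assumes "(u, w) \<in> A" "(v, z) \<in> A"
  shows "(\<lambda>x. c * u x + d * v x, \<lambda>x. c * w x + d * z x) \<in> A"
  using assms by (auto simp: A_def H_lin L2_lin a_lin L2_inner_lin_left H_L2)

lemma A_symmetric:
  assumes "(u, w) \<in> A" "(v, z) \<in> A"
  shows "ip w v = ip u z"
proof -
  have "ip w v = a u v" using assms A_form A_H by metis
  also have "\<dots> = cnj (a v u)" by (rule a_commute)
  also have "\<dots> = ip u z" using A_form[OF assms(2) A_H[OF assms(1)]] L2_inner_commute[of M u z] by simp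
  finally show ?thesis .
qed

lemma A_cong:
  assumes "(u, w) \<in> A" "AE x in M. w x = w' x" "w' \<in> L2 M"
  shows "(u, w') \<in> A"
proof -
  have "ip w v = ip w' v" if "v \<in> H" for v
    using assms that by (intro L2_inner_cong) (auto dest: A_L2 H_L2 L2_measurable)
  then show ?thesis using assms by (auto simp: A_def)
qed

definition regular :: "real \<Rightarrow> bool" where
  "regular c \<longleftrightarrow> complex_of_real c \<in> resolvent_set M A"

lemma regular_estimate:
  assumes "regular c"
  obtains C where "C \<ge> 0" "\<And>u f. f \<in> L2 M \<Longrightarrow> (u, \<lambda>x. of_real c * u x + f x) \<in> A \<Longrightarrow> nrm u \<le> C * nrm f"
proof -
  obtain C where C: "\<forall>(u, w) \<in> A. nrm u \<le> C * nrm (\<lambda>x. w x - of_real c * u x)"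
    using assms by (auto simp: regular_def resolvent_set_def)
  have "nrm u \<le> max 0 C * nrm f" if "(u, \<lambda>x. of_real c * u x + f x) \<in> A" for u f
  proof -
    have "nrm u \<le> C * nrm f" using C that by force
    also have "\<dots> \<le> max 0 C * nrm f" by (intro mult_right_mono) auto
    finally show ?thesis .
  qed
  then show thesis using that[of "max 0 C"] by simp
qed

lemma regular_solution:
  assumes "regular c" "f \<in> L2 M"
  shows "\<exists>u. (u, \<lambda>x. of_real c * u x + f x) \<in> A"
proof -
  obtain u w where u: "(u, w) \<in> A" "AE x in M. w x - of_real c * u x = f x"
    using assms by (auto simp: regular_def resolvent_set_def)
  have "(u, \<lambda>x. of_real c * u x + f x) \<in> A"
  proof (rule A_cong[OF u(1)])
    show "AE x in M. w x = of_real c * u x + f x"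
      using u(2) by eventually_elim (simp add: algebra_simps)
    show "(\<lambda>x. of_real c * u x + f x) \<in> L2 M"
      by (intro L2_add L2_scale A_dom_L2[OF u(1)] assms)
  qed
  then show ?thesis by blast
qed

lemma resolvent_symmetric:
  assumes "(u, \<lambda>x. of_real c * u x + f x) \<in> A" "(v, \<lambda>x. of_real c * v x + g x) \<in> A" "f \<in> L2 M" "g \<in> L2 M"
  shows "ip f v = ip u g"
proof -
  have L: "u \<in> L2 M" "v \<in> L2 M" using assms A_dom_L2 by auto
  have "ip (\<lambda>x. of_real c * u x + f x) v = ip u (\<lambda>x. of_real c * v x + g x)"
    by (rule A_symmetric[OF assms(1,2)])
  then show ?thesis
    using L2_inner_lin_left[OF L(1) assms(3) L(2), of "of_real c" 1]
      L2_inner_lin_right[OF L(2) assms(4) L(1), of "of_real c" 1] by simp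
qed

lemma resolvent_lin:
  assumes "(u, \<lambda>x. of_real c * u x + f x) \<in> A" "(v, \<lambda>x. of_real c * v x + g x) \<in> A"
  shows "(\<lambda>x. p * u x + q * v x, \<lambda>x. of_real c * (p * u x + q * v x) + (p * f x + q * g x)) \<in> A"
  using A_lin[OF assms, of p q] by (simp add: algebra_simps)

text \<open>Let \<open>S = (A - c)\<^bsup>-1\<^esup>\<close> and \<open>s = \<parallel>S\<parallel>\<close>.  Vectors \<open>f\<close> of norm \<open>1\<close> that almost attain the norm satisfy
  \<open>S\<^sup>2 f \<approx> s\<^sup>2 f\<close>, because \<open>S\<close> is symmetric; so \<open>(S - s) (S + s) f \<approx> 0\<close>, and one of \<open>c + 1/s\<close>, \<open>c - 1/s\<close>
  is in the spectrum.  Hence \<open>1/s \<ge> \<delta>\<close> if there is no spectrum at distance less than \<open>\<delta>\<close> from \<open>c\<close>.\<close>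

lemma regular_gap:
  assumes reg: "\<And>t. \<bar>t - c\<bar> < \<delta> \<Longrightarrow> regular t" and \<delta>: "\<delta> > 0"
    and f0: "f0 \<in> L2 M" and u0: "(u0, \<lambda>x. of_real c * u0 x + f0 x) \<in> A"
  shows "\<delta> * nrm u0 \<le> nrm f0"
proof (rule ccontr)
  assume "\<not> ?thesis"
  then have less: "nrm f0 < \<delta> * nrm u0" by simp
  define R where "R f u \<longleftrightarrow> f \<in> L2 M \<and> (u, \<lambda>x. of_real c * u x + f x) \<in> A" for f u
  have R_lin: "R (\<lambda>x. p * f x + q * g x) (\<lambda>x. p * u x + q * v x)" if "R f u" "R g v" for f g u v p q
    using that by (auto simp: R_def intro: L2_lin resolvent_lin)
  have R_L2: "u \<in> L2 M" "f \<in> L2 M" if "R f u" for f u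
    using that by (auto simp: R_def A_dom_L2)
  have R_ex: "\<exists>u. R f u" if "f \<in> L2 M" for f
    using regular_solution[OF reg[of c] that] \<delta> that by (auto simp: R_def)
  have "regular c" using reg[of c] \<delta> by simp
  then obtain C where C0: "C \<ge> 0"
      "\<And>u f. f \<in> L2 M \<Longrightarrow> (u, \<lambda>x. of_real c * u x + f x) \<in> A \<Longrightarrow> nrm u \<le> C * nrm f"
    by (rule regular_estimate) blast
  then have C: "C \<ge> 0" "\<And>f u. R f u \<Longrightarrow> nrm u \<le> C * nrm f"
    by (simp_all add: R_def)
  define Y where "Y = {nrm u | f u. R f u \<and> nrm f = 1}"
  define s where "s = Sup Y"
  have bdd: "bdd_above Y"
  proof (rule bdd_aboveI)
    show "y \<le> C" if "y \<in> Y" for y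
      using that C(2) unfolding Y_def by force
  qed
  have le_s: "nrm u \<le> s * nrm f" if "R f u" for f u
  proof (cases "nrm f = 0")
    case True
    then show ?thesis using C(2)[OF that] by simp
  next
    case False
    then have pos: "nrm f > 0" using L2_norm_nonneg[of M f] by linarith
    let ?k = "complex_of_real (1 / nrm f)"
    have "R (\<lambda>x. ?k * f x) (\<lambda>x. ?k * u x)"
      using R_lin[OF that that, of ?k 0] by simp
    moreover have "nrm (\<lambda>x. ?k * f x) = 1" "nrm (\<lambda>x. ?k * u x) = nrm u / nrm f"
      using pos by (simp_all only: L2_norm_scale) (simp_all add: norm_divide)
    ultimately have "nrm u / nrm f \<in> Y" unfolding Y_def by (intro CollectI exI[of _ "\<lambda>x. ?k * f x"] exI[of _ "\<lambda>x. ?k * u x"]) auto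
    then have "nrm u / nrm f \<le> s" unfolding s_def by (intro cSup_upper bdd)
    then show ?thesis using pos by (simp add: field_simps)
  qed
  have R0: "R f0 u0" using f0 u0 by (simp add: R_def)
  have "nrm f0 \<noteq> 0"
  proof
    assume "nrm f0 = 0"
    with C(2)[OF R0] have "nrm u0 \<le> 0" by simp
    then show False using less \<open>nrm f0 = 0\<close> \<delta> mult_nonneg_nonpos[of \<delta> "nrm u0"] by linarith
  qed
  then have f0pos: "nrm f0 > 0" using L2_norm_nonneg[of M f0] by linarith
  have "nrm f0 < (\<delta> * s) * nrm f0"
    using less mult_left_mono[OF le_s[OF R0], of \<delta>] \<delta> by (simp only: mult.assoc) linarith
  then have "1 < \<delta> * s" using f0pos by simp
  moreover have "\<delta> * s \<le> 0" if "s \<le> 0" using that \<delta> by (simp add: mult_nonneg_nonpos)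
  ultimately have spos: "s > 0" by linarith
  with \<open>1 < \<delta> * s\<close> have s: "s > 0" "1 / s < \<delta>" by (simp_all add: field_simps)
  have Yne: "Y \<noteq> {}"
  proof -
    have "nrm (\<lambda>x. complex_of_real (1 / nrm f0) * f0 x) = 1"
      using f0pos by (simp only: L2_norm_scale) (simp add: norm_divide)
    then have "nrm (\<lambda>x. complex_of_real (1 / nrm f0) * u0 x) \<in> Y"
      unfolding Y_def using R_lin[OF R0 R0, of "of_real (1 / nrm f0)" 0]
      by (intro CollectI exI[of _ "\<lambda>x. complex_of_real (1 / nrm f0) * f0 x"]
          exI[of _ "\<lambda>x. complex_of_real (1 / nrm f0) * u0 x"]) simp
    then show ?thesis by blast
  qed
  have "\<exists>f h k. R f h \<and> R h k \<and> nrm f = 1 \<and> s - 1 / real (Suc n) < nrm h" for n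
  proof -
    have "\<exists>y\<in>Y. s - 1 / real (Suc n) < y"
      unfolding s_def using Yne bdd by (subst less_cSup_iff[symmetric]) (auto simp: s_def)
    then show ?thesis unfolding Y_def using R_ex R_L2 by blast
  qed
  then obtain f h k where fhk: "\<And>n. R (f n) (h n)" "\<And>n. R (h n) (k n)" "\<And>n. nrm (f n) = 1"
    "\<And>n. s - 1 / real (Suc n) < nrm (h n)" by metis
  have L: "f n \<in> L2 M" "h n \<in> L2 M" "k n \<in> L2 M" for n
    using R_L2 fhk by blast+
  have hs: "(\<lambda>n. nrm (h n)) \<longlonglongrightarrow> s"
  proof (rule tendsto_sandwich)
    show "(\<lambda>n. s - 1 / real (Suc n)) \<longlonglongrightarrow> s"
      using tendsto_diff[OF tendsto_const LIMSEQ_inverse_real_of_nat, of s] by (simp add: inverse_eq_divide)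
    show "(\<lambda>n. s) \<longlonglongrightarrow> s" by simp
    show "\<forall>\<^sub>F n in sequentially. s - 1 / real (Suc n) \<le> nrm (h n)" by (intro always_eventually allI less_imp_le fhk(4))
    show "\<forall>\<^sub>F n in sequentially. nrm (h n) \<le> s" using le_s[OF fhk(1)] fhk(3) by simp
  qed
  define q where "q n = (\<lambda>x. k n x - of_real (s\<^sup>2) * f n x)" for n
  have qL: "q n \<in> L2 M" for n unfolding q_def by (intro L2_diff L2_scale L)
  have q_le: "(nrm (q n))\<^sup>2 \<le> s\<^sup>2 * (s\<^sup>2 - (nrm (h n))\<^sup>2)" for n
  proof -
    have "ip (k n) (f n) = ip (h n) (h n)"
      using resolvent_symmetric[of "k n" c "h n" "h n" "f n"] fhk(1,2) L by (auto simp: R_def)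
    then have "Re (ip (k n) (f n)) = (nrm (h n))\<^sup>2" by (simp add: L2_inner_self)
    then have "(nrm (q n))\<^sup>2 = (nrm (k n))\<^sup>2 - 2 * s\<^sup>2 * (nrm (h n))\<^sup>2 + (s\<^sup>2)\<^sup>2"
      unfolding q_def using L fhk(3)
      by (subst L2_norm_diff_sq) (auto intro!: L2_scale simp: L2_inner_scale_right L2_norm_scale norm_power)
    moreover have "(nrm (k n))\<^sup>2 \<le> (s * nrm (h n))\<^sup>2"
      using le_s[OF fhk(2)] by (intro power_mono) auto
    ultimately show ?thesis by (simp add: algebra_simps power2_eq_square)
  qed
  have q0: "(\<lambda>n. nrm (q n)) \<longlonglongrightarrow> 0"
  proof -
    have "(\<lambda>n. s\<^sup>2 * (s\<^sup>2 - (nrm (h n))\<^sup>2)) \<longlonglongrightarrow> s\<^sup>2 * (s\<^sup>2 - s\<^sup>2)"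
      by (intro tendsto_intros hs)
    then have lim: "(\<lambda>n. s\<^sup>2 * (s\<^sup>2 - (nrm (h n))\<^sup>2)) \<longlonglongrightarrow> 0" by simp
    have "(\<lambda>n. (nrm (q n))\<^sup>2) \<longlonglongrightarrow> 0"
      by (rule tendsto_sandwich[OF _ _ tendsto_const lim]) (intro always_eventually allI q_le zero_le_power2)+
    then have "(\<lambda>n. sqrt ((nrm (q n))\<^sup>2)) \<longlonglongrightarrow> sqrt 0" by (rule tendsto_real_sqrt)
    then show ?thesis by simp
  qed
  have sub: "nrm u \<le> C' * nrm g'" if "R g u" "C' \<ge> 0"
      "\<And>u f. f \<in> L2 M \<Longrightarrow> (u, \<lambda>x. of_real t * u x + f x) \<in> A \<Longrightarrow> nrm u \<le> C' * nrm f"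
      "g' = (\<lambda>x. g x + of_real (c - t) * u x)" for t C' g u g'
  proof -
    have "(u, \<lambda>x. of_real t * u x + g' x) \<in> A"
      using that(1) unfolding R_def that(4) by (simp add: algebra_simps)
    moreover have "g' \<in> L2 M" unfolding that(4) by (intro L2_add L2_scale R_L2[OF that(1)])
    ultimately show ?thesis using that(3) by blast
  qed
  define g where "g n = (\<lambda>x. h n x + of_real s * f n x)" for n
  define w where "w n = (\<lambda>x. k n x + of_real s * h n x)" for n
  have Rg: "R (g n) (w n)" for n
    using R_lin[OF fhk(2)[of n] fhk(1)[of n], of 1 "of_real s"] by (simp add: g_def w_def)
  obtain C1 where C1: "C1 \<ge> 0" "\<And>u f. f \<in> L2 M \<Longrightarrow> (u, \<lambda>x. of_real (c + 1/s) * u x + f x) \<in> A \<Longrightarrow> nrm u \<le> C1 * nrm f"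
    by (rule regular_estimate[OF reg[of "c + 1/s"]]) (use s in simp, blast)
  obtain C2 where C2: "C2 \<ge> 0" "\<And>u f. f \<in> L2 M \<Longrightarrow> (u, \<lambda>x. of_real (c - 1/s) * u x + f x) \<in> A \<Longrightarrow> nrm u \<le> C2 * nrm f"
    by (rule regular_estimate[OF reg[of "c - 1/s"]]) (use s in simp, blast)
  have w_le: "nrm (w n) \<le> C1 / s * nrm (q n)" for n
  proof -
    have "nrm (w n) \<le> C1 * nrm (\<lambda>x. of_real (- 1/s) * q n x)"
    proof (rule sub[OF Rg C1])
      show "(\<lambda>x. of_real (- 1/s) * q n x) = (\<lambda>x. g n x + of_real (c - (c + 1/s)) * w n x)"
        using s by (auto simp: q_def g_def w_def field_simps power2_eq_square)
    qed
    then show ?thesis using s by (simp only: L2_norm_scale) (simp add: norm_divide)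
  qed
  have g_le: "s * nrm (g n) \<le> (C1 / s + 1) * nrm (q n)" for n
  proof -
    have eq: "(\<lambda>x. of_real s * g n x) = (\<lambda>x. w n x - q n x)"
      by (auto simp: q_def g_def w_def algebra_simps power2_eq_square)
    have "s * nrm (g n) = nrm (\<lambda>x. of_real s * g n x)" using s by (simp add: L2_norm_scale)
    also have "\<dots> \<le> nrm (w n) + nrm (q n)"
      unfolding eq by (intro L2_norm_diff_triangle R_L2(1)[OF Rg] qL)
    finally show ?thesis using w_le[of n] by (simp add: algebra_simps)
  qed
  have h_le: "nrm (h n) \<le> C2 / s * nrm (g n)" for n
  proof -
    have "nrm (h n) \<le> C2 * nrm (\<lambda>x. of_real (1/s) * g n x)"
    proof (rule sub[OF fhk(1) C2])
      show "(\<lambda>x. of_real (1/s) * g n x) = (\<lambda>x. f n x + of_real (c - (c - 1/s)) * h n x)"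
        using s by (auto simp: g_def field_simps)
    qed
    then show ?thesis using s by (simp only: L2_norm_scale) (simp add: norm_divide)
  qed
  have "nrm (h n) \<le> C2 / s * ((C1 / s + 1) / s * nrm (q n))" for n
  proof (rule order_trans[OF h_le])
    have "nrm (g n) \<le> (C1 / s + 1) / s * nrm (q n)"
      using g_le[of n] s by (simp add: field_simps)
    then show "C2 / s * nrm (g n) \<le> C2 / s * ((C1 / s + 1) / s * nrm (q n))"
      using C2 s by (intro mult_left_mono) auto
  qed
  moreover have "(\<lambda>n. C2 / s * ((C1 / s + 1) / s * nrm (q n))) \<longlonglongrightarrow> C2 / s * ((C1 / s + 1) / s * 0)"
    by (intro tendsto_intros q0)
  ultimately have "s \<le> C2 / s * ((C1 / s + 1) / s * 0)"
    by (intro LIMSEQ_le[OF hs]) auto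
  then show False using s by simp
qed


lemma form_Cauchy_Schwarz:
  assumes K: "K \<subseteq> H" "\<And>u v c d. u \<in> K \<Longrightarrow> v \<in> K \<Longrightarrow> (\<lambda>x. c * u x + d * v x) \<in> K"
    and low: "\<And>v. v \<in> K \<Longrightarrow> \<mu> * (nrm v)\<^sup>2 \<le> Re (a v v)" and uv: "u \<in> K" "v \<in> K"
  shows "(cmod (a u v - of_real \<mu> * ip u v))\<^sup>2
    \<le> (Re (a u u) - \<mu> * (nrm u)\<^sup>2) * (Re (a v v) - \<mu> * (nrm v)\<^sup>2)"
proof (rule Cauchy_Schwarz_discriminant)
  fix t :: complex
  define b where "b f g = a f g - of_real \<mu> * ip f g" for f g
  have H: "u \<in> H" "v \<in> H" and L: "u \<in> L2 M" "v \<in> L2 M" using uv K H_L2 by auto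
  let ?w = "\<lambda>x. 1 * u x + (-t) * v x"
  have w: "?w \<in> K" by (intro K uv)
  have lin: "b ?w f = b u f - t * b v f" if "f \<in> H" for f
    unfolding b_def a_lin[OF H that] L2_inner_lin_left[OF L H_L2[OF that]]
    by (simp add: algebra_simps)
  have comm: "b g f = cnj (b f g)" for f g
    using a_commute[of g f] L2_inner_commute[of M g f] by (simp add: b_def)
  have self: "Re (b f f) = Re (a f f) - \<mu> * (nrm f)\<^sup>2" for f
    by (simp add: b_def L2_inner_self)
  have "b ?w ?w = b u ?w - t * b v ?w" using w K by (intro lin) auto
  also have "b u ?w = cnj (b u u - t * b v u)" using lin[OF H(1)] comm[of u ?w] by simp
  also have "b v ?w = cnj (b u v - t * b v v)" using lin[OF H(2)] comm[of v ?w] by simp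
  finally have "Re (b ?w ?w) = Re (b u u) - 2 * Re (cnj t * b u v) + (cmod t)\<^sup>2 * Re (b v v)"
    using comm[of v u] comm[of v v] unfolding cmod_power2 by (auto simp: complex_eq_iff power2_eq_square algebra_simps)
  moreover have "0 \<le> Re (b ?w ?w)" unfolding self using low[OF w] by simp
  ultimately show "0 \<le> Re (a u u) - \<mu> * (nrm u)\<^sup>2 - 2 * Re (cnj t * (a u v - of_real \<mu> * ip u v))
      + (cmod t)\<^sup>2 * (Re (a v v) - \<mu> * (nrm v)\<^sup>2)"
    by (simp only: self flip: b_def)
  show "0 \<le> Re (a v v) - \<mu> * (nrm v)\<^sup>2" using low[OF uv(2)] by simp
qed

lemma eigenvalue_not_regular:
  assumes "(e, \<lambda>x. of_real t * e x) \<in> A" "nrm e \<noteq> 0"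
  shows "\<not> regular t"
proof
  assume "regular t"
  then obtain C where C: "\<And>u f. f \<in> L2 M \<Longrightarrow> (u, \<lambda>x. of_real t * u x + f x) \<in> A \<Longrightarrow> nrm u \<le> C * nrm f"
    by (rule regular_estimate) blast
  have "nrm e \<le> C * nrm (\<lambda>x. 0)" using assms(1) by (intro C) simp_all
  moreover have "nrm (\<lambda>x. 0) = 0" by (simp add: L2_norm_def)
  ultimately show False using assms(2) L2_norm_nonneg[of M e] by simp
qed

text \<open>The threshold is an infimum of points of the essential spectrum, so a point of the spectrum below it is
  in the discrete spectrum.\<close>

lemma below_threshold_isolated:
  assumes "ereal \<mu> < threshold M A" "\<not> regular \<mu>"
  shows "\<exists>\<delta>>0. \<forall>t. t \<noteq> \<mu> \<longrightarrow> \<bar>t - \<mu>\<bar> < \<delta> \<longrightarrow> regular t"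
proof -
  have "complex_of_real \<mu> \<notin> essential_spectrum M A"
  proof
    assume "complex_of_real \<mu> \<in> essential_spectrum M A"
    then have "threshold M A \<le> ereal \<mu>" unfolding threshold_def by (intro INF_lower) simp
    then show False using assms(1) by simp
  qed
  then have "complex_of_real \<mu> isolated_in spectrum M A"
    using assms(2) by (auto simp: essential_spectrum_def discrete_spectrum_def spectrum_def regular_def)
  then obtain \<delta> where d: "\<delta> > 0" "\<forall>y\<in>spectrum M A. dist (complex_of_real \<mu>) y < \<delta> \<longrightarrow> y = of_real \<mu>"
    unfolding isolated_in_dist_Ex_iff by blast
  have "regular t" if "t \<noteq> \<mu>" "\<bar>t - \<mu>\<bar> < \<delta>" for t
  proof (rule ccontr)
    assume "\<not> regular t"
    then have "complex_of_real t \<in> spectrum M A" by (simp add: regular_def spectrum_def)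
    moreover have "dist (complex_of_real \<mu>) (of_real t) = \<bar>t - \<mu>\<bar>"
      by (simp add: dist_norm norm_minus_commute flip: of_real_diff)
    ultimately show False using d(2) that by force
  qed
  with d(1) show ?thesis by blast
qed


text \<open>Let \<open>\<mu>\<close> be the infimum of the Rayleigh quotient over \<open>K\<close>, the orthogonal complement of the given
  eigenvectors.  Then \<open>\<mu>\<close> is in the spectrum, and since it is below the threshold it is isolated.
  On \<open>K\<close> the operator \<open>T = \<epsilon> (A - \<mu> + \<epsilon>)\<^bsup>-1\<^esup>\<close> satisfies \<open>0 \<le> T \<le> 1\<close>, so the moments
  \<open>\<alpha>\<^sub>k = (T\<^bsup>k\<^esup> g, g)\<close> decrease, and \<open>T\<^bsup>n\<^esup> g\<close> converges for every \<open>g \<in> K\<close>; the limit \<open>f\<close> satisfies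
  \<open>T f = f\<close>, that is \<open>A f = \<mu> f\<close>.  The gap in the spectrum above \<open>\<mu>\<close> makes the differences of the
  moments decay geometrically, so \<open>f \<noteq> 0\<close> once \<open>\<alpha>\<^sub>0 - \<alpha>\<^sub>1\<close> is small, which holds if \<open>g\<close> almost attains
  the infimum.\<close>

lemma bottom_is_eigenvalue:
  assumes e: "\<And>i. i < m \<Longrightarrow> (e i, \<lambda>x. of_real (t i) * e i x) \<in> A" "\<And>i. i < m \<Longrightarrow> nrm (e i) \<noteq> 0"
    and K_def: "K = {v \<in> H. \<forall>i<m. ip v (e i) = 0}"
    and v0: "v0 \<in> K" "nrm v0 \<noteq> 0" and v0_le: "Re (a v0 v0) \<le> \<Lambda> * (nrm v0)\<^sup>2"
    and \<Lambda>: "ereal \<Lambda> < threshold M A"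
  obtains u \<mu> where "\<mu> \<le> \<Lambda>" "u \<in> K" "nrm u \<noteq> 0" "(u, \<lambda>x. of_real \<mu> * u x) \<in> A"
proof -
  have eL: "e i \<in> L2 M" if "i < m" for i using e(1)[OF that] A_dom_L2 by blast
  have KH: "K \<subseteq> H" by (auto simp: K_def)
  then have KL: "v \<in> L2 M" if "v \<in> K" for v using that H_L2 by auto
  have K_lin: "(\<lambda>x. c * u x + d * v x) \<in> K" if "u \<in> K" "v \<in> K" for u v c d
    using that by (auto simp: K_def H_lin L2_inner_lin_left H_L2 eL)
  have K_scale: "(\<lambda>x. c * u x) \<in> K" if "u \<in> K" for u c
    using K_lin[OF that that, of c 0] by simp
  have a_scale: "a (\<lambda>x. of_real c * u x) (\<lambda>x. of_real c * u x) = of_real (c\<^sup>2) * a u u" if "u \<in> K" for u c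
  proof -
    have u: "u \<in> H" "(\<lambda>x. of_real c * u x) \<in> H" using K_scale[OF that] that KH by auto
    show ?thesis
      using a_lin[OF u(1) u(1) u(2), of "of_real c" 0] a_lin_right[OF u(1) u(1) u(1), of "of_real c" 0]
      by (simp add: power2_eq_square)
  qed
  define B where "B = {Re (a v v) | v. v \<in> K \<and> nrm v = 1}"
  define \<mu> where "\<mu> = Inf B"
  have bdd: "bdd_below B" by (rule bdd_belowI[of _ 0]) (auto simp: B_def a_nonneg)
  have normalize: "Re (a v v) / (nrm v)\<^sup>2 \<in> B" if "v \<in> K" "nrm v \<noteq> 0" for v
  proof -
    let ?v = "\<lambda>x. of_real (1 / nrm v) * v x"
    have n1: "nrm ?v = 1" using that(2) by (simp only: L2_norm_scale) (simp add: norm_divide)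
    have "a ?v ?v = of_real ((1 / nrm v)\<^sup>2) * a v v" by (rule a_scale[OF that(1)])
    then have n2: "Re (a ?v ?v) = Re (a v v) / (nrm v)\<^sup>2"
      by (simp only: Re_of_real_mult) (simp add: power_divide)
    show ?thesis unfolding B_def by (intro CollectI exI[of _ ?v] conjI n1 n2[symmetric] K_scale that)
  qed
  have low: "\<mu> * (nrm v)\<^sup>2 \<le> Re (a v v)" if "v \<in> K" for v
  proof (cases "nrm v = 0")
    case False
    have "\<mu> \<le> Re (a v v) / (nrm v)\<^sup>2" unfolding \<mu>_def by (intro cInf_lower normalize that False bdd)
    moreover have "(nrm v)\<^sup>2 > 0" using False by simp
    ultimately show ?thesis by (simp add: field_simps)
  qed (simp add: a_nonneg)
  have \<mu>\<Lambda>: "\<mu> \<le> \<Lambda>"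
  proof -
    have "\<mu> \<le> Re (a v0 v0) / (nrm v0)\<^sup>2" unfolding \<mu>_def by (intro cInf_lower normalize v0 bdd)
    also have "\<dots> \<le> \<Lambda>" using v0(2) v0_le by (simp add: divide_le_eq)
    finally show ?thesis .
  qed
  have near: "\<exists>v\<in>K. nrm v = 1 \<and> Re (a v v) < \<mu> + \<eta>" if "\<eta> > 0" for \<eta>
  proof -
    have "B \<noteq> {}" using normalize[OF v0(1,2)] by blast
    then have "\<exists>y\<in>B. y < \<mu> + \<eta>" using bdd that by (subst cInf_less_iff[symmetric]) (auto simp: \<mu>_def)
    then show ?thesis by (auto simp: B_def)
  qed
  have CS: "(cmod (a u v - of_real \<mu> * ip u v))\<^sup>2
      \<le> (Re (a u u) - \<mu> * (nrm u)\<^sup>2) * (Re (a v v) - \<mu> * (nrm v)\<^sup>2)" if "u \<in> K" "v \<in> K" for u v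
  proof (rule form_Cauchy_Schwarz[OF KH _ _ that])
    show "(\<lambda>x. c * u x + d * v x) \<in> K" if "u \<in> K" "v \<in> K" for u v c d using that by (rule K_lin)
    show "\<mu> * (nrm v)\<^sup>2 \<le> Re (a v v)" if "v \<in> K" for v using that by (rule low)
  qed
  have solution_in_K: "u \<in> K" if "(u, \<lambda>x. of_real c * u x + f x) \<in> A" "regular c" "f \<in> L2 M" "\<And>i. i < m \<Longrightarrow> ip f (e i) = 0" for u f c
  proof -
    note hyps = that
    have "ip u (e i) = 0" if i: "i < m" for i
    proof -
      have "ip f (e i) = ip u (\<lambda>x. of_real (t i - c) * e i x)"
      proof (rule resolvent_symmetric[OF hyps(1) _ hyps(3)])
        show "(e i, \<lambda>x. of_real c * e i x + of_real (t i - c) * e i x) \<in> A"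
          using e(1)[OF i] by (simp add: algebra_simps)
      qed (intro L2_scale eL i)
      then have "of_real (t i - c) * ip u (e i) = 0"
        using hyps(4)[OF i] A_dom_L2[OF hyps(1)] eL[OF i] by (simp only: L2_inner_scale_right complex_cnj_complex_of_real)
      moreover have "t i \<noteq> c" using eigenvalue_not_regular[OF e(1)[OF i] e(2)[OF i]] hyps(2) by auto
      ultimately show ?thesis by simp
    qed
    then show ?thesis using A_H[OF hyps(1)] by (simp add: K_def)
  qed
  have K_orth: "ip v (e i) = 0" if "v \<in> K" "i < m" for v i using that by (simp add: K_def)
  \<comment> \<open>A bounded inverse of \<open>A - \<mu>\<close> is impossible because \<open>a - \<mu>\<close> is nonnegative on \<open>K\<close> but takes
    arbitrarily small values on unit vectors.\<close>
  have nreg: "\<not> regular \<mu>"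
  proof
    assume reg: "regular \<mu>"
    then obtain C where C: "C \<ge> 0" "\<And>u f. f \<in> L2 M \<Longrightarrow> (u, \<lambda>x. of_real \<mu> * u x + f x) \<in> A \<Longrightarrow> nrm u \<le> C * nrm f"
      by (rule regular_estimate) blast
    obtain v where v: "v \<in> K" "nrm v = 1" "Re (a v v) < \<mu> + 1 / (C + 1)"
      using near[of "1 / (C + 1)"] C(1) by auto
    obtain u where u: "(u, \<lambda>x. of_real \<mu> * u x + v x) \<in> A" using regular_solution[OF reg KL[OF v(1)]] by blast
    have uK: "u \<in> K" by (rule solution_in_K[OF u reg KL[OF v(1)] K_orth[OF v(1)]])
    have au: "a u w - of_real \<mu> * ip u w = ip v w" if "w \<in> K" for w
      using A_form[OF u, of w] that KH L2_inner_lin_left[OF KL[OF uK] KL[OF v(1)] KL[OF that], of "of_real \<mu>" 1] by auto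
    have "1 \<le> (Re (a u u) - \<mu> * (nrm u)\<^sup>2) * (Re (a v v) - \<mu> * (nrm v)\<^sup>2)"
      using CS[OF uK v(1)] au[OF v(1)] v(2) by (simp add: L2_inner_self)
    also have "\<dots> \<le> C * (Re (a v v) - \<mu> * (nrm v)\<^sup>2)"
    proof (rule mult_right_mono)
      have "Re (a u u) - \<mu> * (nrm u)\<^sup>2 = Re (ip v u)"
        using arg_cong[OF au[OF uK], of Re] by (simp add: L2_inner_self)
      also have "\<dots> \<le> nrm v * nrm u" by (intro L2_Cauchy_Schwarz_Re KL v uK)
      also have "\<dots> \<le> C" using C(2)[OF KL[OF v(1)] u] v(2) by simp
      finally show "Re (a u u) - \<mu> * (nrm u)\<^sup>2 \<le> C" .
      show "0 \<le> Re (a v v) - \<mu> * (nrm v)\<^sup>2" using low[OF v(1)] by simp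
    qed
    also have "C * (Re (a v v) - \<mu> * (nrm v)\<^sup>2) \<le> C * (1 / (C + 1))" using v C(1) by (intro mult_left_mono) auto
    also have "\<dots> < 1" using C(1) by (simp add: field_simps)
    finally show False by simp
  qed
  have "ereal \<mu> < threshold M A" using \<mu>\<Lambda> \<Lambda> by (meson ereal_less_eq(3) le_less_trans)
  from below_threshold_isolated[OF this nreg]
  obtain \<delta> where \<delta>: "\<delta> > 0" "\<And>t. t \<noteq> \<mu> \<Longrightarrow> \<bar>t - \<mu>\<bar> < \<delta> \<Longrightarrow> regular t" by auto
  define \<epsilon> where "\<epsilon> = \<delta> / 2"
  have \<epsilon>: "\<epsilon> > 0" using \<delta>(1) by (simp add: \<epsilon>_def)
  \<comment> \<open>All real points at distance less than \<open>2 \<epsilon>\<close> from \<open>\<mu>\<close>, except \<open>\<mu>\<close>, are regular.\<close>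
  define c where "c = \<mu> - \<epsilon>"
  have reg: "regular c" by (rule \<delta>(2)) (use \<delta>(1) in \<open>simp_all add: c_def \<epsilon>_def\<close>)
  have gap: "\<epsilon> * nrm u \<le> nrm f" if "f \<in> L2 M" "(u, \<lambda>x. of_real (\<mu> + \<epsilon>) * u x + f x) \<in> A" for u f
  proof (rule regular_gap[where c="\<mu> + \<epsilon>" and \<delta>=\<epsilon> and ?f0.0=f and ?u0.0=u])
    show "regular t" if "\<bar>t - (\<mu> + \<epsilon>)\<bar> < \<epsilon>" for t
    proof (rule \<delta>(2))
      have *: "t - (\<mu> + \<epsilon>) < \<epsilon>" "- (t - (\<mu> + \<epsilon>)) < \<epsilon>" "\<delta> = 2 * \<epsilon>"
        using that unfolding abs_less_iff by (blast, blast) (simp add: \<epsilon>_def)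
      then show "t \<noteq> \<mu>" by auto
      show "\<bar>t - \<mu>\<bar> < \<delta>" using * unfolding abs_less_iff by linarith
    qed
    show "\<epsilon> > 0" "f \<in> L2 M" "(u, \<lambda>x. of_real (\<mu> + \<epsilon>) * u x + f x) \<in> A" by fact+
  qed
  obtain g where g: "g \<in> K" "nrm g = 1" "Re (a g g) < \<mu> + \<epsilon> / 16" using near[of "\<epsilon> / 16"] \<epsilon> by auto
  define S where "S f = (SOME u. (u, \<lambda>x. of_real c * u x + f x) \<in> A)" for f
  have S: "(S f, \<lambda>x. of_real c * S f x + f x) \<in> A" if "f \<in> L2 M" for f
    unfolding S_def using regular_solution[OF reg that] by (rule someI_ex)
  have S_K: "S f \<in> K" if "f \<in> L2 M" "\<And>i. i < m \<Longrightarrow> ip f (e i) = 0" for f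
    by (rule solution_in_K[OF S[OF that(1)] reg that])
  \<comment> \<open>\<open>X n = T\<^bsup>n\<^esup> g\<close>\<close>
  define X where "X = rec_nat g (\<lambda>_ f x. of_real \<epsilon> * S f x)"
  have X0: "X 0 = g" and XSuc: "X (Suc k) = (\<lambda>x. of_real \<epsilon> * S (X k) x)" for k
    by (simp_all add: X_def)
  have XK: "X k \<in> K" for k
  proof (induction k)
    case (Suc k)
    show ?case unfolding XSuc by (intro K_scale S_K KL Suc K_orth[OF Suc])
  qed (simp add: X0 g)
  have XL: "X k \<in> L2 M" for k using XK KL by blast
  have XH: "X k \<in> H" for k using XK KH by blast
  have XA: "(X (Suc k), \<lambda>x. of_real c * X (Suc k) x + of_real \<epsilon> * X k x) \<in> A" for k
    using resolvent_lin[OF S[OF XL[of k]] S[OF XL[of k]], of "of_real \<epsilon>" 0] by (simp add: XSuc)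
  have aX: "a (X (Suc k)) v = of_real \<mu> * ip (X (Suc k)) v + of_real \<epsilon> * (ip (X k) v - ip (X (Suc k)) v)"
    if "v \<in> K" for k v
  proof -
    have "a (X (Suc k)) v = of_real c * ip (X (Suc k)) v + of_real \<epsilon> * ip (X k) v"
      using A_form[OF XA, of v] that KH L2_inner_lin_left[OF XL XL KL[OF that], of "of_real c" "Suc k" "of_real \<epsilon>" k] by auto
    then show ?thesis by (simp add: c_def algebra_simps)
  qed
  have shift: "ip (X k) (X (Suc l)) = ip (X (Suc k)) (X l)" for k l
  proof -
    have "ip (\<lambda>x. of_real \<epsilon> * X k x) (X (Suc l)) = ip (X (Suc k)) (\<lambda>x. of_real \<epsilon> * X l x)"
      by (rule resolvent_symmetric[OF XA XA]) (intro L2_scale XL)+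
    then show ?thesis using \<epsilon> by (simp add: L2_inner_scale_left L2_inner_scale_right XL)
  qed
  define \<alpha> where "\<alpha> k = Re (ip (X k) (X 0))" for k
  have ipX: "Re (ip (X k) (X l)) = \<alpha> (k + l)" for k l
  proof (induction l arbitrary: k)
    case (Suc l)
    then show ?case using Suc[of "Suc k"] by (simp add: shift)
  qed (simp add: \<alpha>_def)
  have ipX': "Re (ip (X k) (X l)) = \<alpha> n" if "k + l = n" for k l n using ipX that by simp
  have nX: "(nrm (X k))\<^sup>2 = \<alpha> (2 * k)" for k
    using ipX[of k k] by (simp add: L2_inner_self mult_2)
  have odd: "\<alpha> (2 * k + 2) \<le> \<alpha> (2 * k + 1)" for k
  proof -
    have "\<mu> * (nrm (X (Suc k)))\<^sup>2 \<le> \<mu> * (nrm (X (Suc k)))\<^sup>2 + \<epsilon> * (\<alpha> (2 * k + 1) - (nrm (X (Suc k)))\<^sup>2)"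
      using low[OF XK[of "Suc k"]] arg_cong[OF aX[OF XK[of "Suc k"], of k], of Re] ipX[of k "Suc k"]
      by (simp add: L2_inner_self mult_2)
    then show ?thesis using \<epsilon> nX[of "Suc k"] by (simp add: zero_le_mult_iff)
  qed
  have even: "\<alpha> (2 * k + 1) \<le> \<alpha> (2 * k)" for k
  proof -
    have le: "\<alpha> (2 * k + 1) \<le> nrm (X k) * nrm (X (Suc k))"
      using L2_Cauchy_Schwarz_Re[OF XL XL, of k "Suc k"] ipX[of k "Suc k"] by (simp add: mult_2)
    have "nrm (X (Suc k)) * nrm (X (Suc k)) \<le> nrm (X k) * nrm (X (Suc k))"
      using le odd[of k] nX[of "Suc k"] by (simp add: power2_eq_square)
    moreover have "nrm (X k) * nrm (X (Suc k)) < nrm (X (Suc k)) * nrm (X (Suc k))" if "nrm (X k) < nrm (X (Suc k))"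
      using that L2_norm_nonneg[of M "X k"] by (intro mult_strict_right_mono) linarith+
    ultimately have "nrm (X (Suc k)) \<le> nrm (X k)" by linarith
    then have "nrm (X k) * nrm (X (Suc k)) \<le> nrm (X k) * nrm (X k)" by (intro mult_left_mono) auto
    with le show ?thesis using nX[of k] by (simp add: power2_eq_square)
  qed
  have dec: "\<alpha> (Suc k) \<le> \<alpha> k" for k
    using even[of "k div 2"] odd[of "k div 2"] by (cases "even k") (auto elim!: evenE oddE)
  have decseq: "decseq \<alpha>" using dec by (simp add: decseq_Suc_iff)
  have \<alpha>_nonneg: "0 \<le> \<alpha> k" for k
  proof -
    have "0 \<le> \<alpha> (2 * k)" using nX[of k] by (metis zero_le_power2)
    also have "\<dots> \<le> \<alpha> k" using decseq by (simp add: decseq_def)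
    finally show ?thesis .
  qed
  have convex: "\<alpha> (2 * k + 2) - \<alpha> (2 * k + 3) \<le> \<alpha> (2 * k + 1) - \<alpha> (2 * k + 2)" for k
  proof -
    let ?y = "\<lambda>x. 1 * X (Suc k) x + (-1) * X (Suc (Suc k)) x"
    have y: "?y \<in> K" by (intro K_lin XK)
    have yH: "?y \<in> H" using y KH by blast
    have 1: "a ?y ?y = a (X (Suc k)) ?y - a (X (Suc (Suc k))) ?y"
      using a_lin[OF XH XH yH, of 1 "Suc k" "-1" "Suc (Suc k)"] by simp
    have 2: "ip ?y ?y = ip (X (Suc k)) ?y - ip (X (Suc (Suc k))) ?y"
      using L2_inner_lin_left[OF XL XL KL[OF y], of 1 "Suc k" "-1" "Suc (Suc k)"] by simp
    have 3: "Re (ip (X k) ?y) - Re (ip (X (Suc k)) ?y) = \<alpha> (2*k+1) - 2 * \<alpha> (2*k+2) + \<alpha> (2*k+3)"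
    proof -
      have d: "ip (X l) ?y = ip (X l) (X (Suc k)) - ip (X l) (X (Suc (Suc k)))" for l
        using L2_inner_diff_right[OF XL XL XL, of l "Suc k" "Suc (Suc k)"] by simp
      have "Re (ip (X k) (X (Suc k))) = \<alpha> (2*k+1)" "Re (ip (X k) (X (Suc (Suc k)))) = \<alpha> (2*k+2)"
        "Re (ip (X (Suc k)) (X (Suc k))) = \<alpha> (2*k+2)" "Re (ip (X (Suc k)) (X (Suc (Suc k)))) = \<alpha> (2*k+3)"
        by (rule ipX'; simp)+
      then show ?thesis unfolding d minus_complex.simps by linarith
    qed
    have "a ?y ?y = of_real \<mu> * ip ?y ?y + of_real \<epsilon> * ((ip (X k) ?y - ip (X (Suc k)) ?y) - ip ?y ?y)"
      unfolding 1 aX[OF y] 2 by (simp add: algebra_simps)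
    then have "Re (a ?y ?y) = \<mu> * (nrm ?y)\<^sup>2 + \<epsilon> * ((Re (ip (X k) ?y) - Re (ip (X (Suc k)) ?y)) - (nrm ?y)\<^sup>2)"
      by (simp only: L2_inner_self plus_complex.simps Re_of_real_mult minus_complex.simps Re_complex_of_real)
    with low[OF y] have "0 \<le> \<epsilon> * (\<alpha> (2*k+1) - 2 * \<alpha> (2*k+2) + \<alpha> (2*k+3) - (nrm ?y)\<^sup>2)"
      unfolding 3 by linarith
    then have "0 \<le> \<alpha> (2*k+1) - 2 * \<alpha> (2*k+2) + \<alpha> (2*k+3) - (nrm ?y)\<^sup>2"
      using \<epsilon> by (simp only: zero_le_mult_iff) linarith
    then show ?thesis using zero_le_power2[of "nrm ?y"] by linarith
  qed
  \<comment> \<open>The gap, applied to \<open>T (X k)\<close>, bounds the spectrum of \<open>T\<close> outside \<open>1\<close> by \<open>1/3\<close>.\<close>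
  have third: "3 * (\<alpha> (2 * k + 1) - \<alpha> (2 * k + 2)) \<le> \<alpha> (2 * k) - \<alpha> (2 * k + 1)" for k
  proof -
    let ?f = "\<lambda>x. of_real \<epsilon> * (X k x - of_real 2 * X (Suc k) x)"
    have 2: "(\<lambda>x. of_real 2 * X (Suc k) x) \<in> L2 M" by (intro L2_scale XL)
    have f: "?f \<in> L2 M" by (intro L2_scale L2_diff XL)
    have "\<epsilon> * nrm (X (Suc k)) \<le> nrm ?f"
      by (rule gap[OF f]) (use XA[of k] in \<open>simp add: c_def algebra_simps\<close>)
    then have "nrm (X (Suc k)) \<le> nrm (\<lambda>x. X k x - of_real 2 * X (Suc k) x)"
      using \<epsilon> by (simp only: L2_norm_scale) simp
    then have "(nrm (X (Suc k)))\<^sup>2 \<le> (nrm (\<lambda>x. X k x - of_real 2 * X (Suc k) x))\<^sup>2"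
      by (intro power_mono) auto
    also have "\<dots> = (nrm (X k))\<^sup>2 - 4 * Re (ip (X k) (X (Suc k))) + 4 * (nrm (X (Suc k)))\<^sup>2"
      unfolding L2_norm_diff_sq[OF XL 2] L2_inner_scale_right[OF XL XL] L2_norm_scale
        complex_cnj_complex_of_real Re_of_real_mult by (simp add: power_mult_distrib)
    finally have "(nrm (X (Suc k)))\<^sup>2 \<le> (nrm (X k))\<^sup>2 - 4 * Re (ip (X k) (X (Suc k))) + 4 * (nrm (X (Suc k)))\<^sup>2" .
    moreover have "Re (ip (X k) (X (Suc k))) = \<alpha> (2*k+1)" by (rule ipX') simp
    moreover have "(nrm (X (Suc k)))\<^sup>2 = \<alpha> (2*k+2)" using nX[of "Suc k"] by simp
    ultimately have "\<alpha> (2*k+2) \<le> \<alpha> (2*k) - 4 * \<alpha> (2*k+1) + 4 * \<alpha> (2*k+2)"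
      by (simp only: nX[of k])
    moreover have "3 * (q - r) \<le> p - q" if "r \<le> p - 4 * q + 4 * r" for p q r :: real
      using that by (simp add: algebra_simps)
    ultimately show ?thesis by blast
  qed
  \<comment> \<open>The Cauchy-Schwarz inequality for \<open>a - \<mu>\<close> and the vectors \<open>T g\<close>, \<open>g\<close>.\<close>
  have start: "\<alpha> 0 - \<alpha> 1 \<le> 1 / 4"
  proof -
    have \<alpha>0: "\<alpha> 0 = 1" using nX[of 0] g(2) by (simp add: X0)
    have "(cmod (a (X 1) g - of_real \<mu> * ip (X 1) g))\<^sup>2
      \<le> (Re (a (X 1) (X 1)) - \<mu> * (nrm (X 1))\<^sup>2) * (Re (a g g) - \<mu> * (nrm g)\<^sup>2)"
      by (rule CS) (use XK g in auto)
    also have "Re (a (X 1) (X 1)) - \<mu> * (nrm (X 1))\<^sup>2 = \<epsilon> * (\<alpha> 1 - \<alpha> 2)"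
    proof -
      have "a (X 1) (X 1) = of_real \<mu> * ip (X 1) (X 1) + of_real \<epsilon> * (ip (X 0) (X 1) - ip (X 1) (X 1))"
        using aX[OF XK[of 1], of 0] by (simp only: One_nat_def)
      then have "Re (a (X 1) (X 1)) = \<mu> * (nrm (X 1))\<^sup>2 + \<epsilon> * (Re (ip (X 0) (X 1)) - Re (ip (X 1) (X 1)))"
        by (simp only: plus_complex.simps Re_of_real_mult minus_complex.simps) (simp only: L2_inner_self Re_complex_of_real)
      moreover have "Re (ip (X 0) (X 1)) = \<alpha> 1" "Re (ip (X 1) (X 1)) = \<alpha> 2" by (rule ipX'; simp)+
      ultimately show ?thesis by simp
    qed
    also have "\<epsilon> * (\<alpha> 1 - \<alpha> 2) * (Re (a g g) - \<mu> * (nrm g)\<^sup>2) \<le> \<epsilon> * 1 * (\<epsilon> / 16)"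
    proof (intro mult_mono mult_left_mono mult_nonneg_nonneg)
      have "\<alpha> 2 \<le> \<alpha> 1" "\<alpha> 1 \<le> \<alpha> 0" using dec[of 0] dec[of 1] by (simp_all add: numeral_2_eq_2)
      then show "\<alpha> 1 - \<alpha> 2 \<le> 1" "0 \<le> \<alpha> 1 - \<alpha> 2" using \<alpha>0 \<alpha>_nonneg[of 2] by linarith+
      show "Re (a g g) - \<mu> * (nrm g)\<^sup>2 \<le> \<epsilon> / 16" "0 \<le> Re (a g g) - \<mu> * (nrm g)\<^sup>2"
        using g low[OF g(1)] by simp_all
    qed (use \<epsilon> in simp_all)
    finally have "(cmod (a (X 1) g - of_real \<mu> * ip (X 1) g))\<^sup>2 \<le> (\<epsilon> / 4)\<^sup>2"
      by (simp add: power2_eq_square)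
    then have "cmod (a (X 1) g - of_real \<mu> * ip (X 1) g) \<le> \<epsilon> / 4"
      by (rule power2_le_imp_le) (use \<epsilon> in simp)
    moreover have "a (X 1) g - of_real \<mu> * ip (X 1) g = of_real \<epsilon> * (ip (X 0) g - ip (X 1) g)"
      using aX[OF g(1), of 0] by simp
    ultimately have "cmod (of_real \<epsilon> * (ip (X 0) g - ip (X 1) g)) \<le> \<epsilon> / 4" by simp
    then have "\<epsilon> * cmod (ip (X 0) g - ip (X 1) g) \<le> \<epsilon> * (1 / 4)"
      using \<epsilon> by (simp only: norm_mult) simp
    then have "cmod (ip (X 0) g - ip (X 1) g) \<le> 1 / 4" using \<epsilon> by (simp only: mult_le_cancel_left_pos)
    moreover have "Re (ip (X 0) g - ip (X 1) g) = \<alpha> 0 - \<alpha> 1" by (simp add: \<alpha>_def X0)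
    ultimately show ?thesis using complex_Re_le_cmod[of "ip (X 0) g - ip (X 1) g"] by linarith
  qed
  \<comment> \<open>The summand \<open>2 (\<alpha>\<^bsub>2k\<^esub> - \<alpha>\<^bsub>2k+1\<^esub>)\<close> carries the geometric series through the induction.\<close>
  have lower: "\<alpha> 0 - 2 * (\<alpha> 0 - \<alpha> 1) + 2 * (\<alpha> (2 * k) - \<alpha> (2 * k + 1)) \<le> \<alpha> (2 * k)" for k
  proof (induction k)
    case (Suc k)
    have "2 * Suc k = 2 * k + 2" "2 * Suc k + 1 = 2 * k + 3" by simp_all
    moreover have "x - 2 * y + 2 * (r - s) \<le> r"
      if "x - 2 * y + 2 * (p - q) \<le> p" "3 * (q - r) \<le> p - q" "r - s \<le> q - r" for x y p q r s :: real
      using that by argo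
    ultimately show ?case using Suc third[of k] convex[of k] by metis
  qed simp
  have big: "1 / 2 \<le> (nrm (X k))\<^sup>2" for k
    using lower[of k] start dec[of "2 * k"] nX[of k] nX[of 0] g(2) by (simp add: X0)
  obtain L where L: "\<alpha> \<longlonglongrightarrow> L"
    by (rule decseq_convergent[OF decseq, of 0]) (simp_all add: \<alpha>_nonneg)
  have cauchy: "\<exists>N. \<forall>i\<ge>N. \<forall>j\<ge>N. nrm (\<lambda>x. X i x - X j x) < r" if "r > 0" for r
  proof -
    have "0 < r\<^sup>2 / 4" using that by simp
    from LIMSEQ_D[OF L this] obtain N where N: "\<And>k. k \<ge> N \<Longrightarrow> \<bar>\<alpha> k - L\<bar> < r\<^sup>2 / 4"
      unfolding real_norm_def by blast
    have "nrm (\<lambda>x. X i x - X j x) < r" if "i \<ge> N" "j \<ge> N" for i j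
    proof (rule power2_less_imp_less)
      have "(nrm (\<lambda>x. X i x - X j x))\<^sup>2 = \<alpha> (2 * i) - 2 * \<alpha> (i + j) + \<alpha> (2 * j)"
        by (simp add: L2_norm_diff_sq[OF XL XL] ipX nX)
      also have "\<dots> < r\<^sup>2"
      proof -
        have "\<bar>\<alpha> (2 * i) - L\<bar> < r\<^sup>2 / 4" "\<bar>\<alpha> (2 * j) - L\<bar> < r\<^sup>2 / 4" "\<bar>\<alpha> (i + j) - L\<bar> < r\<^sup>2 / 4"
          using that by (intro N; simp)+
        then show ?thesis unfolding abs_less_iff by argo
      qed
      finally show "(nrm (\<lambda>x. X i x - X j x))\<^sup>2 < r\<^sup>2" .
    qed (use \<open>r > 0\<close> in simp)
    then show ?thesis by blast
  qed
  obtain f where f: "f \<in> L2 M" and lim: "(\<lambda>n. nrm (\<lambda>x. X n x - f x)) \<longlonglongrightarrow> 0"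
    by (rule L2_complete[OF sigma_finite_measure_axioms XL cauchy]) auto
  have fK: "ip f (e i) = 0" if "i < m" for i
  proof -
    have "cmod (ip f (e i)) \<le> nrm (\<lambda>x. X n x - f x) * nrm (e i)" for n
    proof -
      have "ip f (e i) = - ip (\<lambda>x. X n x - f x) (e i)"
        using K_orth[OF XK that] by (simp add: L2_inner_diff_left XL f eL that)
      then show ?thesis using L2_Cauchy_Schwarz[OF L2_diff[OF XL f] eL[OF that]] by simp
    qed
    moreover have "(\<lambda>n. nrm (\<lambda>x. X n x - f x) * nrm (e i)) \<longlonglongrightarrow> 0 * nrm (e i)"
      by (intro tendsto_intros lim)
    ultimately have "cmod (ip f (e i)) \<le> 0 * nrm (e i)"
      by (intro LIMSEQ_le[OF tendsto_const]) auto
    then show ?thesis by simp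
  qed
  have f0: "nrm f \<noteq> 0"
  proof
    assume "nrm f = 0"
    have half: "1 / 2 \<le> (nrm (\<lambda>x. X n x - f x))\<^sup>2" for n
    proof (rule order_trans[OF big[of n]], rule power_mono)
      have "nrm (X n) = nrm (\<lambda>x. (X n x - f x) + f x)" by simp
      also have "\<dots> \<le> nrm (\<lambda>x. X n x - f x) + nrm f"
        by (intro L2_norm_add_triangle L2_diff XL f)
      finally show "nrm (X n) \<le> nrm (\<lambda>x. X n x - f x)" using \<open>nrm f = 0\<close> by simp
    qed simp
    have "(\<lambda>n. (nrm (\<lambda>x. X n x - f x))\<^sup>2) \<longlonglongrightarrow> 0\<^sup>2" by (intro tendsto_intros lim)
    then have "1 / 2 \<le> (0::real)\<^sup>2" by (rule LIMSEQ_le_const) (use half in blast)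
    then show False by simp
  qed
  define u where "u = S f"
  have u: "(u, \<lambda>x. of_real c * u x + f x) \<in> A" unfolding u_def by (rule S[OF f])
  have uL: "u \<in> L2 M" using u A_dom_L2 by blast
  have \<epsilon>u: "(\<lambda>x. of_real \<epsilon> * u x) \<in> L2 M" by (intro L2_scale uL)
  obtain C where C: "C \<ge> 0" "\<And>u f. f \<in> L2 M \<Longrightarrow> (u, \<lambda>x. of_real c * u x + f x) \<in> A \<Longrightarrow> nrm u \<le> C * nrm f"
    using reg by (rule regular_estimate) blast
  have est: "nrm (\<lambda>x. of_real \<epsilon> * u x - f x) \<le> \<epsilon> * C * nrm (\<lambda>x. X n x - f x) + nrm (\<lambda>x. X (Suc n) x - f x)" for n
  proof -
    have XSL: "S (X n) \<in> L2 M" using S[OF XL] A_dom_L2 by blast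
    have "(\<lambda>x. 1 * S (X n) x + (-1) * u x, \<lambda>x. of_real c * (1 * S (X n) x + (-1) * u x) + (1 * X n x + (-1) * f x)) \<in> A"
      by (rule resolvent_lin[OF S[OF XL] u])
    then have *: "nrm (\<lambda>x. S (X n) x - u x) \<le> C * nrm (\<lambda>x. X n x - f x)"
      using C(2)[OF L2_diff[OF XL f], of "\<lambda>x. S (X n) x - u x"] by simp
    have "nrm (\<lambda>x. of_real \<epsilon> * u x - f x) = nrm (\<lambda>x. (X (Suc n) x - f x) - of_real \<epsilon> * (S (X n) x - u x))"
      by (intro arg_cong[where f=nrm]) (simp add: XSuc algebra_simps)
    also have "\<dots> \<le> nrm (\<lambda>x. X (Suc n) x - f x) + nrm (\<lambda>x. of_real \<epsilon> * (S (X n) x - u x))"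
      by (intro L2_norm_diff_triangle L2_scale L2_diff XL f XSL uL)
    also have "nrm (\<lambda>x. of_real \<epsilon> * (S (X n) x - u x)) \<le> \<epsilon> * (C * nrm (\<lambda>x. X n x - f x))"
      using * \<epsilon> by (simp only: L2_norm_scale) simp
    finally show ?thesis by (simp add: mult.assoc)
  qed
  have "(\<lambda>n. \<epsilon> * C * nrm (\<lambda>x. X n x - f x) + nrm (\<lambda>x. X (Suc n) x - f x)) \<longlonglongrightarrow> \<epsilon> * C * 0 + 0"
    by (intro tendsto_intros lim LIMSEQ_Suc[OF lim])
  then have "nrm (\<lambda>x. of_real \<epsilon> * u x - f x) \<le> \<epsilon> * C * 0 + 0"
    using est by (intro LIMSEQ_le[OF tendsto_const]) auto
  then have "nrm (\<lambda>x. of_real \<epsilon> * u x - f x) = 0" using L2_norm_nonneg[of M "\<lambda>x. of_real \<epsilon> * u x - f x"] by linarith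
  then have ae: "AE x in M. of_real \<epsilon> * u x - f x = 0"
    using L2_norm_eq_0[OF L2_diff[OF \<epsilon>u f]] by simp
  have "(u, \<lambda>x. of_real \<mu> * u x) \<in> A"
  proof (rule A_cong[OF u])
    show "AE x in M. of_real c * u x + f x = of_real \<mu> * u x"
      using ae by eventually_elim (auto simp: c_def algebra_simps)
    show "(\<lambda>x. of_real \<mu> * u x) \<in> L2 M" by (intro L2_scale uL)
  qed
  moreover have "nrm u \<noteq> 0"
  proof
    assume "nrm u = 0"
    then have "nrm (\<lambda>x. of_real \<epsilon> * u x) = 0" by (simp add: L2_norm_scale)
    moreover have "nrm f = nrm (\<lambda>x. of_real \<epsilon> * u x)"
      using ae by (intro L2_norm_cong L2_measurable f \<epsilon>u) (auto elim!: eventually_mono)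
    ultimately show False using f0 by simp
  qed
  moreover have "u \<in> K" unfolding u_def by (intro S_K f fK)
  ultimately show thesis by (intro that[OF \<mu>\<Lambda>])
qed

end

section \<open>Eigenvalue counts and the variational principle\<close>

lemma le_SUP_enat_nat:
  assumes "enat j \<le> (SUP x\<in>X. f x)" "1 \<le> j"
  shows "\<exists>x\<in>X. enat j \<le> f x"
proof (rule ccontr)
  assume "\<not> ?thesis"
  then have *: "f x < enat j" if "x \<in> X" for x using that by (auto simp: not_le)
  have "f x \<le> enat (j - 1)" if "x \<in> X" for x
    using *[OF that] assms(2) by (cases "f x") auto
  then have "(SUP x\<in>X. f x) \<le> enat (j - 1)" by (rule SUP_least)
  with assms have "enat j \<le> enat (j - 1)" using order_trans by blast
  then show False using assms(2) by simp
qed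

lemma enat_le_add_split:
  assumes "enat j \<le> x + y"
  shows "\<exists>j1 j2. j = j1 + j2 \<and> enat j1 \<le> x \<and> enat j2 \<le> y"
proof (cases x)
  case (enat p)
  show ?thesis
  proof (cases "j \<le> p")
    case True
    then show ?thesis using enat by (intro exI[of _ j] exI[of _ 0]) (auto simp: zero_enat_def[symmetric])
  next
    case False
    then have "j = p + (j - p)" "enat (j - p) \<le> y" using assms enat by (cases y; auto)+
    then show ?thesis using enat by blast
  qed
next
  case infinity
  then show ?thesis by (intro exI[of _ j] exI[of _ 0]) (auto simp: zero_enat_def[symmetric])
qed

lemma le_L2_dim:
  assumes "enat j \<le> L2_dim M V"
  shows "\<exists>u. (\<forall>i<j. u i \<in> V) \<and> L2_independent M j u"
proof (cases "j = 0")
  case True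
  then show ?thesis by (auto simp: L2_independent_def)
next
  case False
  with assms obtain m u where m: "j \<le> m" "\<forall>i<m. u i \<in> V" "L2_independent M m u"
    unfolding L2_dim_def using le_SUP_enat_nat[of j enat] by fastforce
  have "L2_independent M j u"
    unfolding L2_independent_def
  proof (intro allI impI)
    fix c :: "nat \<Rightarrow> complex" and i
    assume ae: "AE x in M. (\<Sum>i<j. c i * u i x) = 0" and "i < j"
    define c' where "c' i = (if i < j then c i else 0)" for i
    have "(\<Sum>i<m. c' i * u i x) = (\<Sum>i<j. c i * u i x)" for x
      using m(1) by (intro sum.mono_neutral_cong_right) (auto simp: c'_def)
    then have "AE x in M. (\<Sum>i<m. c' i * u i x) = 0" using ae by simp
    then have "c' i = 0" using m \<open>i < j\<close> by (auto simp: L2_independent_def)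
    then show "c i = 0" using \<open>i < j\<close> by (simp add: c'_def)
  qed
  with m show ?thesis by (intro exI[of _ u]) auto
qed

definition orthonormal :: "'a measure \<Rightarrow> nat \<Rightarrow> (nat \<Rightarrow> 'a \<Rightarrow> complex) \<Rightarrow> bool" where
  "orthonormal M j e \<longleftrightarrow> (\<forall>i<j. e i \<in> L2 M) \<and>
     (\<forall>i<j. \<forall>k<j. L2_inner M (e i) (e k) = (if i = k then 1 else 0))"

lemma orthonormal_norm: "orthonormal M j e \<Longrightarrow> i < j \<Longrightarrow> L2_norm M (e i) = 1"
proof -
  assume "orthonormal M j e" "i < j"
  then have "L2_inner M (e i) (e i) = 1" by (simp add: orthonormal_def)
  then have "(L2_norm M (e i))\<^sup>2 = 1" unfolding L2_inner_self by (metis of_real_eq_1_iff)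
  then show ?thesis using L2_norm_nonneg[of M "e i"] by (simp add: power2_eq_1_iff)
qed

lemma orthonormal_combination_inner:
  assumes "orthonormal M j e"
  shows "L2_inner M (\<lambda>x. \<Sum>i<j. c i * e i x) (\<lambda>x. \<Sum>i<j. d i * e i x) = (\<Sum>i<j. c i * cnj (d i))"
proof -
  have L: "i \<in> {..<j} \<Longrightarrow> e i \<in> L2 M" for i using assms by (simp add: orthonormal_def)
  have "L2_inner M (\<lambda>x. \<Sum>i<j. c i * e i x) (\<lambda>x. \<Sum>i<j. d i * e i x)
      = (\<Sum>i<j. c i * (\<Sum>k<j. cnj (d k) * L2_inner M (e i) (e k)))"
    using L by (subst L2_inner_sum_left[OF L L2_sum[OF L]]) (auto intro!: sum.cong L2_inner_sum_right)
  also have "\<dots> = (\<Sum>i<j. c i * cnj (d i))"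
  proof (intro sum.cong refl)
    fix i assume i: "i \<in> {..<j}"
    have "(\<Sum>k<j. cnj (d k) * L2_inner M (e i) (e k)) = (\<Sum>k<j. if k = i then cnj (d k) else 0)"
      using assms i by (intro sum.cong) (auto simp: orthonormal_def)
    then show "c i * (\<Sum>k<j. cnj (d k) * L2_inner M (e i) (e k)) = c i * cnj (d i)" using i by simp
  qed
  finally show ?thesis .
qed

lemma orthonormal_combination_norm:
  assumes "orthonormal M j e"
  shows "(L2_norm M (\<lambda>x. \<Sum>i<j. c i * e i x))\<^sup>2 = (\<Sum>i<j. (cmod (c i))\<^sup>2)"
proof -
  have "complex_of_real ((L2_norm M (\<lambda>x. \<Sum>i<j. c i * e i x))\<^sup>2) = (\<Sum>i<j. c i * cnj (c i))"
    unfolding L2_inner_self[symmetric] by (rule orthonormal_combination_inner[OF assms])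
  also have "\<dots> = complex_of_real (\<Sum>i<j. (cmod (c i))\<^sup>2)"
    unfolding of_real_sum by (intro sum.cong refl complex_norm_square[symmetric])
  finally show ?thesis by (metis of_real_eq_iff)
qed

lemma orthonormal_independent:
  assumes "orthonormal M j e"
  shows "L2_independent M j e"
  unfolding L2_independent_def
proof (intro allI impI)
  fix c :: "nat \<Rightarrow> complex" and i
  assume ae: "AE x in M. (\<Sum>i<j. c i * e i x) = 0" and "i < j"
  have "(\<lambda>x. \<Sum>i<j. c i * e i x) \<in> L2 M" using assms by (intro L2_sum) (simp add: orthonormal_def)
  then have "(L2_norm M (\<lambda>x. \<Sum>i<j. c i * e i x))\<^sup>2 = 0" using ae by (simp add: L2_norm_eq_0)
  then have "(\<Sum>i<j. (cmod (c i))\<^sup>2) = 0" unfolding orthonormal_combination_norm[OF assms] .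
  then show "c i = 0" using \<open>i < j\<close> by (simp add: sum_nonneg_eq_0_iff)
qed

lemma orthonormal_extend:
  assumes e: "orthonormal M m e" and v: "v \<in> L2 M" "L2_norm M v \<noteq> 0" "\<And>i. i < m \<Longrightarrow> L2_inner M v (e i) = 0"
  shows "orthonormal M (Suc m) (e(m := (\<lambda>x. complex_of_real (1 / L2_norm M v) * v x)))"
proof -
  let ?k = "complex_of_real (1 / L2_norm M v)"
  let ?v = "\<lambda>x. ?k * v x"
  have L: "e i \<in> L2 M" if "i < m" for i using e that by (simp add: orthonormal_def)
  have 1: "L2_inner M ?v ?v = 1"
    using v(2) unfolding L2_inner_scale_left[OF v(1) L2_scale[OF v(1)]] L2_inner_scale_right[OF v(1) v(1)]
    unfolding L2_inner_self by (simp add: power2_eq_square)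
  have 2: "L2_inner M ?v (e i) = 0" if "i < m" for i
    using L2_inner_scale_left[OF v(1) L[OF that], of ?k] v(3)[OF that] by simp
  have 3: "L2_inner M (e i) ?v = 0" if "i < m" for i
    using 2[OF that] L2_inner_commute[of M "e i" ?v] by simp
  have 4: "L2_inner M (e i) (e k) = (if i = k then 1 else 0)" if "i < m" "k < m" for i k
    using e that by (simp add: orthonormal_def)
  show ?thesis unfolding orthonormal_def
  proof (intro conjI allI impI)
    fix i assume "i < Suc m"
    then show "(e(m := ?v)) i \<in> L2 M" using L L2_scale[OF v(1), of ?k]
      by (cases "i = m") (simp_all only: fun_upd_apply if_True if_False refl less_Suc_eq, auto)
  next
    fix i k assume "i < Suc m" "k < Suc m"
    then show "L2_inner M ((e(m := ?v)) i) ((e(m := ?v)) k) = (if i = k then 1 else 0)"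
      using 1 2 3 4 by (cases "i = m"; cases "k = m") (simp_all only: fun_upd_apply if_True if_False refl, auto)
  qed
qed

lemma orthogonal_combination:
  assumes "\<And>k. k < j \<Longrightarrow> w k \<in> L2 M" "\<And>i. i < m \<Longrightarrow> e i \<in> L2 M" "L2_independent M j w" "m < j"
  obtains c where "L2_norm M (\<lambda>x. \<Sum>k<j. c k * w k x) \<noteq> 0"
    "\<And>i. i < m \<Longrightarrow> L2_inner M (\<lambda>x. \<Sum>k<j. c k * w k x) (e i) = 0"
proof -
  obtain c where c: "\<exists>k\<in>{..<j}. c k \<noteq> 0" "\<forall>i<m. (\<Sum>k<j. c k * L2_inner M (w k) (e i)) = 0"
    using homogeneous_system_nontrivial[of "{..<j}" m "\<lambda>i k. L2_inner M (w k) (e i)"] assms(4) by auto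
  have "L2_norm M (\<lambda>x. \<Sum>k<j. c k * w k x) \<noteq> 0"
  proof
    assume "L2_norm M (\<lambda>x. \<Sum>k<j. c k * w k x) = 0"
    moreover have "(\<lambda>x. \<Sum>k<j. c k * w k x) \<in> L2 M" using assms(1) by (intro L2_sum) auto
    ultimately have "AE x in M. (\<Sum>k<j. c k * w k x) = 0" by (simp add: L2_norm_eq_0)
    then show False using assms(3) c(1) by (auto simp: L2_independent_def)
  qed
  moreover have "L2_inner M (\<lambda>x. \<Sum>k<j. c k * w k x) (e i) = 0" if "i < m" for i
    using L2_inner_sum_left[of "{..<j}" w M "e i" c] assms(1,2) c(2) that by simp
  ultimately show thesis by (rule that)
qed

lemma orthonormal_of_independent:
  assumes V: "V \<subseteq> L2 M" and lin: "\<And>u c (k::nat). (\<And>i. i < k \<Longrightarrow> u i \<in> V) \<Longrightarrow> (\<lambda>x. \<Sum>i<k. c i * u i x) \<in> V"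
    and u: "\<forall>i<j. u i \<in> V" "L2_independent M j u" and "m \<le> j"
  shows "\<exists>e. (\<forall>i<m. e i \<in> V) \<and> orthonormal M m e"
  using \<open>m \<le> j\<close>
proof (induction m)
  case 0
  then show ?case by (auto simp: orthonormal_def)
next
  case (Suc m)
  then obtain e where e: "\<forall>i<m. e i \<in> V" "orthonormal M m e" by auto
  obtain c where c: "L2_norm M (\<lambda>x. \<Sum>k<j. c k * u k x) \<noteq> 0"
    "\<And>i. i < m \<Longrightarrow> L2_inner M (\<lambda>x. \<Sum>k<j. c k * u k x) (e i) = 0"
    by (rule orthogonal_combination[of j u M m e]) (use u e V Suc.prems in auto)
  let ?v = "\<lambda>x. \<Sum>k<j. c k * u k x"
  have v: "?v \<in> V" by (rule lin) (use u(1) in auto)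
  let ?k = "complex_of_real (1 / L2_norm M ?v)"
  have "(\<lambda>x. \<Sum>i<(1::nat). ?k * ?v x) \<in> V" by (rule lin[of 1 "\<lambda>_. ?v" "\<lambda>_. ?k"]) (rule v)
  then have kv: "(\<lambda>x. ?k * ?v x) \<in> V" by simp
  have "orthonormal M (Suc m) (e(m := (\<lambda>x. ?k * ?v x)))"
    by (rule orthonormal_extend[OF e(2) _ c]) (use v V in auto)
  moreover have "\<forall>i<Suc m. (e(m := (\<lambda>x. ?k * ?v x))) i \<in> V"
    using e(1) kv by (simp add: less_Suc_eq)
  ultimately show ?case by blast
qed

context form_operator
begin

text \<open>Repeated values of \<open>t\<close> stand for multiplicities, so an eigenvalue count is the size of a longest
  family (lemmas \<open>eigen_count_family\<close> and \<open>family_eigen_count\<close>).\<close>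

definition eigenfamily :: "nat \<Rightarrow> (nat \<Rightarrow> 'a \<Rightarrow> complex) \<Rightarrow> (nat \<Rightarrow> real) \<Rightarrow> bool" where
  "eigenfamily j e t \<longleftrightarrow> orthonormal M j e \<and> (\<forall>i<j. (e i, \<lambda>x. of_real (t i) * e i x) \<in> A)"

lemma H_sum:
  assumes "finite I" "\<And>i. i \<in> I \<Longrightarrow> u i \<in> H"
  shows "(\<lambda>x. \<Sum>i\<in>I. c i * u i x) \<in> H"
  using assms
proof (induction I rule: finite_induct)
  case (insert i I)
  then have "(\<lambda>x. c i * u i x + 1 * (\<Sum>i\<in>I. c i * u i x)) \<in> H" by (intro H_lin) auto
  then show ?case using insert by simp
qed (simp add: H_zero)

lemma A_sum:
  assumes "finite I" "\<And>i. i \<in> I \<Longrightarrow> (u i, w i) \<in> A"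
  shows "(\<lambda>x. \<Sum>i\<in>I. c i * u i x, \<lambda>x. \<Sum>i\<in>I. c i * w i x) \<in> A"
  using assms
proof (induction I rule: finite_induct)
  case empty
  have "a (\<lambda>x. 0) v = 0" if "v \<in> H" for v
    using a_lin[OF H_zero H_zero that, of 0 0] by simp
  then show ?case by (simp add: A_def H_zero L2_inner_def)
next
  case (insert i I)
  then have "(\<lambda>x. c i * u i x + 1 * (\<Sum>i\<in>I. c i * u i x), \<lambda>x. c i * w i x + 1 * (\<Sum>i\<in>I. c i * w i x)) \<in> A"
    by (intro A_lin) auto
  then show ?case using insert by simp
qed

lemma eigenfamily_form:
  assumes "eigenfamily j e t"
  shows "Re (a (\<lambda>x. \<Sum>i<j. c i * e i x) (\<lambda>x. \<Sum>i<j. c i * e i x)) = (\<Sum>i<j. t i * (cmod (c i))\<^sup>2)"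
proof -
  have on: "orthonormal M j e" and eA: "\<And>i. i < j \<Longrightarrow> (e i, \<lambda>x. of_real (t i) * e i x) \<in> A"
    using assms by (auto simp: eigenfamily_def)
  have "(\<lambda>x. \<Sum>i<j. c i * e i x, \<lambda>x. \<Sum>i<j. c i * (of_real (t i) * e i x)) \<in> A"
    by (rule A_sum) (auto intro: eA)
  moreover have "(\<lambda>x. \<Sum>i<j. c i * e i x) \<in> H"
    by (rule H_sum) (auto intro: A_H eA)
  ultimately have "a (\<lambda>x. \<Sum>i<j. c i * e i x) (\<lambda>x. \<Sum>i<j. c i * e i x)
      = ip (\<lambda>x. \<Sum>i<j. (c i * of_real (t i)) * e i x) (\<lambda>x. \<Sum>i<j. c i * e i x)"
    using A_form by (simp add: mult.assoc)
  also have "\<dots> = (\<Sum>i<j. (c i * of_real (t i)) * cnj (c i))"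
    by (rule orthonormal_combination_inner[OF on])
  also have "\<dots> = of_real (\<Sum>i<j. t i * (cmod (c i))\<^sup>2)"
    unfolding of_real_sum of_real_mult complex_norm_square by (simp only: mult_ac)
  finally show ?thesis by (simp only: Re_complex_of_real)
qed

lemma eigenvectors_orthogonal:
  assumes "(e, \<lambda>x. of_real s * e x) \<in> A" "(f, \<lambda>x. of_real t * f x) \<in> A" "s \<noteq> t"
  shows "ip e f = 0"
proof -
  have L: "e \<in> L2 M" "f \<in> L2 M" using assms A_dom_L2 by auto
  have "of_real s * ip e f = of_real t * ip e f"
    using A_symmetric[OF assms(1,2)] by (simp add: L2_inner_scale_left L2_inner_scale_right L)
  then show ?thesis using assms(3) by simp
qed

lemma eigenspace_family:
  assumes "enat j \<le> eigen_mult M A (of_real s)"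
  shows "\<exists>e. eigenfamily j e (\<lambda>_. s)"
proof -
  obtain u where u: "\<forall>i<j. u i \<in> eigenspace A (of_real s)" "L2_independent M j u"
    using le_L2_dim assms unfolding eigen_mult_def by blast
  have "\<exists>e. (\<forall>i<j. e i \<in> eigenspace A (of_real s)) \<and> orthonormal M j e"
  proof (rule orthonormal_of_independent[OF _ _ u])
    show "eigenspace A (of_real s) \<subseteq> L2 M" by (auto simp: eigenspace_def A_dom_L2)
    show "(\<lambda>x. \<Sum>i<k. c i * u i x) \<in> eigenspace A (of_real s)"
      if "\<And>i. i < k \<Longrightarrow> u i \<in> eigenspace A (of_real s)" for u c and k :: nat
    proof -
      have "(\<lambda>x. \<Sum>i<k. c i * u i x, \<lambda>x. \<Sum>i<k. c i * (of_real s * u i x)) \<in> A"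
        using that by (intro A_sum) (auto simp: eigenspace_def)
      then show ?thesis by (simp add: eigenspace_def sum_distrib_left mult.left_commute)
    qed
  qed simp
  then show ?thesis by (auto simp: eigenfamily_def eigenspace_def)
qed

lemma eigenfamily_append:
  assumes 1: "eigenfamily j1 e1 t1" and 2: "eigenfamily j2 e2 t2"
    and ne: "\<And>i k. i < j1 \<Longrightarrow> k < j2 \<Longrightarrow> t1 i \<noteq> t2 k"
  shows "eigenfamily (j1 + j2) (\<lambda>i. if i < j1 then e1 i else e2 (i - j1)) (\<lambda>i. if i < j1 then t1 i else t2 (i - j1))"
proof -
  have o12: "ip (e1 i) (e2 k) = 0" "ip (e2 k) (e1 i) = 0" if "i < j1" "k < j2" for i k
    using eigenvectors_orthogonal ne[OF that] 1 2 that by (auto simp: eigenfamily_def) metis+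
  show ?thesis unfolding eigenfamily_def orthonormal_def
  proof (intro conjI allI impI)
    fix i k assume "i < j1 + j2" "k < j1 + j2"
    then show "ip (if i < j1 then e1 i else e2 (i - j1)) (if k < j1 then e1 k else e2 (k - j1)) = (if i = k then 1 else 0)"
      using o12[of i "k - j1"] o12[of k "i - j1"] 1 2
      by (auto simp: eigenfamily_def orthonormal_def)
  qed (use 1 2 in \<open>auto simp: eigenfamily_def orthonormal_def\<close>)
qed

lemma eigen_count_family:
  assumes "enat j \<le> eigen_count M A S"
  shows "\<exists>e t. eigenfamily j e t \<and> (\<forall>i<j. t i \<in> S)"
proof (cases "j = 0")
  case True
  then show ?thesis by (auto simp: eigenfamily_def orthonormal_def)
next
  case False
  have main: "\<exists>e t. eigenfamily j e t \<and> (\<forall>i<j. t i \<in> F)"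
    if "finite F" "enat j \<le> (\<Sum>t\<in>F. eigen_mult M A (complex_of_real t))" for F j
    using that
  proof (induction F arbitrary: j rule: finite_induct)
    case empty
    then have "j = 0" by (simp add: zero_enat_def)
    then show ?case by (auto simp: eigenfamily_def orthonormal_def)
  next
    case (insert s F)
    then obtain j1 j2 where j: "j = j1 + j2" "enat j1 \<le> eigen_mult M A (of_real s)"
        "enat j2 \<le> (\<Sum>t\<in>F. eigen_mult M A (complex_of_real t))"
      using enat_le_add_split by (metis sum.insert)
    obtain e1 where e1: "eigenfamily j1 e1 (\<lambda>_. s)" using eigenspace_family[OF j(2)] by blast
    obtain e2 t2 where e2: "eigenfamily j2 e2 t2" "\<forall>i<j2. t2 i \<in> F" using insert.IH[OF j(3)] by blast
    have "eigenfamily (j1 + j2) (\<lambda>i. if i < j1 then e1 i else e2 (i - j1)) (\<lambda>i. if i < j1 then s else t2 (i - j1))"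
      using eigenfamily_append[OF e1 e2(1)] e2(2) insert.hyps by fastforce
    moreover have "\<forall>i<j. (if i < j1 then s else t2 (i - j1)) \<in> insert s F" using e2(2) j(1) by auto
    ultimately show ?case using j(1)
      by (intro exI[of _ "\<lambda>i. if i < j1 then e1 i else e2 (i - j1)"] exI[of _ "\<lambda>i. if i < j1 then s else t2 (i - j1)"]) simp
  qed
  obtain F where "finite F" "F \<subseteq> S" "enat j \<le> (\<Sum>t\<in>F. eigen_mult M A (complex_of_real t))"
    using le_SUP_enat_nat[OF assms[unfolded eigen_count_def]] False by auto
  with main[of F j] show ?thesis by blast
qed

lemma family_eigen_mult:
  assumes f: "eigenfamily j e t" and I: "I \<subseteq> {i. i < j \<and> t i = s}"
  shows "enat (card I) \<le> eigen_mult M A (of_real s)"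
proof -
  have "finite I" using I finite_subset[of I "{..<j}"] by auto
  then obtain h where h: "bij_betw h {0..<card I} I" using ex_bij_betw_nat_finite by blast
  have hI: "h i < j" "t (h i) = s" if "i < card I" for i
    using bij_betwE[OF h] that I by auto
  have hinj: "h i = h k \<longleftrightarrow> i = k" if "i < card I" "k < card I" for i k
    using bij_betw_imp_inj_on[OF h] that by (auto simp: inj_on_def)
  have "orthonormal M (card I) (e \<circ> h)"
    using f hI hinj by (auto simp: eigenfamily_def orthonormal_def)
  then have "L2_independent M (card I) (e \<circ> h)" by (rule orthonormal_independent)
  moreover have "\<forall>i<card I. (e \<circ> h) i \<in> eigenspace A (of_real s)"
    using f hI by (auto simp: eigenfamily_def eigenspace_def)
  ultimately show ?thesis unfolding eigen_mult_def L2_dim_def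
    by (intro SUP_upper2[of "card I"] CollectI exI[of _ "e \<circ> h"] conjI) auto
qed

lemma family_eigen_count:
  assumes f: "eigenfamily j e t" and S: "\<And>i. i < j \<Longrightarrow> t i \<in> S"
  shows "enat j \<le> eigen_count M A S"
proof -
  let ?F = "t ` {..<j}"
  have "(\<Sum>i<j. 1::nat) = (\<Sum>s\<in>?F. \<Sum>i\<in>{i. i \<in> {..<j} \<and> t i = s}. 1)"
    by (rule sum.image_gen) simp
  then have "j = (\<Sum>s\<in>?F. card {i. i < j \<and> t i = s})" by simp
  then have "enat j = (\<Sum>s\<in>?F. enat (card {i. i < j \<and> t i = s}))"
    unfolding of_nat_eq_enat[symmetric] by (metis of_nat_sum)
  also have "\<dots> \<le> (\<Sum>s\<in>?F. eigen_mult M A (complex_of_real s))"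
    by (intro sum_mono family_eigen_mult[OF f]) auto
  also have "\<dots> \<le> eigen_count M A S"
    unfolding eigen_count_def using S by (intro SUP_upper) auto
  finally show ?thesis .
qed

lemma family_max:
  assumes "enat j \<le> eigen_count M A S" "1 \<le> j"
  shows "\<exists>t\<in>S. 0 < eigen_mult M A (of_real t) \<and> enat j \<le> eigen_count M A {..t}"
proof -
  obtain e t where f: "eigenfamily j e t" "\<forall>i<j. t i \<in> S" using eigen_count_family[OF assms(1)] by blast
  let ?T = "t ` {..<j}"
  have "?T \<noteq> {}" using assms(2) by (auto simp: lessThan_empty_iff)
  then have "Max ?T \<in> ?T" by (intro Max_in) auto
  then obtain i where i: "i < j" "Max ?T = t i" by auto
  have "enat (card {i}) \<le> eigen_mult M A (of_real (t i))"
    by (rule family_eigen_mult[OF f(1)]) (use i in auto)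
  then have "0 < eigen_mult M A (of_real (t i))"
    by (cases "eigen_mult M A (of_real (t i))") (auto simp: zero_enat_def)
  moreover have "enat j \<le> eigen_count M A {..t i}"
  proof (rule family_eigen_count[OF f(1)])
    show "t k \<in> {..t i}" if "k < j" for k
      using that i(2) by (simp add: flip: i(2))
  qed
  ultimately show ?thesis using f(2) i(1) by blast
qed

lemma eigen_mult_pos:
  assumes "0 < eigen_mult M A (of_real t)"
  obtains e where "(e, \<lambda>x. of_real t * e x) \<in> A" "nrm e = 1"
proof -
  have "enat 1 \<le> eigen_mult M A (of_real t)"
    using assms by (cases "eigen_mult M A (of_real t)") (auto simp: zero_enat_def)
  from eigenspace_family[OF this] obtain e where "eigenfamily 1 e (\<lambda>_. t)" by blast
  then have "orthonormal M 1 e" and e: "(e 0, \<lambda>x. of_real t * e 0 x) \<in> A"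
    by (simp_all add: eigenfamily_def)
  then have "nrm (e 0) = 1" using orthonormal_norm[of M 1 e 0] by simp
  with e show thesis by (rule that)
qed

lemma eigenvalue_nonneg:
  assumes "(e, \<lambda>x. of_real t * e x) \<in> A" "nrm e = 1"
  shows "0 \<le> t"
proof -
  have "a e e = of_real t * ip e e"
    using A_form[OF assms(1) A_H[OF assms(1)]] A_dom_L2[OF assms(1)] by (simp add: L2_inner_scale_left)
  then show ?thesis using a_nonneg[of e] assms(2) by (simp add: L2_inner_self)
qed

text \<open>A point of accumulation of eigenvalues is in the spectrum without being isolated, so it cannot be below
  the threshold.\<close>

lemma finite_eigenvalues_below:
  assumes "ereal t0 < threshold M A"
  shows "finite {t. t \<le> t0 \<and> 0 < eigen_mult M A (of_real t)}" (is "finite ?E")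
proof (rule ccontr)
  assume "infinite ?E"
  moreover have "?E \<subseteq> {0..t0}"
  proof
    fix t assume t: "t \<in> ?E"
    then have "0 < eigen_mult M A (of_real t)" by simp
    then obtain e where "(e, \<lambda>x. of_real t * e x) \<in> A" "nrm e = 1" by (rule eigen_mult_pos)
    then show "t \<in> {0..t0}" using eigenvalue_nonneg t by auto
  qed
  ultimately obtain p where p: "p \<in> {0..t0}" "p islimpt ?E"
    using compact_eq_Bolzano_Weierstrass[of "{0..t0}"] compact_Icc[of 0 t0] by blast
  have near: "\<exists>t e. t \<noteq> p \<and> \<bar>t - p\<bar> < d \<and> (e, \<lambda>x. of_real t * e x) \<in> A \<and> nrm e = 1" if "d > 0" for d
  proof -
    have "\<forall>d>0. \<exists>t\<in>?E. t \<noteq> p \<and> dist t p < d" using p(2) by (simp only: islimpt_approachable)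
    with that obtain t where "t \<in> ?E" "t \<noteq> p" "dist t p < d" by blast
    from \<open>t \<in> ?E\<close> have "0 < eigen_mult M A (of_real t)" by simp
    then obtain e where "(e, \<lambda>x. of_real t * e x) \<in> A" "nrm e = 1" by (rule eigen_mult_pos)
    with \<open>t \<noteq> p\<close> \<open>dist t p < d\<close> show ?thesis unfolding dist_real_def by blast
  qed
  have "\<not> regular p"
  proof
    assume "regular p"
    then obtain C where C: "C \<ge> 0" "\<And>u f. f \<in> L2 M \<Longrightarrow> (u, \<lambda>x. of_real p * u x + f x) \<in> A \<Longrightarrow> nrm u \<le> C * nrm f"
      by (rule regular_estimate) blast
    have "0 < 1 / (C + 1)" using C(1) by simp
    from near[OF this]
    obtain t e where t: "\<bar>t - p\<bar> < 1 / (C + 1)" "(e, \<lambda>x. of_real t * e x) \<in> A" "nrm e = 1"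
      by blast
    have "nrm e \<le> C * nrm (\<lambda>x. of_real (t - p) * e x)"
    proof (rule C(2))
      show "(\<lambda>x. of_real (t - p) * e x) \<in> L2 M" by (rule L2_scale[OF A_dom_L2[OF t(2)]])
      show "(e, \<lambda>x. of_real p * e x + of_real (t - p) * e x) \<in> A" using t(2) by (simp add: algebra_simps)
    qed
    also have "\<dots> = C * \<bar>t - p\<bar>" using t(3) unfolding L2_norm_scale norm_of_real by simp
    also have "\<dots> \<le> C * (1 / (C + 1))" using t(1) C(1) by (intro mult_left_mono) auto
    also have "\<dots> < 1" using C(1) by (simp add: field_simps)
    finally show False using t(3) by simp
  qed
  moreover have "ereal p < threshold M A" using p(1) assms by (meson atLeastAtMost_iff ereal_less_eq(3) le_less_trans)
  ultimately obtain d where d: "d > 0" "\<forall>t. t \<noteq> p \<longrightarrow> \<bar>t - p\<bar> < d \<longrightarrow> regular t"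
    using below_threshold_isolated by blast
  obtain t e where "t \<noteq> p" "\<bar>t - p\<bar> < d" "(e, \<lambda>x. of_real t * e x) \<in> A" "nrm e = 1"
    using near[OF d(1)] by blast
  then show False using d(2) eigenvalue_not_regular[of e t] by simp
qed

text \<open>Only finitely many eigenvalues compete for the least one, which is therefore attained; otherwise the
  operator \<open>LEAST\<close> would return an arbitrary number.\<close>

lemma nth_eigenvalue_props:
  assumes j: "1 \<le> j" and count: "enat j \<le> eigen_count M A {t. ereal t < threshold M A}"
  shows "ereal (nth_eigenvalue M A j) < threshold M A" (is ?A)
    and "enat j \<le> eigen_count M A {..nth_eigenvalue M A j}" (is ?B)
    and "\<And>t. ereal t < threshold M A \<Longrightarrow> enat j \<le> eigen_count M A {..t} \<Longrightarrow> nth_eigenvalue M A j \<le> t"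
proof -
  define P where "P t \<longleftrightarrow> ereal t < threshold M A \<and> 0 < eigen_mult M A (of_real t) \<and>
      enat j \<le> eigen_count M A {..t}" for t
  obtain t0 where t0: "P t0" using family_max[OF count j] by (auto simp: P_def)
  define Q where "Q = {t. P t \<and> t \<le> t0}"
  have "finite Q" by (rule finite_subset[OF _ finite_eigenvalues_below[of t0]]) (use t0 in \<open>auto simp: Q_def P_def\<close>)
  moreover have "Q \<noteq> {}" using t0 by (auto simp: Q_def)
  ultimately have m: "Min Q \<in> Q" "\<And>t. t \<in> Q \<Longrightarrow> Min Q \<le> t" by auto
  have min: "Min Q \<le> t" if "P t" for t
    using m that by (cases "t \<le> t0") (fastforce simp: Q_def)+
  have nth: "nth_eigenvalue M A j = Min Q"
    unfolding nth_eigenvalue_def P_def[symmetric] using m(1) min by (intro Least_equality) (auto simp: Q_def)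
  have "P (nth_eigenvalue M A j)" using m(1) by (simp add: nth Q_def)
  then show ?A ?B by (auto simp: P_def)
  fix t assume t: "ereal t < threshold M A" "enat j \<le> eigen_count M A {..t}"
  then obtain t' where "t' \<le> t" "0 < eigen_mult M A (of_real t')" "enat j \<le> eigen_count M A {..t'}"
    using family_max[OF t(2) j] by auto
  moreover have "ereal t' < threshold M A" using \<open>t' \<le> t\<close> t(1) by (meson ereal_less_eq(3) le_less_trans)
  ultimately show "nth_eigenvalue M A j \<le> t" using min[of t'] unfolding nth P_def by linarith
qed

text \<open>Each step of the induction applies \<open>bottom_is_eigenvalue\<close> to a combination of the \<open>w\<^sub>i\<close> that is orthogonal to
  the eigenvectors found so far.\<close>

theorem minmax_upper:
  assumes \<Lambda>: "ereal \<Lambda> < threshold M A" and w: "\<And>i. i < j \<Longrightarrow> w i \<in> H" "L2_independent M j w"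
    and le: "\<And>c. Re (a (\<lambda>x. \<Sum>i<j. c i * w i x) (\<lambda>x. \<Sum>i<j. c i * w i x))
        \<le> \<Lambda> * (nrm (\<lambda>x. \<Sum>i<j. c i * w i x))\<^sup>2"
  shows "enat j \<le> eigen_count M A {..\<Lambda>}"
proof -
  have "\<exists>e t. eigenfamily m e t \<and> (\<forall>i<m. t i \<le> \<Lambda>)" if "m \<le> j" for m
    using that
  proof (induction m)
    case 0
    then show ?case by (auto simp: eigenfamily_def orthonormal_def)
  next
    case (Suc m)
    then obtain e t where e: "eigenfamily m e t" "\<forall>i<m. t i \<le> \<Lambda>" by auto
    then have on: "orthonormal M m e" and eA: "\<And>i. i < m \<Longrightarrow> (e i, \<lambda>x. of_real (t i) * e i x) \<in> A"
      by (auto simp: eigenfamily_def)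
    have eL: "e i \<in> L2 M" if "i < m" for i using on that by (simp add: orthonormal_def)
    obtain c where c: "nrm (\<lambda>x. \<Sum>k<j. c k * w k x) \<noteq> 0"
      "\<And>i. i < m \<Longrightarrow> ip (\<lambda>x. \<Sum>k<j. c k * w k x) (e i) = 0"
      by (rule orthogonal_combination[of j w M m e]) (use w H_L2 eL Suc.prems in auto)
    let ?v = "\<lambda>x. \<Sum>k<j. c k * w k x"
    define K where "K = {v \<in> H. \<forall>i<m. ip v (e i) = 0}"
    have v: "?v \<in> K" using c(2) w(1) by (auto simp: K_def intro!: H_sum)
    have n: "nrm (e i) \<noteq> 0" if "i < m" for i using orthonormal_norm[OF on that] by simp
    obtain u \<mu> where u: "\<mu> \<le> \<Lambda>" "u \<in> K" "nrm u \<noteq> 0" "(u, \<lambda>x. of_real \<mu> * u x) \<in> A"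
      by (rule bottom_is_eigenvalue[of m e t K ?v \<Lambda>, OF _ _ K_def v c(1) le \<Lambda>]) (erule eA, erule n, blast)
    let ?k = "complex_of_real (1 / nrm u)"
    let ?e = "e(m := (\<lambda>x. ?k * u x))" and ?t = "t(m := \<mu>)"
    have "orthonormal M (Suc m) ?e"
      by (rule orthonormal_extend[OF on A_dom_L2[OF u(4)] u(3)]) (use u(2) in \<open>simp add: K_def\<close>)
    moreover have "(\<lambda>x. ?k * u x, \<lambda>x. of_real \<mu> * (?k * u x)) \<in> A"
      using A_lin[OF u(4) u(4), of ?k 0] by (simp add: mult.left_commute)
    then have "\<forall>i<Suc m. (?e i, \<lambda>x. of_real (?t i) * ?e i x) \<in> A"
      using eA by (auto simp: less_Suc_eq)
    moreover have "\<forall>i<Suc m. ?t i \<le> \<Lambda>" using e(2) u(1) by (auto simp: less_Suc_eq)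
    ultimately show ?case unfolding eigenfamily_def by blast
  qed
  from this[of j] obtain e t where "eigenfamily j e t" "\<forall>i<j. t i \<le> \<Lambda>" by auto
  then show ?thesis by (intro family_eigen_count) auto
qed

definition energy :: "('a \<Rightarrow> complex) \<Rightarrow> real" where
  "energy u = sqrt (Re (a u u))"

lemma energy_nonneg [simp]: "0 \<le> energy u"
  by (simp add: energy_def a_nonneg)

lemma energy_sq: "(energy u)\<^sup>2 = Re (a u u)"
  by (simp add: energy_def a_nonneg)

lemma energy_scale:
  assumes "u \<in> H"
  shows "energy (\<lambda>x. c * u x) = cmod c * energy u"
proof -
  have cu: "(\<lambda>x. c * u x) \<in> H" using H_lin[OF assms assms, of c 0] by simp
  have "a (\<lambda>x. c * u x) (\<lambda>x. c * u x) = (c * cnj c) * a u u"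
    using a_lin[OF assms assms cu, of c 0] a_lin_right[OF assms assms assms, of c 0] by simp
  then have "Re (a (\<lambda>x. c * u x) (\<lambda>x. c * u x)) = (cmod c)\<^sup>2 * Re (a u u)"
    by (simp only: complex_norm_square[symmetric] Re_of_real_mult)
  then show ?thesis by (simp add: energy_def real_sqrt_mult)
qed

lemma energy_triangle:
  assumes "u \<in> H" "v \<in> H"
  shows "energy (\<lambda>x. u x + v x) \<le> energy u + energy v"
proof (rule power2_le_imp_le)
  have "(cmod (a u v - of_real 0 * ip u v))\<^sup>2
    \<le> (Re (a u u) - 0 * (nrm u)\<^sup>2) * (Re (a v v) - 0 * (nrm v)\<^sup>2)"
    by (rule form_Cauchy_Schwarz[of H]) (auto intro: H_lin assms simp: a_nonneg)
  then have "(cmod (a u v))\<^sup>2 \<le> (energy u * energy v)\<^sup>2"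
    by (simp add: power_mult_distrib energy_sq)
  then have "cmod (a u v) \<le> energy u * energy v"
    by (rule power2_le_imp_le) simp
  then have le: "Re (a u v) \<le> energy u * energy v" using complex_Re_le_cmod order_trans by blast
  have uv: "(\<lambda>x. u x + v x) \<in> H" using H_lin[OF assms, of 1 1] by simp
  have "a (\<lambda>x. u x + v x) (\<lambda>x. u x + v x) = a u u + a u v + (a v u + a v v)"
    using a_lin[OF assms uv, of 1 1] a_lin_right[OF assms assms(1), of 1 1] a_lin_right[OF assms assms(2), of 1 1] by simp
  moreover have "Re (a v u) = Re (a u v)" using a_commute[of v u] by simp
  ultimately show "(energy (\<lambda>x. u x + v x))\<^sup>2 \<le> (energy u + energy v)\<^sup>2"
    unfolding energy_sq power2_sum using le by simp
qed simp

lemma energy_sum: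
  assumes "finite I" "\<And>i. i \<in> I \<Longrightarrow> u i \<in> H"
  shows "energy (\<lambda>x. \<Sum>i\<in>I. c i * u i x) \<le> (\<Sum>i\<in>I. cmod (c i) * energy (u i))"
  using assms
proof (induction I rule: finite_induct)
  case empty
  have "a (\<lambda>x. 0) (\<lambda>x. 0) = 0" using a_lin[OF H_zero H_zero H_zero, of 0 0] by simp
  then show ?case by (simp add: energy_def)
next
  case (insert i I)
  have "energy (\<lambda>x. c i * u i x + (\<Sum>i\<in>I. c i * u i x)) \<le> energy (\<lambda>x. c i * u i x) + energy (\<lambda>x. \<Sum>i\<in>I. c i * u i x)"
    using insert H_lin[of "u i" "u i" "c i" 0] by (intro energy_triangle H_sum) auto
  then show ?case using insert energy_scale[of "u i" "c i"] by simp
qed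

text \<open>Approximating an orthonormal family within \<open>\<epsilon>\<close>, in the norm and in the energy, changes the norm and the
  energy of a combination by at most \<open>j \<epsilon>\<close> times the length of its coefficient vector.\<close>

lemma approximate_family:
  assumes f: "eigenfamily j e t" "\<And>i. i < j \<Longrightarrow> t i \<le> \<Lambda>" "0 \<le> \<Lambda>"
    and T: "T \<subseteq> H" "\<And>u \<epsilon>. u \<in> H \<Longrightarrow> \<epsilon> > 0 \<Longrightarrow> \<exists>f\<in>T. nrm (\<lambda>x. u x - f x) \<le> \<epsilon> \<and> energy (\<lambda>x. u x - f x) \<le> \<epsilon>"
    and "\<eta> > 0"
  obtains g where "\<And>i. i < j \<Longrightarrow> g i \<in> T" "L2_independent M j g"
    "\<And>c. Re (a (\<lambda>x. \<Sum>i<j. c i * g i x) (\<lambda>x. \<Sum>i<j. c i * g i x))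
        \<le> (\<Lambda> + \<eta>) * (nrm (\<lambda>x. \<Sum>i<j. c i * g i x))\<^sup>2"
proof -
  have on: "orthonormal M j e" using f(1) by (simp add: eigenfamily_def)
  have eH: "e i \<in> H" if "i < j" for i using f(1) that A_H unfolding eigenfamily_def by blast
  have "((\<lambda>\<kappa>. (\<Lambda> + \<eta>) * (1 - \<kappa>)\<^sup>2 - (sqrt \<Lambda> + \<kappa>)\<^sup>2) \<longlongrightarrow> (\<Lambda> + \<eta>) * (1 - 0)\<^sup>2 - (sqrt \<Lambda> + 0)\<^sup>2) (at_right 0)"
    by (intro tendsto_intros)
  then have "\<forall>\<^sub>F \<kappa> in at_right 0. 0 < (\<Lambda> + \<eta>) * (1 - \<kappa>)\<^sup>2 - (sqrt \<Lambda> + \<kappa>)\<^sup>2"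
    by (rule order_tendstoD(1)) (use \<open>0 \<le> \<Lambda>\<close> \<open>\<eta> > 0\<close> in simp)
  moreover have "\<forall>\<^sub>F \<kappa> in at_right (0::real). 0 < \<kappa> \<and> \<kappa> < 1"
    using eventually_at_right_real[of 0 "1::real"] by (auto elim: eventually_mono)
  ultimately have "\<forall>\<^sub>F \<kappa> in at_right 0. 0 < \<kappa> \<and> \<kappa> < 1 \<and> 0 < (\<Lambda> + \<eta>) * (1 - \<kappa>)\<^sup>2 - (sqrt \<Lambda> + \<kappa>)\<^sup>2"
    by eventually_elim auto
  from eventually_happens'[OF trivial_limit_at_right_real this]
  obtain \<kappa> where "0 < \<kappa>" "\<kappa> < 1" "0 < (\<Lambda> + \<eta>) * (1 - \<kappa>)\<^sup>2 - (sqrt \<Lambda> + \<kappa>)\<^sup>2" by blast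
  then have \<kappa>: "0 < \<kappa>" "\<kappa> < 1" "(sqrt \<Lambda> + \<kappa>)\<^sup>2 \<le> (\<Lambda> + \<eta>) * (1 - \<kappa>)\<^sup>2" by linarith+
  define \<epsilon> where "\<epsilon> = \<kappa> / (real j + 1)"
  have \<epsilon>: "\<epsilon> > 0" "real j * \<epsilon> \<le> \<kappa>" using \<kappa> by (auto simp: \<epsilon>_def field_simps)
  have "\<forall>i. \<exists>f. i < j \<longrightarrow> f \<in> T \<and> nrm (\<lambda>x. e i x - f x) \<le> \<epsilon> \<and> energy (\<lambda>x. e i x - f x) \<le> \<epsilon>"
    using T(2)[OF eH \<epsilon>(1)] by blast
  then obtain g where g: "\<And>i. i < j \<Longrightarrow> g i \<in> T"
    "\<And>i. i < j \<Longrightarrow> nrm (\<lambda>x. e i x - g i x) \<le> \<epsilon>" "\<And>i. i < j \<Longrightarrow> energy (\<lambda>x. e i x - g i x) \<le> \<epsilon>" by metis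
  have gH: "g i \<in> H" if "i < j" for i using g(1)[OF that] T(1) by blast
  have dH: "(\<lambda>x. e i x - g i x) \<in> H" if "i < j" for i using H_lin[OF eH[OF that] gH[OF that], of 1 "-1"] by simp
  define n where "n c = nrm (\<lambda>x. \<Sum>i<j. c i * e i x)" for c
  have n0: "0 \<le> n c" for c by (simp add: n_def)
  have n_sq: "(n c)\<^sup>2 = (\<Sum>i<j. (cmod (c i))\<^sup>2)" for c
    unfolding n_def by (rule orthonormal_combination_norm[OF on])
  have c_le: "cmod (c i) \<le> n c" if "i < j" for c i
  proof (rule power2_le_imp_le[OF _ n0])
    show "(cmod (c i))\<^sup>2 \<le> (n c)\<^sup>2" unfolding n_sq using that by (intro member_le_sum) auto
  qed
  have sum_le: "(\<Sum>i<j. cmod (c i) * r i) \<le> \<kappa> * n c" if "\<And>i. i < j \<Longrightarrow> 0 \<le> r i \<and> r i \<le> \<epsilon>" for c r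
  proof -
    have "(\<Sum>i<j. cmod (c i) * r i) \<le> (\<Sum>i<j. n c * \<epsilon>)"
      using that c_le n0 by (intro sum_mono mult_mono) auto
    also have "\<dots> = (real j * \<epsilon>) * n c" by simp
    also have "\<dots> \<le> \<kappa> * n c" by (intro mult_right_mono \<epsilon> n0)
    finally show ?thesis .
  qed
  have split: "(\<lambda>x. \<Sum>i<j. c i * e i x) = (\<lambda>x. (\<Sum>i<j. c i * g i x) + (\<Sum>i<j. c i * (e i x - g i x)))" for c
    by (auto simp flip: sum.distrib simp: algebra_simps)
  have split': "(\<lambda>x. \<Sum>i<j. c i * g i x) = (\<lambda>x. (\<Sum>i<j. c i * e i x) + (\<Sum>i<j. (- c i) * (e i x - g i x)))" for c
    by (auto simp flip: sum.distrib simp: algebra_simps)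
  have lower: "(1 - \<kappa>) * n c \<le> nrm (\<lambda>x. \<Sum>i<j. c i * g i x)" for c
  proof -
    have "n c \<le> nrm (\<lambda>x. \<Sum>i<j. c i * g i x) + nrm (\<lambda>x. \<Sum>i<j. c i * (e i x - g i x))"
      unfolding n_def split[of c] by (intro L2_norm_add_triangle L2_sum) (auto intro: H_L2 gH dH)
    also have "nrm (\<lambda>x. \<Sum>i<j. c i * (e i x - g i x)) \<le> (\<Sum>i<j. cmod (c i) * nrm (\<lambda>x. e i x - g i x))"
      by (rule L2_norm_sum_triangle) (auto intro: H_L2 dH)
    also have "\<dots> \<le> \<kappa> * n c" by (rule sum_le) (auto intro: g)
    finally show ?thesis by (simp add: algebra_simps)
  qed
  have upper: "energy (\<lambda>x. \<Sum>i<j. c i * g i x) \<le> (sqrt \<Lambda> + \<kappa>) * n c" for c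
  proof -
    have "energy (\<lambda>x. \<Sum>i<j. c i * g i x)
        \<le> energy (\<lambda>x. \<Sum>i<j. c i * e i x) + energy (\<lambda>x. \<Sum>i<j. (- c i) * (e i x - g i x))"
      unfolding split'[of c] by (intro energy_triangle H_sum) (auto intro: eH dH)
    also have "energy (\<lambda>x. \<Sum>i<j. (- c i) * (e i x - g i x)) \<le> (\<Sum>i<j. cmod (- c i) * energy (\<lambda>x. e i x - g i x))"
      by (rule energy_sum) (auto intro: dH)
    also have "\<dots> \<le> \<kappa> * n c" using sum_le[of "\<lambda>i. energy (\<lambda>x. e i x - g i x)" c] g(3) by simp
    also have "energy (\<lambda>x. \<Sum>i<j. c i * e i x) \<le> sqrt \<Lambda> * n c"
    proof (rule power2_le_imp_le)
      have "(energy (\<lambda>x. \<Sum>i<j. c i * e i x))\<^sup>2 = (\<Sum>i<j. t i * (cmod (c i))\<^sup>2)"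
        unfolding energy_sq by (rule eigenfamily_form[OF f(1)])
      also have "\<dots> \<le> (\<Sum>i<j. \<Lambda> * (cmod (c i))\<^sup>2)" using f(2) by (intro sum_mono mult_right_mono) auto
      also have "\<dots> = (sqrt \<Lambda> * n c)\<^sup>2"
        using f(3) by (simp add: power_mult_distrib n_sq sum_distrib_left)
      finally show "(energy (\<lambda>x. \<Sum>i<j. c i * e i x))\<^sup>2 \<le> (sqrt \<Lambda> * n c)\<^sup>2" .
      show "0 \<le> sqrt \<Lambda> * n c" using f(3) n0 by simp
    qed
    finally show ?thesis by (simp add: algebra_simps)
  qed
  show thesis
  proof (rule that[of g])
    show "g i \<in> T" if "i < j" for i using g(1)[OF that] .
    show "L2_independent M j g" unfolding L2_independent_def
    proof (intro allI impI)
      fix c :: "nat \<Rightarrow> complex" and i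
      assume ae: "AE x in M. (\<Sum>i<j. c i * g i x) = 0" and i: "i < j"
      have "(\<lambda>x. \<Sum>i<j. c i * g i x) \<in> L2 M" by (intro L2_sum) (auto intro: H_L2 gH)
      then have "nrm (\<lambda>x. \<Sum>i<j. c i * g i x) = 0" using ae by (simp add: L2_norm_eq_0)
      then have "(1 - \<kappa>) * n c \<le> 0" using lower[of c] by simp
      then have "n c \<le> 0" using \<kappa>(2) by (simp add: mult_le_0_iff)
      then have "cmod (c i) \<le> 0" using c_le[OF i, of c] by linarith
      then show "c i = 0" by simp
    qed
    fix c
    have "Re (a (\<lambda>x. \<Sum>i<j. c i * g i x) (\<lambda>x. \<Sum>i<j. c i * g i x)) = (energy (\<lambda>x. \<Sum>i<j. c i * g i x))\<^sup>2"
      by (simp add: energy_sq)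
    also have "\<dots> \<le> ((sqrt \<Lambda> + \<kappa>) * n c)\<^sup>2" by (intro power_mono upper) simp
    also have "\<dots> \<le> ((\<Lambda> + \<eta>) * (1 - \<kappa>)\<^sup>2) * (n c)\<^sup>2"
      unfolding power_mult_distrib by (intro mult_right_mono \<kappa>) simp
    also have "\<dots> = (\<Lambda> + \<eta>) * ((1 - \<kappa>) * n c)\<^sup>2" by (simp add: power_mult_distrib)
    also have "\<dots> \<le> (\<Lambda> + \<eta>) * (nrm (\<lambda>x. \<Sum>i<j. c i * g i x))\<^sup>2"
      using f(3) \<open>\<eta> > 0\<close> \<kappa> n0[of c] by (intro mult_left_mono power_mono lower) auto
    finally show "Re (a (\<lambda>x. \<Sum>i<j. c i * g i x) (\<lambda>x. \<Sum>i<j. c i * g i x))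
        \<le> (\<Lambda> + \<eta>) * (nrm (\<lambda>x. \<Sum>i<j. c i * g i x))\<^sup>2" .
  qed
qed

end

section \<open>Test functions and integration by parts\<close>

lemma partial_deriv_eq: "(f has_derivative f') (at x) \<Longrightarrow> partial_deriv i f x = f' (axis i 1)"
  unfolding partial_deriv_def using frechet_derivative_at by metis

lemma C_k_continuous: "C_k k f \<Longrightarrow> continuous_on UNIV f"
  by (cases k) (auto simp: continuous_on_eq_continuous_within intro: differentiable_imp_continuous_within)

lemma C_k_Suc_imp: "C_k (Suc k) f \<Longrightarrow> C_k k f"
proof (induction k arbitrary: f)
  case 0
  then show ?case using C_k_continuous[of "Suc 0" f] by simp
next
  case (Suc k)
  then show ?case by (metis C_k.simps(2))
qed

lemma C_k_const: "C_k k (\<lambda>x. c)"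
proof (induction k arbitrary: c)
  case (Suc k)
  have "partial_deriv i (\<lambda>x. c) = (\<lambda>x. 0)" for i :: 'a
    by (rule ext, subst partial_deriv_eq[OF has_derivative_const]) simp
  with Suc show ?case by simp
qed simp

lemma partial_deriv_add:
  assumes "f differentiable (at x)" "g differentiable (at x)"
  shows "partial_deriv i (\<lambda>x. f x + g x) x = partial_deriv i f x + partial_deriv i g x"
proof -
  obtain f' g' where d: "(f has_derivative f') (at x)" "(g has_derivative g') (at x)"
    using assms by (auto simp: differentiable_def)
  show ?thesis
    unfolding partial_deriv_eq[OF d(1)] partial_deriv_eq[OF d(2)] partial_deriv_eq[OF has_derivative_add[OF d]] ..
qed

lemma partial_deriv_mult:
  assumes "f differentiable (at x)" "g differentiable (at x)"
  shows "partial_deriv i (\<lambda>x. f x * g x) x = f x * partial_deriv i g x + partial_deriv i f x * g x"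
proof -
  obtain f' g' where d: "(f has_derivative f') (at x)" "(g has_derivative g') (at x)"
    using assms by (auto simp: differentiable_def)
  show ?thesis
    unfolding partial_deriv_eq[OF d(1)] partial_deriv_eq[OF d(2)] partial_deriv_eq[OF has_derivative_mult[OF d]] ..
qed

lemma C_k_add: "C_k k f \<Longrightarrow> C_k k g \<Longrightarrow> C_k k (\<lambda>x. f x + g x)"
proof (induction k arbitrary: f g)
  case 0
  then show ?case by (auto intro: continuous_intros)
next
  case (Suc k)
  have "partial_deriv i (\<lambda>x. f x + g x) = (\<lambda>x. partial_deriv i f x + partial_deriv i g x)" for i
    using Suc.prems by (intro ext partial_deriv_add) auto
  with Suc show ?case by (auto intro: differentiable_add)
qed

lemma C_k_mult: "C_k k f \<Longrightarrow> C_k k g \<Longrightarrow> C_k k (\<lambda>x. f x * g x)"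
proof (induction k arbitrary: f g)
  case 0
  then show ?case by (auto intro: continuous_intros)
next
  case (Suc k)
  have "partial_deriv i (\<lambda>x. f x * g x) = (\<lambda>x. f x * partial_deriv i g x + partial_deriv i f x * g x)" for i
    using Suc.prems by (intro ext partial_deriv_mult) auto
  moreover have "C_k k f" "C_k k g" using Suc.prems C_k_Suc_imp by blast+
  ultimately show ?case using Suc by (auto intro: differentiable_mult C_k_add)
qed

lemma C_k_sum: "(\<And>i. i \<in> I \<Longrightarrow> C_k k (f i)) \<Longrightarrow> C_k k (\<lambda>x. \<Sum>i\<in>I. f i x)"
  by (induction I rule: infinite_finite_induct) (auto intro: C_k_add C_k_const)

lemma C_k_prod: "(\<And>i. i \<in> I \<Longrightarrow> C_k k (f i)) \<Longrightarrow> C_k k (\<lambda>x. \<Prod>i\<in>I. f i x)"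
  by (induction I rule: infinite_finite_induct) (auto intro: C_k_mult C_k_const)

lemma C_k_scale: "C_k k f \<Longrightarrow> C_k k (\<lambda>x. c * f x)"
  by (intro C_k_mult C_k_const)

lemma differentiable_of_components:
  fixes \<Phi> :: "real^'n \<Rightarrow> real^'m"
  assumes "\<And>l. (\<lambda>x. complex_of_real (\<Phi> x $ l)) differentiable (at x)"
  shows "\<Phi> differentiable (at x)"
proof -
  have "(\<lambda>x. \<Phi> x $ l) differentiable (at x)" for l
  proof -
    obtain D where "((\<lambda>x. complex_of_real (\<Phi> x $ l)) has_derivative D) (at x)"
      using assms[of l] by (auto simp: differentiable_def)
    from has_derivative_Re[OF this] show ?thesis by (auto simp: differentiable_def)
  qed
  then show ?thesis
    by (subst differentiable_componentwise_within) (auto simp: Basis_vec_def inner_axis)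
qed

lemma partial_deriv_comp:
  fixes \<Phi> :: "real^'n \<Rightarrow> real^'m"
  assumes f: "f differentiable (at (\<Phi> x))" and \<Phi>: "\<Phi> differentiable (at x)"
  shows "partial_deriv i (\<lambda>x. f (\<Phi> x)) x
    = (\<Sum>l\<in>UNIV. partial_deriv l f (\<Phi> x) * partial_deriv i (\<lambda>x. complex_of_real (\<Phi> x $ l)) x)"
proof -
  obtain f' where f': "(f has_derivative f') (at (\<Phi> x))" using f by (auto simp: differentiable_def)
  obtain P where P: "(\<Phi> has_derivative P) (at x)" using \<Phi> by (auto simp: differentiable_def)
  have lin: "linear f'" using f' by (rule has_derivative_linear)
  have comp: "partial_deriv i (\<lambda>x. complex_of_real (\<Phi> x $ l)) x = of_real (P (axis i 1) $ l)" for l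
    by (rule partial_deriv_eq) (intro has_derivative_of_real bounded_linear.has_derivative[OF bounded_linear_vec_nth P])
  have v: "P (axis i 1) = (\<Sum>l\<in>UNIV. (P (axis i 1) $ l) *\<^sub>R axis l 1)"
    by (simp add: vec_eq_iff axis_def if_distrib cong: if_cong)
  have "partial_deriv i (\<lambda>x. f (\<Phi> x)) x = f' (P (axis i 1))"
    by (rule partial_deriv_eq) (use has_derivative_compose[OF P f'] in simp)
  also have "\<dots> = (\<Sum>l\<in>UNIV. (P (axis i 1) $ l) *\<^sub>R f' (axis l 1))"
    by (subst v) (simp add: linear_sum[OF lin] linear_scale[OF lin])
  also have "\<dots> = (\<Sum>l\<in>UNIV. partial_deriv l f (\<Phi> x) * partial_deriv i (\<lambda>x. complex_of_real (\<Phi> x $ l)) x)"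
    unfolding comp partial_deriv_eq[OF f'] by (simp add: scaleR_conv_of_real mult.commute)
  finally show ?thesis .
qed

lemma C_k_comp:
  fixes \<Phi> :: "real^'n \<Rightarrow> real^'m"
  assumes "C_k k f" "\<And>l. C_k k (\<lambda>x. complex_of_real (\<Phi> x $ l))"
  shows "C_k k (\<lambda>x. f (\<Phi> x))"
  using assms
proof (induction k arbitrary: f)
  case 0
  have "continuous_on UNIV (\<lambda>x. Re (complex_of_real (\<Phi> x $ l)))" for l
    by (rule continuous_on_Re) (use 0 in simp)
  then have "continuous_on UNIV \<Phi>"
    by (subst continuous_on_componentwise) (auto simp: Basis_vec_def inner_axis)
  with 0 show ?case using continuous_on_compose2[of UNIV f UNIV \<Phi>] by simp
next
  case (Suc k)
  have \<Phi>: "\<Phi> differentiable (at x)" for x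
    using Suc.prems by (intro differentiable_of_components) auto
  have fd: "f differentiable (at x)" and fC: "C_k k (partial_deriv l f)" for x l
    using Suc.prems(1) by simp_all
  have "C_k k (\<lambda>x. complex_of_real (\<Phi> x $ l))" for l by (rule C_k_Suc_imp[OF Suc.prems(2)])
  then have C: "C_k k (\<lambda>x. partial_deriv l f (\<Phi> x))" for l by (rule Suc.IH[OF fC])
  have pd: "partial_deriv i (\<lambda>x. f (\<Phi> x))
    = (\<lambda>x. \<Sum>l\<in>UNIV. partial_deriv l f (\<Phi> x) * partial_deriv i (\<lambda>x. complex_of_real (\<Phi> x $ l)) x)" for i
    by (intro ext partial_deriv_comp fd \<Phi>)
  show ?case unfolding C_k.simps(2)
  proof (intro conjI allI)
    show "(\<lambda>x. f (\<Phi> x)) differentiable (at x)" for x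
      using differentiable_chain_at[OF \<Phi> fd, of x] by (simp add: o_def)
    show "C_k k (partial_deriv i (\<lambda>x. f (\<Phi> x)))" for i
      unfolding pd by (intro C_k_sum C_k_mult C) (use Suc.prems(2) in simp)
  qed
qed

lemma test_functions_C_k: "f \<in> test_functions \<Omega> \<Longrightarrow> C_k k f"
  by (simp add: test_functions_def)

lemma test_functions_differentiable: "f \<in> test_functions \<Omega> \<Longrightarrow> f differentiable (at x)"
  using test_functions_C_k[of f \<Omega> 1] by simp

lemma test_functions_mono: "\<Omega> \<subseteq> \<Omega>' \<Longrightarrow> test_functions \<Omega> \<subseteq> test_functions \<Omega>'"
  by (auto simp: test_functions_def)

lemma test_functionsI:
  assumes "\<And>k. C_k k f" "compact K" "K \<subseteq> \<Omega>" "\<And>x. x \<notin> K \<Longrightarrow> f x = 0"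
  shows "f \<in> test_functions \<Omega>"
proof -
  have "closure {x. f x \<noteq> 0} \<subseteq> K"
    by (intro closure_minimal compact_imp_closed assms(2)) (use assms(4) in auto)
  moreover from this have "compact (closure {x. f x \<noteq> 0})"
    using compact_Int_closed[OF assms(2), of "closure {x. f x \<noteq> 0}"] by (simp add: Int_absorb1)
  ultimately show ?thesis using assms by (auto simp: test_functions_def)
qed

lemma test_functions_support:
  assumes "f \<in> test_functions \<Omega>"
  shows "\<exists>K. compact K \<and> K \<subseteq> \<Omega> \<and> (\<forall>x. x \<notin> K \<longrightarrow> f x = 0)"
proof (intro exI conjI allI impI)
  show "compact (closure {x. f x \<noteq> 0})" "closure {x. f x \<noteq> 0} \<subseteq> \<Omega>"
    using assms by (auto simp: test_functions_def)
  show "f x = 0" if "x \<notin> closure {x. f x \<noteq> 0}" for x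
    using that closure_subset[of "{x. f x \<noteq> 0}"] by blast
qed

lemma test_functions_lin:
  assumes "f \<in> test_functions \<Omega>" "g \<in> test_functions \<Omega>"
  shows "(\<lambda>x. c * f x + d * g x) \<in> test_functions \<Omega>"
proof -
  obtain K where K: "compact K" "K \<subseteq> \<Omega>" "\<And>x. x \<notin> K \<Longrightarrow> f x = 0" using test_functions_support[OF assms(1)] by metis
  obtain K' where K': "compact K'" "K' \<subseteq> \<Omega>" "\<And>x. x \<notin> K' \<Longrightarrow> g x = 0" using test_functions_support[OF assms(2)] by metis
  show ?thesis
  proof (rule test_functionsI)
    show "C_k k (\<lambda>x. c * f x + d * g x)" for k
      by (intro C_k_add C_k_scale test_functions_C_k[OF assms(1)] test_functions_C_k[OF assms(2)])
    show "compact (K \<union> K')" "K \<union> K' \<subseteq> \<Omega>" using K K' by blast+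
    show "c * f x + d * g x = 0" if "x \<notin> K \<union> K'" for x using that K(3)[of x] K'(3)[of x] by simp
  qed
qed

lemma test_functions_zero: "(\<lambda>x. 0) \<in> test_functions \<Omega>"
proof (rule test_functionsI)
  show "C_k k (\<lambda>x. 0)" for k by (rule C_k_const)
  show "compact {}" by (rule compact_empty)
qed simp_all

lemma test_functions_mult:
  assumes "f \<in> test_functions \<Omega>" "g \<in> test_functions \<Omega>"
  shows "(\<lambda>x. f x * g x) \<in> test_functions \<Omega>"
proof -
  obtain K where K: "compact K" "K \<subseteq> \<Omega>" "\<And>x. x \<notin> K \<Longrightarrow> f x = 0" using test_functions_support[OF assms(1)] by metis
  show ?thesis
  proof (rule test_functionsI[OF _ K(1,2)])
    show "C_k k (\<lambda>x. f x * g x)" for k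
      by (intro C_k_mult test_functions_C_k[OF assms(1)] test_functions_C_k[OF assms(2)])
    show "f x * g x = 0" if "x \<notin> K" for x using K(3)[OF that] by simp
  qed
qed

lemma test_functions_partial:
  assumes "f \<in> test_functions \<Omega>"
  shows "partial_deriv i f \<in> test_functions \<Omega>"
proof -
  obtain K where K: "compact K" "K \<subseteq> \<Omega>" "\<And>x. x \<notin> K \<Longrightarrow> f x = 0" using test_functions_support[OF assms] by metis
  show ?thesis
  proof (rule test_functionsI[OF _ K(1,2)])
    show "C_k k (partial_deriv i f)" for k using test_functions_C_k[OF assms, of "Suc k"] by simp
    show "partial_deriv i f x = 0" if "x \<notin> K" for x
    proof -
      have "((\<lambda>x. 0) has_derivative (\<lambda>x. 0)) (at x)" by simp
      then have "(f has_derivative (\<lambda>x. 0)) (at x)"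
      proof (rule has_derivative_transform_within_open)
        show "open (- K)" using K(1) by (simp add: compact_imp_closed open_Compl)
        show "x \<in> - K" using that by simp
        show "0 = f y" if "y \<in> - K" for y using K(3)[of y] that by simp
      qed
      then show ?thesis by (simp add: partial_deriv_eq)
    qed
  qed
qed

lemma test_functions_continuous: "f \<in> test_functions \<Omega> \<Longrightarrow> continuous_on S f"
  using test_functions_C_k[of f \<Omega> 0] by (auto intro: continuous_on_subset[OF _ subset_UNIV])

lemma continuous_compact_support_integrable:
  fixes f :: "'a::euclidean_space \<Rightarrow> 'b::{banach,second_countable_topology}"
  assumes "continuous_on UNIV f" "compact K" "\<And>x. x \<notin> K \<Longrightarrow> f x = 0"
  shows "integrable lborel f" "integrable lebesgue f"
proof -
  have "integrable lborel (\<lambda>x. indicator K x *\<^sub>R f x)"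
    by (intro borel_integrable_compact assms continuous_on_subset[OF assms(1)]) auto
  moreover have "(\<lambda>x. indicator K x *\<^sub>R f x) = f" using assms(3) by (auto simp: indicator_def)
  ultimately show *: "integrable lborel f" by simp
  then show "integrable lebesgue f" by (subst integrable_completion) auto
qed

lemma lebesgue_on_supported:
  fixes f :: "'a::euclidean_space \<Rightarrow> 'b::{banach,second_countable_topology}"
  assumes "\<Omega> \<in> sets lebesgue" "\<And>x. x \<notin> \<Omega> \<Longrightarrow> f x = 0"
  shows "integrable (lebesgue_on \<Omega>) f \<longleftrightarrow> integrable lebesgue f"
    and "integral\<^sup>L (lebesgue_on \<Omega>) f = integral\<^sup>L lebesgue f"
proof -
  have "(\<lambda>x. indicator \<Omega> x *\<^sub>R f x) = f" using assms(2) by (auto simp: indicator_def)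
  then show "integrable (lebesgue_on \<Omega>) f \<longleftrightarrow> integrable lebesgue f"
    and "integral\<^sup>L (lebesgue_on \<Omega>) f = integral\<^sup>L lebesgue f"
    using assms(1) by (simp_all add: integrable_restrict_space integral_restrict_space)
qed

lemma test_functions_L2:
  assumes "\<Omega> \<in> sets lebesgue" "f \<in> test_functions \<Omega>"
  shows "f \<in> L2 (lebesgue_on \<Omega>)"
proof -
  obtain K where K: "compact K" "K \<subseteq> \<Omega>" "\<And>x. x \<notin> K \<Longrightarrow> f x = 0" using test_functions_support[OF assms(2)] by metis
  have c: "continuous_on UNIV f" using test_functions_continuous[OF assms(2)] .
  have "integrable lebesgue (\<lambda>x. (cmod (f x))\<^sup>2)"
  proof (rule continuous_compact_support_integrable(2)[OF _ K(1)])
    show "continuous_on UNIV (\<lambda>x. (cmod (f x))\<^sup>2)" by (intro continuous_intros c)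
    show "(cmod (f x))\<^sup>2 = 0" if "x \<notin> K" for x using K(3)[OF that] by simp
  qed
  moreover have "f x = 0" if "x \<notin> \<Omega>" for x using K(2,3) that by blast
  ultimately have "integrable (lebesgue_on \<Omega>) (\<lambda>x. (cmod (f x))\<^sup>2)"
    using assms(1) by (subst lebesgue_on_supported) auto
  moreover have "f \<in> borel_measurable (lebesgue_on \<Omega>)"
    using c by (intro measurable_restrict_space1 measurable_completion) (simp add: borel_measurable_continuous_onI)
  ultimately show ?thesis by (simp add: L2_def)
qed

text \<open>Integrating a difference quotient gives \<open>0\<close> by translation invariance, and the difference quotients
  are dominated because the support is compact.\<close>

lemma integral_partial_deriv_eq_0:
  assumes "f \<in> test_functions \<Omega>"
  shows "(LINT x|lebesgue. partial_deriv i f x) = 0"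
proof -
  obtain K where K: "compact K" "K \<subseteq> \<Omega>" "\<And>x. x \<notin> K \<Longrightarrow> f x = 0" using test_functions_support[OF assms] by metis
  have c: "continuous_on UNIV f" using test_functions_continuous[OF assms] .
  have p: "partial_deriv i f \<in> test_functions \<Omega>" by (rule test_functions_partial[OF assms])
  then have pc: "continuous_on UNIV (partial_deriv i f)" by (rule test_functions_continuous)
  obtain K2 where K2: "compact K2" "\<And>x. x \<notin> K2 \<Longrightarrow> partial_deriv i f x = 0" using test_functions_support[OF p] by metis
  have "compact (partial_deriv i f ` K2)" by (intro compact_continuous_image K2 continuous_on_subset[OF pc]) simp
  then obtain B0 where "\<And>x. x \<in> K2 \<Longrightarrow> norm (partial_deriv i f x) \<le> B0"
    using compact_imp_bounded bounded_iff by (metis imageI)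
  then have B: "norm (partial_deriv i f x) \<le> max 0 B0" for x
    using K2(2)[of x] by (cases "x \<in> K2") fastforce+
  define e where "e = axis i (1::real)"
  have ne: "norm e = 1" by (simp add: e_def norm_axis_1)
  define h where "h = (\<lambda>m. 1 / real (Suc m))"
  have h: "0 < h m" "h m \<le> 1" for m by (auto simp: h_def)
  define q where "q m x = (f (h m *\<^sub>R e + x) - f x) /\<^sub>R h m" for m x
  have line: "((\<lambda>t. f (t *\<^sub>R e + x)) has_vector_derivative partial_deriv i f (t *\<^sub>R e + x)) (at t within S)" for t x S
  proof -
    obtain D where D: "(f has_derivative D) (at (t *\<^sub>R e + x))"
      using test_functions_differentiable[OF assms] by (auto simp: differentiable_def)
    have 1: "((\<lambda>t. t *\<^sub>R e + x) has_derivative (\<lambda>s. s *\<^sub>R e)) (at t within S)"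
      by (auto intro!: derivative_eq_intros)
    have "((\<lambda>t. f (t *\<^sub>R e + x)) has_derivative (\<lambda>s. D (s *\<^sub>R e))) (at t within S)"
      by (rule has_derivative_compose[OF 1 D])
    moreover have "(\<lambda>s. D (s *\<^sub>R e)) = (\<lambda>s. s *\<^sub>R partial_deriv i f (t *\<^sub>R e + x))"
      using partial_deriv_eq[OF D] has_derivative_linear[OF D] by (auto simp: e_def linear_scale)
    ultimately show ?thesis by (simp add: has_vector_derivative_def)
  qed
  have lim: "(\<lambda>m. q m x) \<longlonglongrightarrow> partial_deriv i f x" for x
  proof -
    let ?p = "partial_deriv i f x"
    have "((\<lambda>y. norm (f ((0 + y) *\<^sub>R e + x) - f (0 *\<^sub>R e + x) - y *\<^sub>R partial_deriv i f (0 *\<^sub>R e + x)) / norm y) \<longlongrightarrow> 0) (at 0)"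
      using line[of x 0 UNIV] unfolding has_vector_derivative_def has_derivative_at by blast
    then have "((\<lambda>y. norm ((f (y *\<^sub>R e + x) - f x) /\<^sub>R y - ?p)) \<longlongrightarrow> 0) (at 0)"
    proof (rule Lim_transform_eventually)
      have eq: "norm (f ((0 + y) *\<^sub>R e + x) - f (0 *\<^sub>R e + x) - y *\<^sub>R partial_deriv i f (0 *\<^sub>R e + x)) / norm y
          = norm ((f (y *\<^sub>R e + x) - f x) /\<^sub>R y - ?p)" if "y \<noteq> 0" for y :: real
      proof -
        have "(f (y *\<^sub>R e + x) - f x) /\<^sub>R y - ?p = (f (y *\<^sub>R e + x) - f x - y *\<^sub>R ?p) /\<^sub>R y"
          using that by (simp add: scaleR_diff_right)
        also have "norm \<dots> = norm (f (y *\<^sub>R e + x) - f x - y *\<^sub>R ?p) / norm y"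
          by (simp add: divide_inverse mult.commute)
        finally show ?thesis by simp
      qed
      show "\<forall>\<^sub>F y in at (0::real). norm (f ((0 + y) *\<^sub>R e + x) - f (0 *\<^sub>R e + x) - y *\<^sub>R partial_deriv i f (0 *\<^sub>R e + x)) / norm y
          = norm ((f (y *\<^sub>R e + x) - f x) /\<^sub>R y - ?p)"
        by (rule eventually_mono[OF eventually_neq_at_within]) (rule eq)
    qed
    then have "((\<lambda>y. (f (y *\<^sub>R e + x) - f x) /\<^sub>R y - ?p) \<longlongrightarrow> 0) (at 0)"
      by (rule tendsto_norm_zero_cancel)
    then have "((\<lambda>y. (f (y *\<^sub>R e + x) - f x) /\<^sub>R y) \<longlongrightarrow> partial_deriv i f x) (at 0)"
      by (rule LIM_zero_cancel)
    moreover have "filterlim h (at 0) sequentially"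
    proof -
      have "h \<longlonglongrightarrow> 0" using LIMSEQ_inverse_real_of_nat by (simp add: h_def inverse_eq_divide)
      moreover have "h m \<noteq> 0" for m using h(1)[of m] by simp
      ultimately show ?thesis by (simp add: filterlim_at)
    qed
    ultimately show ?thesis unfolding q_def by (rule filterlim_compose)
  qed
  have q_le: "norm (q m x) \<le> max 0 B0" for m x
  proof -
    have "norm (f (h m *\<^sub>R e + x) - f (0 *\<^sub>R e + x)) \<le> max 0 B0 * norm (h m - 0)"
    proof (rule differentiable_bound[of "{0..1}" "\<lambda>t. f (t *\<^sub>R e + x)" "\<lambda>t s. s *\<^sub>R partial_deriv i f (t *\<^sub>R e + x)"])
      show "((\<lambda>t. f (t *\<^sub>R e + x)) has_derivative (\<lambda>s. s *\<^sub>R partial_deriv i f (t *\<^sub>R e + x))) (at t within {0..1})" for t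
        using line[of x t "{0..1}"] by (simp only: has_vector_derivative_def)
      show "onorm (\<lambda>s. s *\<^sub>R partial_deriv i f (t *\<^sub>R e + x)) \<le> max 0 B0" for t
        by (rule onorm_le) (use mult_right_mono[OF B, of "\<bar>_\<bar>"] in \<open>simp add: mult.commute\<close>)
      show "h m \<in> {0..1}" "0 \<in> {0..1::real}" using h[of m] by auto
    qed simp
    then have "norm (f (h m *\<^sub>R e + x) - f x) / h m \<le> max 0 B0"
      using h(1)[of m] by (simp add: pos_divide_le_eq)
    moreover have "norm (q m x) = norm (f (h m *\<^sub>R e + x) - f x) / h m"
      using h(1)[of m] by (simp only: q_def norm_scaleR) (simp add: divide_inverse mult.commute)
    ultimately show ?thesis by simp
  qed
  define K' where "K' = (\<lambda>(x, y). x + y) ` (K \<times> cball 0 1)"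
  have "compact K'" unfolding K'_def
    by (intro compact_continuous_image compact_Times K compact_cball) (auto simp: split_def intro!: continuous_intros)
  have q0: "q m x = 0" if "x \<notin> K'" for m x
  proof -
    have "x \<notin> K"
    proof
      assume "x \<in> K"
      then have "x \<in> K'" unfolding K'_def by (intro image_eqI[of _ _ "(x, 0)"]) auto
      then show False using that by simp
    qed
    moreover have "h m *\<^sub>R e + x \<notin> K"
    proof
      assume "h m *\<^sub>R e + x \<in> K"
      then have "x \<in> K'" unfolding K'_def using h[of m] ne
        by (intro image_eqI[of _ _ "(h m *\<^sub>R e + x, - (h m *\<^sub>R e))"]) auto
      then show False using that by simp
    qed
    ultimately show ?thesis using K(3) by (simp add: q_def)
  qed
  have fi: "integrable lborel f" by (rule continuous_compact_support_integrable[OF c K(1) K(3)])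
  have fm: "f \<in> borel_measurable borel" using c by (rule borel_measurable_continuous_onI)
  have tr: "integrable lborel (\<lambda>x. f (y + x))" "(LINT x|lborel. f (y + x)) = (LINT x|lborel. f x)" for y
  proof -
    have "integrable (distr lborel borel ((+) y)) f" using fi by (simp add: lborel_distr_plus)
    then show "integrable lborel (\<lambda>x. f (y + x))" by (subst (asm) integrable_distr_eq) (use fm in auto)
    have "(LINT x|distr lborel borel ((+) y). f x) = (LINT x|lborel. f (y + x))"
      by (rule integral_distr) (use fm in auto)
    then show "(LINT x|lborel. f (y + x)) = (LINT x|lborel. f x)" by (simp add: lborel_distr_plus)
  qed
  have int_q: "(LINT x|lborel. q m x) = 0" for m
    unfolding q_def using tr[of "h m *\<^sub>R e"] fi by simp
  have "(\<lambda>m. LINT x|lborel. q m x) \<longlonglongrightarrow> (LINT x|lborel. partial_deriv i f x)"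
  proof (rule integral_dominated_convergence)
    show "integrable lborel (\<lambda>x. indicator K' x *\<^sub>R max 0 B0)"
      by (rule borel_integrable_compact) (use \<open>compact K'\<close> in auto)
    show "AE x in lborel. norm (q m x) \<le> indicator K' x *\<^sub>R max 0 B0" for m
      using q_le q0 by (intro AE_I2) (auto simp: indicator_def)
    show "AE x in lborel. (\<lambda>m. q m x) \<longlonglongrightarrow> partial_deriv i f x" using lim by simp
    show "partial_deriv i f \<in> borel_measurable lborel"
      using pc by (simp add: borel_measurable_continuous_onI)
    show "q m \<in> borel_measurable lborel" for m
      unfolding q_def using fm by measurable
  qed
  then have "(LINT x|lborel. partial_deriv i f x) = 0"
    unfolding int_q using LIMSEQ_unique tendsto_const by blast
  then show ?thesis
    by (subst integral_completion) (use pc in \<open>simp_all add: borel_measurable_continuous_onI\<close>)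
qed

lemma test_function_weak_partial:
  assumes \<Omega>: "\<Omega> \<in> sets lebesgue" and f: "f \<in> test_functions \<Omega>"
  shows "is_weak_partial \<Omega> i f (partial_deriv i f)"
  unfolding is_weak_partial_def
proof (intro conjI ballI)
  show "partial_deriv i f \<in> L2 (lebesgue_on \<Omega>)"
    by (intro test_functions_L2 test_functions_partial assms)
  fix g assume g: "g \<in> test_functions \<Omega>"
  have 1: "(\<lambda>x. f x * partial_deriv i g x) \<in> test_functions \<Omega>"
    and 2: "(\<lambda>x. partial_deriv i f x * g x) \<in> test_functions \<Omega>"
    by (intro test_functions_mult test_functions_partial f g)+
  have L: "(LINT x|lebesgue_on \<Omega>. h x) = (LINT x|lebesgue. h x)" and I: "integrable lebesgue h"
    if h: "h \<in> test_functions \<Omega>" for h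
  proof -
    obtain K where K: "compact K" "K \<subseteq> \<Omega>" "\<And>x. x \<notin> K \<Longrightarrow> h x = 0" using test_functions_support[OF h] by metis
    show "integrable lebesgue h"
      by (rule continuous_compact_support_integrable(2)[OF test_functions_continuous[OF h] K(1,3)])
    show "(LINT x|lebesgue_on \<Omega>. h x) = (LINT x|lebesgue. h x)"
      by (rule lebesgue_on_supported(2)[OF \<Omega>]) (use K(2,3) in blast)
  qed
  have "0 = (LINT x|lebesgue. partial_deriv i (\<lambda>x. f x * g x) x)"
    by (rule integral_partial_deriv_eq_0[OF test_functions_mult[OF f g], symmetric])
  also have "\<dots> = (LINT x|lebesgue. f x * partial_deriv i g x + partial_deriv i f x * g x)"
    by (intro arg_cong[where f="integral\<^sup>L lebesgue"] ext partial_deriv_mult)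
      (use f g test_functions_differentiable in auto)
  also have "\<dots> = (LINT x|lebesgue. f x * partial_deriv i g x) + (LINT x|lebesgue. partial_deriv i f x * g x)"
    by (rule Bochner_Integration.integral_add[OF I[OF 1] I[OF 2]])
  finally show "(LINT x|lebesgue_on \<Omega>. f x * partial_deriv i g x) = - (LINT x|lebesgue_on \<Omega>. partial_deriv i f x * g x)"
    unfolding L[OF 1] L[OF 2] by (simp add: eq_neg_iff_add_eq_0)
qed

section \<open>Bump functions and the fundamental lemma\<close>

text \<open>The functions \<open>p(1/t) exp(-1/t)\<close>, extended by \<open>0\<close>, are closed under differentiation, which gives smoothness by
  induction over all polynomials \<open>p\<close> at once.\<close>

definition flat_exp :: "real poly \<Rightarrow> real \<Rightarrow> real" where
  "flat_exp p t = (if t \<le> 0 then 0 else poly p (1 / t) * exp (- (1 / t)))"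

lemma poly_times_exp_tendsto_0: "((\<lambda>y. poly q y * exp (- y)) \<longlongrightarrow> (0::real)) at_top"
proof -
  have "((\<lambda>y. \<Sum>i\<le>degree q. coeff q i * (y ^ i / exp y)) \<longlongrightarrow> (\<Sum>i\<le>degree q. coeff q i * 0)) at_top"
    by (intro tendsto_intros tendsto_power_div_exp_0)
  moreover have "(\<lambda>y. poly q y * exp (- y)) = (\<lambda>y. \<Sum>i\<le>degree q. coeff q i * (y ^ i / exp y))"
    by (simp add: poly_altdef exp_minus sum_distrib_right divide_inverse mult.assoc)
  ultimately show ?thesis by simp
qed

lemma flat_exp_derivative:
  "(flat_exp p has_real_derivative flat_exp ([:0, 0, 1:] * (p - pderiv p)) t) (at t)"
proof -
  consider "t < 0" | "t = 0" | "t > 0" by linarith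
  then show ?thesis
  proof cases
    case 1
    have "((\<lambda>t. 0) has_real_derivative 0) (at t)" by simp
    then have "(flat_exp p has_real_derivative 0) (at t)"
      by (rule has_field_derivative_transform_within_open[of _ _ _ "{..<0}"]) (use 1 in \<open>auto simp: flat_exp_def\<close>)
    then show ?thesis using 1 by (simp add: flat_exp_def)
  next
    case 3
    have "((\<lambda>t. poly p (1 / t)) has_real_derivative poly (pderiv p) (1 / t) * (- (1 / t\<^sup>2))) (at t)"
      by (rule DERIV_chain2[OF poly_DERIV]) (use 3 in \<open>auto intro!: derivative_eq_intros simp: power2_eq_square\<close>)
    moreover have "((\<lambda>t. exp (- (1 / t))) has_real_derivative exp (- (1 / t)) * (1 / t\<^sup>2)) (at t)"
      using 3 by (auto intro!: derivative_eq_intros simp: power2_eq_square)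
    ultimately have "((\<lambda>t. poly p (1 / t) * exp (- (1 / t))) has_real_derivative
        poly (pderiv p) (1 / t) * (- (1 / t\<^sup>2)) * exp (- (1 / t)) + exp (- (1 / t)) * (1 / t\<^sup>2) * poly p (1 / t)) (at t)"
      by (rule DERIV_mult)
    then have "(flat_exp p has_real_derivative
        poly (pderiv p) (1 / t) * (- (1 / t\<^sup>2)) * exp (- (1 / t)) + exp (- (1 / t)) * (1 / t\<^sup>2) * poly p (1 / t)) (at t)"
      by (rule has_field_derivative_transform_within_open[of _ _ _ "{0<..}"]) (use 3 in \<open>auto simp: flat_exp_def\<close>)
    moreover have "poly (pderiv p) (1 / t) * (- (1 / t\<^sup>2)) * exp (- (1 / t)) + exp (- (1 / t)) * (1 / t\<^sup>2) * poly p (1 / t)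
        = flat_exp ([:0, 0, 1:] * (p - pderiv p)) t"
      using 3 by (simp add: flat_exp_def power2_eq_square algebra_simps)
    ultimately show ?thesis by simp
  next
    case 2
    have "((\<lambda>h. flat_exp p h / h) \<longlongrightarrow> 0) (at 0)"
    proof (rule filterlim_split_at)
      have "\<forall>\<^sub>F h in at_left 0. 0 = flat_exp p h / h"
        by (simp add: eventually_at_filter flat_exp_def)
      then show "((\<lambda>h. flat_exp p h / h) \<longlongrightarrow> 0) (at_left 0)"
        by (rule Lim_transform_eventually[OF tendsto_const])
      have "((\<lambda>h. poly (p * [:0, 1:]) (inverse h) * exp (- inverse h)) \<longlongrightarrow> 0) (at_right 0)"
        by (rule filterlim_compose[OF poly_times_exp_tendsto_0 filterlim_inverse_at_top_right])
      then show "((\<lambda>h. flat_exp p h / h) \<longlongrightarrow> 0) (at_right 0)"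
        by (rule Lim_transform_eventually)
          (auto simp: eventually_at_filter flat_exp_def divide_inverse intro!: always_eventually)
    qed
    then show ?thesis using 2 by (simp add: has_field_derivative_iff flat_exp_def)
  qed
qed

lemma C_k_flat_exp:
  "C_k k (\<lambda>x::real^'n. complex_of_real (flat_exp p (c * x $ i + d)))"
proof (induction k arbitrary: p)
  case 0
  have "continuous_on UNIV (flat_exp p)"
    by (intro continuous_at_imp_continuous_on ballI DERIV_isCont[OF flat_exp_derivative])
  then have "continuous_on UNIV (\<lambda>x::real^'n. flat_exp p (c * x $ i + d))"
    by (rule continuous_on_compose2) (auto intro!: continuous_intros)
  then show ?case by (simp add: continuous_on_of_real)
next
  case (Suc k)
  let ?q = "[:0, 0, 1:] * (p - pderiv p)"
  have d: "((\<lambda>x::real^'n. complex_of_real (flat_exp p (c * x $ i + d))) has_derivative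
      (\<lambda>h. complex_of_real (flat_exp ?q (c * x $ i + d) * (c * h $ i)))) (at x)" for x
  proof (rule has_derivative_of_real)
    have "((\<lambda>x::real^'n. c * x $ i + d) has_derivative (\<lambda>h. c * h $ i)) (at x)"
      by (auto intro!: derivative_eq_intros bounded_linear.has_derivative[OF bounded_linear_vec_nth])
    from has_derivative_compose[OF this has_field_derivative_imp_has_derivative[OF flat_exp_derivative]]
    show "((\<lambda>x::real^'n. flat_exp p (c * x $ i + d)) has_derivative
      (\<lambda>h. flat_exp ?q (c * x $ i + d) * (c * h $ i))) (at x)" .
  qed
  have "partial_deriv l (\<lambda>x::real^'n. complex_of_real (flat_exp p (c * x $ i + d)))
      = (\<lambda>x. complex_of_real (c * axis l 1 $ i) * complex_of_real (flat_exp ?q (c * x $ i + d)))" for l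
    by (rule ext) (simp add: partial_deriv_eq[OF d])
  then have "C_k k (partial_deriv l (\<lambda>x::real^'n. complex_of_real (flat_exp p (c * x $ i + d))))" for l
    using C_k_scale[OF Suc.IH[of ?q]] by (simp only:)
  moreover have "(\<lambda>x::real^'n. complex_of_real (flat_exp p (c * x $ i + d))) differentiable (at x)" for x
    using d by (auto simp: differentiable_def)
  ultimately show ?case by simp
qed

lemma flat_exp_1:
  "0 \<le> flat_exp 1 t" "flat_exp 1 t \<le> 1" "t \<le> 0 \<Longrightarrow> flat_exp 1 t = 0"
  by (auto simp: flat_exp_def)

lemma flat_exp_1_tendsto:
  assumes "t > 0"
  shows "(\<lambda>n. flat_exp 1 (real (Suc n) * t)) \<longlonglongrightarrow> 1"
proof -
  have "(\<lambda>n. exp (- (inverse (real (Suc n)) * (1 / t)))) \<longlonglongrightarrow> exp (- (0 * (1 / t)))"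
    by (intro tendsto_intros LIMSEQ_inverse_real_of_nat)
  moreover have "(\<lambda>n. flat_exp 1 (real (Suc n) * t)) = (\<lambda>n. exp (- (inverse (real (Suc n)) * (1 / t))))"
    using assms by (auto simp: flat_exp_def not_le inverse_eq_divide simp del: of_nat_Suc)
  ultimately show ?thesis by simp
qed

definition box_bump :: "real^'n \<Rightarrow> real^'n \<Rightarrow> nat \<Rightarrow> real^'n \<Rightarrow> real" where
  "box_bump a b n x = (\<Prod>i\<in>UNIV. flat_exp 1 (real (Suc n) * (x $ i - a $ i)) * flat_exp 1 (real (Suc n) * (b $ i - x $ i)))"

lemma box_bump_le: "0 \<le> box_bump a b n x" "box_bump a b n x \<le> 1"
  unfolding box_bump_def
  by (intro prod_nonneg ballI mult_nonneg_nonneg flat_exp_1)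
    (intro prod_le_1 conjI mult_nonneg_nonneg mult_le_one flat_exp_1)

lemma box_bump_outside:
  assumes "x \<notin> box a b"
  shows "box_bump a b n x = 0"
proof -
  from assms obtain i where "\<not> (a $ i < x $ i \<and> x $ i < b $ i)" unfolding mem_box_cart by blast
  then have "x $ i - a $ i \<le> 0 \<or> b $ i - x $ i \<le> 0" by linarith
  then have "flat_exp 1 (real (Suc n) * (x $ i - a $ i)) = 0 \<or> flat_exp 1 (real (Suc n) * (b $ i - x $ i)) = 0"
    using flat_exp_1(3) by (metis mult_nonneg_nonpos of_nat_0_le_iff)
  then show ?thesis unfolding box_bump_def by (auto intro!: prod_zero)
qed

lemma box_bump_tendsto:
  fixes x :: "real^'a::finite"
  shows "(\<lambda>n. box_bump a b n x) \<longlonglongrightarrow> indicator (box a b) x"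
proof (cases "x \<in> box a b")
  case True
  then have pos: "0 < x $ i - a $ i" "0 < b $ i - x $ i" for i by (simp_all add: mem_box_cart)
  have "(\<lambda>n. box_bump a b n x) \<longlonglongrightarrow> (\<Prod>i\<in>(UNIV::'a set). 1 * 1)"
    unfolding box_bump_def by (intro tendsto_prod tendsto_mult flat_exp_1_tendsto pos)
  with True show ?thesis by simp
qed (simp add: box_bump_outside)

lemma box_bump_test_function:
  assumes "cbox a b \<subseteq> \<Omega>"
  shows "(\<lambda>x. complex_of_real (box_bump a b n x)) \<in> test_functions \<Omega>"
proof (rule test_functionsI[OF _ _ assms])
  let ?m = "real (Suc n)"
  have eq: "(\<lambda>x. complex_of_real (box_bump a b n x)) = (\<lambda>x. \<Prod>i\<in>UNIV.
      complex_of_real (flat_exp 1 (?m * x $ i + (- ?m * a $ i))) * complex_of_real (flat_exp 1 ((- ?m) * x $ i + ?m * b $ i)))"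
    by (auto simp: box_bump_def algebra_simps)
  show "C_k k (\<lambda>x. complex_of_real (box_bump a b n x))" for k
    unfolding eq by (intro C_k_prod C_k_mult C_k_flat_exp)
  show "complex_of_real (box_bump a b n x) = 0" if "x \<notin> cbox a b" for x
    using box_bump_outside[of x a b n] that box_subset_cbox[of a b] by auto
qed simp

lemma L2_cnj: "f \<in> L2 M \<Longrightarrow> (\<lambda>x. cnj (f x)) \<in> L2 M"
proof -
  assume f: "f \<in> L2 M"
  have "(\<lambda>x. cnj (f x)) \<in> borel_measurable M"
    by (rule borel_measurable_continuous_on[where f=cnj]) (auto intro: continuous_intros L2_measurable[OF f])
  then show ?thesis using f by (simp add: L2_def)
qed

lemma L2_times_integrable: "f \<in> L2 M \<Longrightarrow> g \<in> L2 M \<Longrightarrow> integrable M (\<lambda>x. f x * g x)"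
  using L2_inner_integrable[OF _ L2_cnj, of f M g] by simp

lemma indicator_L2:
  assumes "\<Omega> \<in> sets lebesgue"
  shows "(indicator (cbox a b) :: real^'n \<Rightarrow> complex) \<in> L2 (lebesgue_on \<Omega>)"
proof -
  have "emeasure lebesgue (\<Omega> \<inter> cbox a b) \<le> emeasure lebesgue (cbox a b)"
    using assms by (intro emeasure_mono) auto
  also have "\<dots> < \<infinity>" using emeasure_compact_finite[OF compact_cbox, of a b] by simp
  finally have "integrable lebesgue (indicator (\<Omega> \<inter> cbox a b) :: real^'n \<Rightarrow> real)"
    using assms by (intro integrable_real_indicator) auto
  moreover have "(\<lambda>x. indicator \<Omega> x *\<^sub>R (cmod (indicator (cbox a b) x))\<^sup>2) = (indicator (\<Omega> \<inter> cbox a b) :: real^'n \<Rightarrow> real)"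
    by (auto simp: indicator_def)
  ultimately have "integrable (lebesgue_on \<Omega>) (\<lambda>x. (cmod (indicator (cbox a b) x))\<^sup>2)"
    using assms by (subst integrable_restrict_space) simp_all
  moreover have "(indicator (cbox a b) :: real^'n \<Rightarrow> complex) \<in> borel_measurable (lebesgue_on \<Omega>)"
    by (intro measurable_restrict_space1 measurable_completion) simp
  ultimately show ?thesis by (simp add: L2_def)
qed

lemma small_box_in_open:
  fixes x :: "'a::euclidean_space"
  assumes "open \<Omega>" "x \<in> \<Omega>"
  shows "\<exists>d>0. \<forall>h. 0 < h \<longrightarrow> h < d \<longrightarrow> cbox x (x + h *\<^sub>R One) \<subseteq> \<Omega>"
proof -
  obtain r where r: "r > 0" "ball x r \<subseteq> \<Omega>" using assms open_contains_ball by blast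
  have "cbox x (x + h *\<^sub>R One) \<subseteq> \<Omega>" if h: "0 < h" "h < r / DIM('a)" for h
  proof
    fix y assume y: "y \<in> cbox x (x + h *\<^sub>R One)"
    have "norm (y - x) \<le> (\<Sum>i\<in>Basis. \<bar>(y - x) \<bullet> i\<bar>)" by (rule norm_le_l1)
    also have "\<dots> \<le> (\<Sum>i\<in>(Basis::'a set). h)"
      by (intro sum_mono) (use y in \<open>auto simp: mem_box inner_diff_left inner_add_left abs_le_iff\<close>)
    also have "\<dots> < r" using h by (simp add: field_simps)
    finally show "y \<in> \<Omega>" using r by (auto simp: dist_norm norm_minus_commute)
  qed
  then show ?thesis using r by (intro exI[of _ "r / DIM('a)"]) auto
qed

text \<open>The integral of \<open>g\<close> over a box in \<open>\<Omega>\<close> vanishes, because the indicator of the box is a limit of test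
  functions; almost every value of \<open>g\<close> is a limit of averages over such boxes.\<close>

lemma fundamental_lemma:
  fixes g :: "real^'n::finite \<Rightarrow> complex"
  assumes \<Omega>: "open \<Omega>" and g: "g \<in> L2 (lebesgue_on \<Omega>)"
    and zero: "\<And>f. f \<in> test_functions \<Omega> \<Longrightarrow> (LINT x|lebesgue_on \<Omega>. g x * f x) = 0"
  shows "AE x in lebesgue_on \<Omega>. g x = 0"
proof -
  have \<Omega>m: "\<Omega> \<in> sets lebesgue" using \<Omega> by simp
  define G where "G x = (if x \<in> \<Omega> then g x else 0)" for x
  have fun_eq: "(\<lambda>x. indicator \<Omega> x *\<^sub>R (g x * indicator S x)) = (\<lambda>x. indicator S x *\<^sub>R G x)" for S
    by (auto simp: G_def indicator_def)
  have set_int: "set_integrable lebesgue S G \<longleftrightarrow> integrable (lebesgue_on \<Omega>) (\<lambda>x. g x * indicator S x)" for S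
    using \<Omega>m by (simp add: integrable_restrict_space fun_eq set_integrable_def)
  have set_LINT: "(LINT x:S|lebesgue. G x) = (LINT x|lebesgue_on \<Omega>. g x * indicator S x)" for S
    using \<Omega>m by (simp add: integral_restrict_space fun_eq set_lebesgue_integral_def)
  have int_cbox: "integrable (lebesgue_on \<Omega>) (\<lambda>x. g x * indicator (cbox a b) x)" for a b
    by (rule L2_times_integrable[OF g indicator_L2[OF \<Omega>m]])
  have G_int: "G integrable_on cbox a b" for a b
    using int_cbox set_int set_lebesgue_integral_eq_integral(1) by blast
  have G_zero: "integral (cbox a b) G = 0" if sub: "cbox a b \<subseteq> \<Omega>" for a b
  proof -
    have lim: "(\<lambda>n. LINT x|lebesgue_on \<Omega>. g x * complex_of_real (box_bump a b n x))
        \<longlonglongrightarrow> (LINT x|lebesgue_on \<Omega>. g x * indicator (box a b) x)"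
    proof (rule integral_dominated_convergence)
      show "integrable (lebesgue_on \<Omega>) (\<lambda>x. norm (g x * indicator (cbox a b) x))"
        using int_cbox by (rule integrable_norm)
      show "AE x in lebesgue_on \<Omega>. norm (g x * complex_of_real (box_bump a b n x)) \<le> norm (g x * indicator (cbox a b) x)" for n
      proof (rule AE_I2)
        fix x
        have "box_bump a b n x \<le> indicator (cbox a b) x"
          using box_bump_le[of a b n x] box_bump_outside[of x a b n] box_subset_cbox[of a b] by (auto simp: indicator_def)
        then show "norm (g x * complex_of_real (box_bump a b n x)) \<le> norm (g x * indicator (cbox a b) x)"
          using box_bump_le[of a b n x] by (auto simp: norm_mult indicator_def intro!: mult_left_le mult_left_mono)
      qed
      show "AE x in lebesgue_on \<Omega>. (\<lambda>n. g x * complex_of_real (box_bump a b n x)) \<longlonglongrightarrow> g x * indicator (box a b) x"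
      proof (intro AE_I2 tendsto_mult tendsto_const)
        fix x
        have "(\<lambda>n. complex_of_real (box_bump a b n x)) \<longlonglongrightarrow> complex_of_real (indicator (box a b) x)"
          by (intro tendsto_of_real box_bump_tendsto)
        then show "(\<lambda>n. complex_of_real (box_bump a b n x)) \<longlonglongrightarrow> indicator (box a b) x"
          by (simp add: indicator_def of_bool_def split: if_splits)
      qed
      have [measurable]: "g \<in> borel_measurable (lebesgue_on \<Omega>)" using g by (rule L2_measurable)
      have "(indicator (box a b) :: real^'n \<Rightarrow> complex) \<in> borel_measurable (lebesgue_on \<Omega>)"
        by (intro measurable_restrict_space1 measurable_completion) simp
      then show "(\<lambda>x. g x * indicator (box a b) x) \<in> borel_measurable (lebesgue_on \<Omega>)"
        by (intro borel_measurable_times) simp_all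
      have "(\<lambda>x. complex_of_real (box_bump a b n x)) \<in> L2 (lebesgue_on \<Omega>)" for n
        by (rule test_functions_L2[OF \<Omega>m box_bump_test_function[OF sub]])
      then show "(\<lambda>x. g x * complex_of_real (box_bump a b n x)) \<in> borel_measurable (lebesgue_on \<Omega>)" for n
        by (rule borel_measurable_times[OF L2_measurable[OF g] L2_measurable])
    qed
    have "(LINT x|lebesgue_on \<Omega>. g x * complex_of_real (box_bump a b n x)) = 0" for n
      by (rule zero[OF box_bump_test_function[OF sub]])
    with lim have "(\<lambda>n::nat. 0) \<longlonglongrightarrow> (LINT x|lebesgue_on \<Omega>. g x * indicator (box a b) x)" by simp
    from LIMSEQ_unique[OF this tendsto_const]
    have "(LINT x|lebesgue_on \<Omega>. g x * indicator (box a b) x) = 0" .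
    moreover have "set_integrable lebesgue (box a b) G"
    proof (rule set_integrable_subset)
      show "set_integrable lebesgue (cbox a b) G" unfolding set_int by (rule int_cbox)
    qed (simp_all add: box_subset_cbox)
    then have "(LINT x:box a b|lebesgue. G x) = integral (box a b) G" by (rule set_lebesgue_integral_eq_integral(2))
    ultimately show ?thesis by (simp add: set_LINT integral_open_interval)
  qed
  obtain N where N: "negligible N" "\<And>x e. x \<notin> N \<Longrightarrow> 0 < e \<Longrightarrow>
      \<exists>d>0. \<forall>h. 0 < h \<and> h < d \<longrightarrow> norm (integral (cbox x (x + h *\<^sub>R One)) G /\<^sub>R h ^ DIM(real^'n) - G x) < e"
    using integrable_ccontinuous_explicit[of G, OF G_int] by metis
  have G0: "G x = 0" if x: "x \<in> \<Omega>" "x \<notin> N" for x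
  proof (rule ccontr)
    assume "G x \<noteq> 0"
    then have "norm (G x) > 0" by simp
    from N(2)[OF x(2) this] obtain d where d: "d > 0"
      "\<forall>h. 0 < h \<and> h < d \<longrightarrow> norm (integral (cbox x (x + h *\<^sub>R One)) G /\<^sub>R h ^ DIM(real^'n) - G x) < norm (G x)" by blast
    obtain d' where d': "d' > 0" "\<forall>h. 0 < h \<longrightarrow> h < d' \<longrightarrow> cbox x (x + h *\<^sub>R One) \<subseteq> \<Omega>"
      using small_box_in_open[OF \<Omega> x(1)] by blast
    define h where "h = min d d' / 2"
    have h: "0 < h" "h < d" "h < d'" using d(1) d'(1) by (auto simp: h_def)
    have "integral (cbox x (x + h *\<^sub>R One)) G = 0" using d'(2) h by (intro G_zero) blast
    then show False using d(2) h by auto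
  qed
  have "AE x in lebesgue. x \<notin> N" using N(1) by (simp add: negligible_iff_null_sets AE_not_in)
  then have "AE x in lebesgue. x \<in> \<Omega> \<longrightarrow> g x = 0"
  proof eventually_elim
    case (elim x)
    then show ?case using G0[of x] by (auto simp: G_def)
  qed
  then show ?thesis using \<Omega>m by (subst AE_restrict_space_iff) simp_all
qed

section \<open>The Dirichlet form\<close>

lemma sigma_finite_lebesgue_on:
  assumes "\<Omega> \<in> sets lebesgue"
  shows "sigma_finite_measure (lebesgue_on \<Omega> :: 'a::euclidean_space measure)"
proof (rule sigma_finite_measure_restrict_space[OF _ assms])
  obtain A :: "'a set set" where A: "countable A" "A \<subseteq> sets lborel" "\<Union>A = space lborel" "\<forall>a\<in>A. emeasure lborel a \<noteq> \<infinity>"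
    using lborel.sigma_finite_countable by blast
  show "sigma_finite_measure (lebesgue :: 'a measure)"
  proof (rule sigma_finite_measure.intro, intro exI conjI)
    show "countable A" "A \<subseteq> sets lebesgue" "\<Union>A = space lebesgue" using A by auto
    show "\<forall>a\<in>A. emeasure lebesgue a \<noteq> \<infinity>"
    proof
      fix a assume "a \<in> A"
      then have "a \<in> sets lborel" "emeasure lborel a \<noteq> \<infinity>" using A by blast+
      then show "emeasure lebesgue a \<noteq> \<infinity>" by simp
    qed
  qed
qed

lemma weak_partial_L2: "is_weak_partial \<Omega> i u g \<Longrightarrow> g \<in> L2 (lebesgue_on \<Omega>)"
  by (simp add: is_weak_partial_def)

lemma is_weak_partial_lin:
  assumes \<Omega>: "\<Omega> \<in> sets lebesgue" and uv: "u \<in> L2 (lebesgue_on \<Omega>)" "v \<in> L2 (lebesgue_on \<Omega>)"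
    and g: "is_weak_partial \<Omega> i u g" and h: "is_weak_partial \<Omega> i v h"
  shows "is_weak_partial \<Omega> i (\<lambda>x. c * u x + d * v x) (\<lambda>x. c * g x + d * h x)"
  unfolding is_weak_partial_def
proof (intro conjI ballI)
  have gh: "g \<in> L2 (lebesgue_on \<Omega>)" "h \<in> L2 (lebesgue_on \<Omega>)" using g h weak_partial_L2 by blast+
  then show "(\<lambda>x. c * g x + d * h x) \<in> L2 (lebesgue_on \<Omega>)" by (rule L2_lin)
  have lin: "(LINT x|lebesgue_on \<Omega>. (c * p x + d * q x) * f x)
      = c * (LINT x|lebesgue_on \<Omega>. p x * f x) + d * (LINT x|lebesgue_on \<Omega>. q x * f x)"
    if "p \<in> L2 (lebesgue_on \<Omega>)" "q \<in> L2 (lebesgue_on \<Omega>)" "f \<in> L2 (lebesgue_on \<Omega>)" for p q f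
    using L2_inner_lin_left[OF that(1,2) L2_cnj[OF that(3)], of c d] by (simp add: L2_inner_def)
  fix f assume f: "f \<in> test_functions \<Omega>"
  have fL: "f \<in> L2 (lebesgue_on \<Omega>)" "partial_deriv i f \<in> L2 (lebesgue_on \<Omega>)"
    by (intro test_functions_L2 test_functions_partial \<Omega> f)+
  have "(LINT x|lebesgue_on \<Omega>. u x * partial_deriv i f x) = - (LINT x|lebesgue_on \<Omega>. g x * f x)"
    "(LINT x|lebesgue_on \<Omega>. v x * partial_deriv i f x) = - (LINT x|lebesgue_on \<Omega>. h x * f x)"
    using g h f by (auto simp: is_weak_partial_def)
  then show "(LINT x|lebesgue_on \<Omega>. (c * u x + d * v x) * partial_deriv i f x)
      = - (LINT x|lebesgue_on \<Omega>. (c * g x + d * h x) * f x)"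
    unfolding lin[OF uv fL(2)] lin[OF gh fL(1)] by simp
qed

text \<open>The weak derivatives in the Dirichlet form are chosen by \<open>SOME\<close>; by uniqueness the choice is linear up to null sets.\<close>

lemma weak_partial_unique:
  fixes \<Omega> :: "(real^'n::finite) set"
  assumes \<Omega>: "open \<Omega>" and g: "is_weak_partial \<Omega> i u g" and h: "is_weak_partial \<Omega> i u h"
  shows "AE x in lebesgue_on \<Omega>. g x = h x"
proof -
  have \<Omega>m: "\<Omega> \<in> sets lebesgue" using \<Omega> by simp
  have gh: "g \<in> L2 (lebesgue_on \<Omega>)" "h \<in> L2 (lebesgue_on \<Omega>)" using g h weak_partial_L2 by blast+
  have "AE x in lebesgue_on \<Omega>. g x - h x = 0"
  proof (rule fundamental_lemma[OF \<Omega> L2_diff[OF gh]])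
    fix f assume f: "f \<in> test_functions \<Omega>"
    have fL: "f \<in> L2 (lebesgue_on \<Omega>)" by (rule test_functions_L2[OF \<Omega>m f])
    have "(LINT x|lebesgue_on \<Omega>. (g x - h x) * f x) = (LINT x|lebesgue_on \<Omega>. g x * f x) - (LINT x|lebesgue_on \<Omega>. h x * f x)"
      using L2_inner_diff_left[OF gh L2_cnj[OF fL]] by (simp add: L2_inner_def)
    also have "\<dots> = 0" using g h f by (simp add: is_weak_partial_def)
    finally show "(LINT x|lebesgue_on \<Omega>. (g x - h x) * f x) = 0" .
  qed
  then show ?thesis by simp
qed

lemma weak_partial_works:
  assumes "u \<in> H1 \<Omega>"
  shows "is_weak_partial \<Omega> i u (weak_partial \<Omega> i u)"
proof -
  have "\<exists>g. is_weak_partial \<Omega> i u g" using assms by (simp add: H1_def)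
  then show ?thesis unfolding weak_partial_def by (rule someI_ex)
qed

lemma H1_L2: "u \<in> H1 \<Omega> \<Longrightarrow> u \<in> L2 (lebesgue_on \<Omega>)"
  by (simp add: H1_def)

lemma H1_partial_L2: "u \<in> H1 \<Omega> \<Longrightarrow> weak_partial \<Omega> i u \<in> L2 (lebesgue_on \<Omega>)"
  by (rule weak_partial_L2[OF weak_partial_works])

lemma H1_lin:
  assumes "\<Omega> \<in> sets lebesgue" "u \<in> H1 \<Omega>" "v \<in> H1 \<Omega>"
  shows "(\<lambda>x. c * u x + d * v x) \<in> H1 \<Omega>"
  unfolding H1_def
proof (intro CollectI conjI allI exI)
  show "(\<lambda>x. c * u x + d * v x) \<in> L2 (lebesgue_on \<Omega>)" by (intro L2_lin H1_L2 assms)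
  show "is_weak_partial \<Omega> i (\<lambda>x. c * u x + d * v x) (\<lambda>x. c * weak_partial \<Omega> i u x + d * weak_partial \<Omega> i v x)" for i
    by (intro is_weak_partial_lin weak_partial_works H1_L2 assms)
qed

lemma weak_partial_lin:
  assumes "open \<Omega>" "u \<in> H1 \<Omega>" "v \<in> H1 \<Omega>"
  shows "AE x in lebesgue_on \<Omega>. weak_partial \<Omega> i (\<lambda>x. c * u x + d * v x) x
    = c * weak_partial \<Omega> i u x + d * weak_partial \<Omega> i v x"
proof (rule weak_partial_unique[OF assms(1)])
  have \<Omega>m: "\<Omega> \<in> sets lebesgue" using assms(1) by simp
  show "is_weak_partial \<Omega> i (\<lambda>x. c * u x + d * v x) (weak_partial \<Omega> i (\<lambda>x. c * u x + d * v x))"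
    by (intro weak_partial_works H1_lin \<Omega>m assms)
  show "is_weak_partial \<Omega> i (\<lambda>x. c * u x + d * v x) (\<lambda>x. c * weak_partial \<Omega> i u x + d * weak_partial \<Omega> i v x)"
    by (intro is_weak_partial_lin weak_partial_works H1_L2 \<Omega>m assms)
qed

lemma test_functions_H1:
  assumes "\<Omega> \<in> sets lebesgue" "f \<in> test_functions \<Omega>"
  shows "f \<in> H1 \<Omega>"
  using test_function_weak_partial[OF assms] test_functions_L2[OF assms] unfolding H1_def by blast

lemma weak_partial_test:
  assumes "open \<Omega>" "f \<in> test_functions \<Omega>"
  shows "AE x in lebesgue_on \<Omega>. weak_partial \<Omega> i f x = partial_deriv i f x"
proof -
  have \<Omega>m: "\<Omega> \<in> sets lebesgue" using assms(1) by simp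
  show ?thesis
    by (rule weak_partial_unique[OF assms(1) weak_partial_works[OF test_functions_H1[OF \<Omega>m assms(2)]]
        test_function_weak_partial[OF \<Omega>m assms(2)]])
qed

lemma H1_norm_ge:
  "L2_norm (lebesgue_on \<Omega>) u \<le> H1_norm \<Omega> u"
  "L2_norm (lebesgue_on \<Omega>) (weak_partial \<Omega> i u) \<le> H1_norm \<Omega> u"
  "(\<Sum>i\<in>UNIV. (L2_norm (lebesgue_on \<Omega>) (weak_partial \<Omega> i u))\<^sup>2) \<le> (H1_norm \<Omega> u)\<^sup>2"
proof -
  let ?p = "\<lambda>i. (L2_norm (lebesgue_on \<Omega>) (weak_partial \<Omega> i u))\<^sup>2"
  have s: "0 \<le> sum ?p UNIV" by (intro sum_nonneg) simp
  then have sq: "(H1_norm \<Omega> u)\<^sup>2 = (L2_norm (lebesgue_on \<Omega>) u)\<^sup>2 + sum ?p UNIV"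
    unfolding H1_norm_def by (subst real_sqrt_pow2) simp_all
  have nn: "0 \<le> H1_norm \<Omega> u" unfolding H1_norm_def using s by simp
  show "L2_norm (lebesgue_on \<Omega>) u \<le> H1_norm \<Omega> u"
    by (rule power2_le_imp_le[OF _ nn]) (use sq s in simp)
  show "(\<Sum>i\<in>UNIV. (L2_norm (lebesgue_on \<Omega>) (weak_partial \<Omega> i u))\<^sup>2) \<le> (H1_norm \<Omega> u)\<^sup>2"
    using sq by simp
  have "?p i \<le> sum ?p UNIV" by (rule member_le_sum) auto
  then show "L2_norm (lebesgue_on \<Omega>) (weak_partial \<Omega> i u) \<le> H1_norm \<Omega> u"
    using sq zero_le_power2[of "L2_norm (lebesgue_on \<Omega>) u"]
    by (intro power2_le_imp_le[OF _ nn]) linarith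
qed

lemma H1_norm_le:
  "H1_norm \<Omega> u \<le> L2_norm (lebesgue_on \<Omega>) u + (\<Sum>i\<in>UNIV. L2_norm (lebesgue_on \<Omega>) (weak_partial \<Omega> i u))"
proof -
  let ?p = "\<lambda>i. L2_norm (lebesgue_on \<Omega>) (weak_partial \<Omega> i u)"
  have "H1_norm \<Omega> u \<le> sqrt ((L2_norm (lebesgue_on \<Omega>) u)\<^sup>2) + sqrt (\<Sum>i\<in>UNIV. (?p i)\<^sup>2)"
    unfolding H1_norm_def by (intro sqrt_add_le_add_sqrt sum_nonneg) auto
  also have "sqrt (\<Sum>i\<in>UNIV. (?p i)\<^sup>2) \<le> sum ?p UNIV"
    using L2_set_le_sum[of UNIV ?p] by (simp add: L2_set_def)
  finally show ?thesis by simp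
qed

lemma H1_norm_lin_le:
  fixes \<Omega> :: "(real^'n::finite) set"
  assumes \<Omega>: "open \<Omega>" and u: "u \<in> H1 \<Omega>" and v: "v \<in> H1 \<Omega>"
  shows "H1_norm \<Omega> (\<lambda>x. c * u x + d * v x)
    \<le> (1 + real CARD('n)) * (cmod c * H1_norm \<Omega> u + cmod d * H1_norm \<Omega> v)"
proof -
  let ?N = "L2_norm (lebesgue_on \<Omega>)" and ?b = "cmod c * H1_norm \<Omega> u + cmod d * H1_norm \<Omega> v"
  have \<Omega>m: "\<Omega> \<in> sets lebesgue" using \<Omega> by simp
  have N_lin: "?N (\<lambda>x. c * p x + d * q x) \<le> cmod c * ?N p + cmod d * ?N q"
    if "p \<in> L2 (lebesgue_on \<Omega>)" "q \<in> L2 (lebesgue_on \<Omega>)" for p q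
    using L2_norm_add_triangle[OF L2_scale[OF that(1), of c] L2_scale[OF that(2), of d]]
    by (simp add: L2_norm_scale)
  have "?N (\<lambda>x. c * u x + d * v x) \<le> cmod c * ?N u + cmod d * ?N v"
    by (rule N_lin[OF H1_L2[OF u] H1_L2[OF v]])
  also have "\<dots> \<le> ?b" by (intro add_mono mult_left_mono H1_norm_ge) auto
  finally have 1: "?N (\<lambda>x. c * u x + d * v x) \<le> ?b" .
  have 2: "?N (weak_partial \<Omega> i (\<lambda>x. c * u x + d * v x)) \<le> ?b" for i
  proof -
    have "?N (weak_partial \<Omega> i (\<lambda>x. c * u x + d * v x))
        = ?N (\<lambda>x. c * weak_partial \<Omega> i u x + d * weak_partial \<Omega> i v x)"
      by (rule L2_norm_cong[OF weak_partial_lin[OF \<Omega> u v]])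
        (intro L2_measurable H1_partial_L2 H1_lin L2_lin \<Omega>m u v)+
    also have "\<dots> \<le> cmod c * ?N (weak_partial \<Omega> i u) + cmod d * ?N (weak_partial \<Omega> i v)"
      by (rule N_lin[OF H1_partial_L2[OF u] H1_partial_L2[OF v]])
    also have "\<dots> \<le> ?b" by (intro add_mono mult_left_mono H1_norm_ge) auto
    finally show ?thesis .
  qed
  have "H1_norm \<Omega> (\<lambda>x. c * u x + d * v x) \<le> ?b + (\<Sum>i\<in>(UNIV::'n set). ?b)"
    by (rule order_trans[OF H1_norm_le]) (intro add_mono sum_mono 1 2)
  also have "\<dots> = (1 + real CARD('n)) * ?b" by (simp only: sum_constant) (simp add: algebra_simps)
  finally show ?thesis .
qed

lemma H10_H1: "u \<in> H10 \<Omega> \<Longrightarrow> u \<in> H1 \<Omega>"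
  by (simp add: H10_def)

lemma H10_lin:
  fixes \<Omega> :: "(real^'n::finite) set"
  assumes \<Omega>: "open \<Omega>" and u: "u \<in> H10 \<Omega>" and v: "v \<in> H10 \<Omega>"
  shows "(\<lambda>x. c * u x + d * v x) \<in> H10 \<Omega>"
proof -
  have \<Omega>m: "\<Omega> \<in> sets lebesgue" using \<Omega> by simp
  obtain f where f: "\<And>m. f m \<in> test_functions \<Omega>" "(\<lambda>m::nat. H1_norm \<Omega> (\<lambda>x. u x - f m x)) \<longlonglongrightarrow> 0"
    using u by (auto simp: H10_def)
  obtain g where g: "\<And>m. g m \<in> test_functions \<Omega>" "(\<lambda>m::nat. H1_norm \<Omega> (\<lambda>x. v x - g m x)) \<longlonglongrightarrow> 0"
    using v by (auto simp: H10_def)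
  have 1: "(\<lambda>x. u x - f m x) \<in> H1 \<Omega>" "(\<lambda>x. v x - g m x) \<in> H1 \<Omega>" for m
    using H1_lin[OF \<Omega>m H10_H1[OF u] test_functions_H1[OF \<Omega>m f(1)], of 1 "-1"]
      H1_lin[OF \<Omega>m H10_H1[OF v] test_functions_H1[OF \<Omega>m g(1)], of 1 "-1"] by simp_all
  define r where "r m = (1 + real CARD('n)) * (cmod c * H1_norm \<Omega> (\<lambda>x. u x - f m x) + cmod d * H1_norm \<Omega> (\<lambda>x. v x - g m x))" for m
  have "r \<longlonglongrightarrow> (1 + real CARD('n)) * (cmod c * 0 + cmod d * 0)"
    unfolding r_def by (intro tendsto_intros f g)
  then have r0: "r \<longlonglongrightarrow> 0" by simp
  have le: "H1_norm \<Omega> (\<lambda>x. (c * u x + d * v x) - (c * f m x + d * g m x)) \<le> r m" for m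
    using H1_norm_lin_le[OF \<Omega> 1(1)[of m] 1(2)[of m], of c d] by (simp add: r_def algebra_simps)
  have "(\<lambda>m. H1_norm \<Omega> (\<lambda>x. (c * u x + d * v x) - (c * f m x + d * g m x))) \<longlonglongrightarrow> 0"
  proof (rule tendsto_sandwich[OF _ _ tendsto_const r0])
    show "\<forall>\<^sub>F m in sequentially. 0 \<le> H1_norm \<Omega> (\<lambda>x. (c * u x + d * v x) - (c * f m x + d * g m x))"
      by (intro always_eventually allI order_trans[OF L2_norm_nonneg H1_norm_ge(1)])
  qed (intro always_eventually allI le)
  moreover have "(\<lambda>x. c * f m x + d * g m x) \<in> test_functions \<Omega>" for m
    by (rule test_functions_lin[OF f(1) g(1)])
  moreover have "(\<lambda>x. c * u x + d * v x) \<in> H1 \<Omega>" by (intro H1_lin \<Omega>m H10_H1 u v)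
  ultimately show ?thesis unfolding H10_def
    by (intro CollectI conjI exI[of _ "\<lambda>m x. c * f m x + d * g m x"] allI)
qed

lemma test_functions_H10:
  assumes \<Omega>: "open \<Omega>" and f: "f \<in> test_functions \<Omega>"
  shows "f \<in> H10 \<Omega>"
proof -
  have \<Omega>m: "\<Omega> \<in> sets lebesgue" using \<Omega> by simp
  have H: "f \<in> H1 \<Omega>" by (rule test_functions_H1[OF \<Omega>m f])
  have "0 \<le> H1_norm \<Omega> (\<lambda>x. f x - f x)" by (rule order_trans[OF L2_norm_nonneg H1_norm_ge(1)])
  moreover have "H1_norm \<Omega> (\<lambda>x. f x - f x) \<le> 0" using H1_norm_lin_le[OF \<Omega> H H, of 0 0] by simp
  ultimately have "H1_norm \<Omega> (\<lambda>x. f x - f x) = 0" by linarith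
  then have "(\<lambda>m::nat. H1_norm \<Omega> (\<lambda>x. f x - f x)) \<longlonglongrightarrow> 0" by simp
  then show ?thesis unfolding H10_def using H f by (intro CollectI conjI exI[of _ "\<lambda>_. f"] allI)
qed

lemma dirichlet_form_operator:
  fixes \<Omega> :: "(real^'n::finite) set"
  assumes \<Omega>: "open \<Omega>"
  shows "form_operator (lebesgue_on \<Omega>) (H10 \<Omega>) (dirichlet_form \<Omega>)"
proof -
  have \<Omega>m: "\<Omega> \<in> sets lebesgue" using \<Omega> by simp
  interpret sigma_finite_measure "lebesgue_on \<Omega>" by (rule sigma_finite_lebesgue_on[OF \<Omega>m])
  show ?thesis
  proof
    show "u \<in> L2 (lebesgue_on \<Omega>)" if "u \<in> H10 \<Omega>" for u using that H10_H1 H1_L2 by blast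
    show "(\<lambda>x. 0) \<in> H10 \<Omega>" by (rule test_functions_H10[OF \<Omega> test_functions_zero])
    show "(\<lambda>x. c * u x + d * v x) \<in> H10 \<Omega>" if "u \<in> H10 \<Omega>" "v \<in> H10 \<Omega>" for u v c d
      by (rule H10_lin[OF \<Omega> that])
    show "dirichlet_form \<Omega> v u = cnj (dirichlet_form \<Omega> u v)" for u v
      unfolding dirichlet_form_def cnj_sum by (intro sum.cong refl L2_inner_commute)
    show "0 \<le> Re (dirichlet_form \<Omega> u u)" for u
      unfolding dirichlet_form_def Re_sum L2_inner_self by (intro sum_nonneg) (simp only: Re_complex_of_real zero_le_power2)
    show "dirichlet_form \<Omega> (\<lambda>x. c * u x + d * v x) w = c * dirichlet_form \<Omega> u w + d * dirichlet_form \<Omega> v w"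
      if "u \<in> H10 \<Omega>" "v \<in> H10 \<Omega>" "w \<in> H10 \<Omega>" for u v w c d
    proof -
      have H: "u \<in> H1 \<Omega>" "v \<in> H1 \<Omega>" "w \<in> H1 \<Omega>" using that H10_H1 by blast+
      have "L2_inner (lebesgue_on \<Omega>) (weak_partial \<Omega> i (\<lambda>x. c * u x + d * v x)) (weak_partial \<Omega> i w)
          = c * L2_inner (lebesgue_on \<Omega>) (weak_partial \<Omega> i u) (weak_partial \<Omega> i w)
            + d * L2_inner (lebesgue_on \<Omega>) (weak_partial \<Omega> i v) (weak_partial \<Omega> i w)" for i
      proof -
        have "L2_inner (lebesgue_on \<Omega>) (weak_partial \<Omega> i (\<lambda>x. c * u x + d * v x)) (weak_partial \<Omega> i w)
          = L2_inner (lebesgue_on \<Omega>) (\<lambda>x. c * weak_partial \<Omega> i u x + d * weak_partial \<Omega> i v x) (weak_partial \<Omega> i w)"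
          by (rule L2_inner_cong[OF weak_partial_lin[OF \<Omega> H(1,2)] AE_I2[OF refl]])
            (intro L2_measurable H1_partial_L2 H1_lin L2_lin \<Omega>m H)+
        then show ?thesis by (simp add: L2_inner_lin_left H1_partial_L2 H)
      qed
      then show ?thesis unfolding dirichlet_form_def by (simp add: sum.distrib sum_distrib_left)
    qed
  qed
qed

lemma dirichlet_laplacian_eq:
  assumes "open \<Omega>"
  shows "form_operator.A (lebesgue_on \<Omega>) (H10 \<Omega>) (dirichlet_form \<Omega>) = dirichlet_laplacian \<Omega>"
  unfolding form_operator.A_def[OF dirichlet_form_operator[OF assms]] dirichlet_laplacian_def ..

lemma dirichlet_form_self:
  "Re (dirichlet_form \<Omega> u u) = (\<Sum>i\<in>UNIV. (L2_norm (lebesgue_on \<Omega>) (weak_partial \<Omega> i u))\<^sup>2)"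
  unfolding dirichlet_form_def Re_sum L2_inner_self Re_complex_of_real ..

lemma H10_approximation:
  assumes "u \<in> H10 \<Omega>" "\<epsilon> > 0"
  shows "\<exists>f\<in>test_functions \<Omega>. L2_norm (lebesgue_on \<Omega>) (\<lambda>x. u x - f x) \<le> \<epsilon> \<and>
    sqrt (Re (dirichlet_form \<Omega> (\<lambda>x. u x - f x) (\<lambda>x. u x - f x))) \<le> \<epsilon>"
proof -
  obtain f where f: "\<And>m. f m \<in> test_functions \<Omega>" "(\<lambda>m::nat. H1_norm \<Omega> (\<lambda>x. u x - f m x)) \<longlonglongrightarrow> 0"
    using assms(1) by (auto simp: H10_def)
  have "\<forall>\<^sub>F m in sequentially. H1_norm \<Omega> (\<lambda>x. u x - f m x) < \<epsilon>"
    by (rule order_tendstoD(2)[OF f(2) assms(2)])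
  from eventually_happens'[OF sequentially_bot this] obtain m where m: "H1_norm \<Omega> (\<lambda>x. u x - f m x) < \<epsilon>" by blast
  have 0: "0 \<le> H1_norm \<Omega> (\<lambda>x. u x - f m x)" by (rule order_trans[OF L2_norm_nonneg H1_norm_ge(1)])
  have "L2_norm (lebesgue_on \<Omega>) (\<lambda>x. u x - f m x) \<le> \<epsilon>"
    using H1_norm_ge(1)[of \<Omega> "\<lambda>x. u x - f m x"] m by linarith
  moreover have "sqrt (Re (dirichlet_form \<Omega> (\<lambda>x. u x - f m x) (\<lambda>x. u x - f m x))) \<le> H1_norm \<Omega> (\<lambda>x. u x - f m x)"
    unfolding dirichlet_form_self by (rule real_le_lsqrt[OF 0 H1_norm_ge(3)])
  ultimately show ?thesis using f(1) m by (intro bexI[of _ "f m"]) auto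
qed

lemma dirichlet_form_test:
  fixes \<Omega> :: "(real^'n::finite) set"
  assumes \<Omega>: "open \<Omega>" and f: "f \<in> test_functions \<Omega>"
  shows "Re (dirichlet_form \<Omega> f f) = (\<Sum>i\<in>UNIV. LINT x|lebesgue. (cmod (partial_deriv i f x))\<^sup>2)"
proof -
  have \<Omega>m: "\<Omega> \<in> sets lebesgue" using \<Omega> by simp
  have "(L2_norm (lebesgue_on \<Omega>) (weak_partial \<Omega> i f))\<^sup>2 = (LINT x|lebesgue. (cmod (partial_deriv i f x))\<^sup>2)" for i
  proof -
    have p: "partial_deriv i f \<in> test_functions \<Omega>" by (rule test_functions_partial[OF f])
    obtain K where K: "K \<subseteq> \<Omega>" "\<forall>x. x \<notin> K \<longrightarrow> partial_deriv i f x = 0" using test_functions_support[OF p] by blast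
    have "L2_norm (lebesgue_on \<Omega>) (weak_partial \<Omega> i f) = L2_norm (lebesgue_on \<Omega>) (partial_deriv i f)"
      by (rule L2_norm_cong[OF weak_partial_test[OF \<Omega> f]])
        (intro L2_measurable H1_partial_L2 test_functions_H1 test_functions_L2 \<Omega>m f p)+
    then have "(L2_norm (lebesgue_on \<Omega>) (weak_partial \<Omega> i f))\<^sup>2 = (LINT x|lebesgue_on \<Omega>. (cmod (partial_deriv i f x))\<^sup>2)"
      by (simp only: L2_norm_sq)
    also have "\<dots> = (LINT x|lebesgue. (cmod (partial_deriv i f x))\<^sup>2)"
    proof (rule lebesgue_on_supported(2)[OF \<Omega>m])
      fix x assume "x \<notin> \<Omega>"
      then have "partial_deriv i f x = 0" using K by blast
      then show "(cmod (partial_deriv i f x))\<^sup>2 = 0" by simp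
    qed
    finally show ?thesis .
  qed
  then show ?thesis by (simp add: dirichlet_form_self)
qed

lemma L2_norm_test:
  assumes \<Omega>: "\<Omega> \<in> sets lebesgue" and f: "f \<in> test_functions \<Omega>"
  shows "(L2_norm (lebesgue_on \<Omega>) f)\<^sup>2 = (LINT x|lebesgue. (cmod (f x))\<^sup>2)"
proof -
  obtain K where K: "K \<subseteq> \<Omega>" "\<forall>x. x \<notin> K \<longrightarrow> f x = 0" using test_functions_support[OF f] by blast
  show ?thesis unfolding L2_norm_sq
  proof (rule lebesgue_on_supported(2)[OF \<Omega>])
    fix x assume "x \<notin> \<Omega>"
    then have "f x = 0" using K by blast
    then show "(cmod (f x))\<^sup>2 = 0" by simp
  qed
qed

section \<open>Polyhedral layers\<close>

definition dir_form :: "real \<Rightarrow> real^3 \<Rightarrow> real" where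
  "dir_form \<psi> x = x $ 1 * cos \<psi> + x $ 2 * sin \<psi>"

definition face_dist :: "real \<Rightarrow> real \<Rightarrow> real^3 \<Rightarrow> real" where
  "face_dist \<theta> \<psi> x = x $ 3 * sin \<theta> - cos \<theta> * dir_form \<psi> x"

lemma bounded_linear_dir_form: "bounded_linear (dir_form \<psi>)"
  unfolding dir_form_def
  by (intro bounded_linear_add bounded_linear_mult_const bounded_linear_vec_nth)

lemma dir_form_derivative: "(dir_form \<psi> has_derivative dir_form \<psi>) (at x within S)"
  by (rule bounded_linear_imp_has_derivative[OF bounded_linear_dir_form])

lemma continuous_dir_form: "continuous_on S (dir_form \<psi>)"
  by (rule linear_continuous_on[OF bounded_linear_dir_form])

lemma continuous_face_dist: "continuous_on S (face_dist \<theta> \<psi>)"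
  unfolding face_dist_def[abs_def] by (intro continuous_intros continuous_dir_form)

lemma polyhedral_angle_eq:
  "polyhedral_angle n \<phi> \<theta> = {x. \<forall>j\<in>{1..n}. 0 < face_dist \<theta> (\<phi> j) x}"
proof -
  have cyl: "face_dist \<theta> \<alpha> (cylindrical r \<psi> z) = z * sin \<theta> - r * cos \<theta> * cos (\<psi> - \<alpha>)" for r \<psi> z \<alpha>
    by (simp add: face_dist_def dir_form_def cylindrical_def vector_3 cos_diff algebra_simps)
  have ex: "\<exists>r \<psi> z. x = cylindrical r \<psi> z \<and> r \<ge> 0" for x
  proof -
    let ?z = "Complex (x $ 1) (x $ 2)"
    have "rcis (cmod ?z) (Arg ?z) = ?z" by (simp add: rcis_cmod_Arg)
    then have "x $ 1 = cmod ?z * cos (Arg ?z)" "x $ 2 = cmod ?z * sin (Arg ?z)"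
      by (metis Re_rcis complex.sel(1), metis Im_rcis complex.sel(2))
    then have "x = cylindrical (cmod ?z) (Arg ?z) (x $ 3)"
      by (simp add: cylindrical_def vec_eq_iff forall_3 vector_3)
    then show ?thesis by (intro exI[of _ "cmod ?z"] exI[of _ "Arg ?z"] exI[of _ "x $ 3"]) simp
  qed
  show ?thesis
  proof (intro set_eqI iffI)
    fix x assume "x \<in> polyhedral_angle n \<phi> \<theta>"
    then show "x \<in> {x. \<forall>j\<in>{1..n}. 0 < face_dist \<theta> (\<phi> j) x}"
      unfolding polyhedral_angle_def using cyl by auto
  next
    fix x assume x: "x \<in> {x. \<forall>j\<in>{1..n}. 0 < face_dist \<theta> (\<phi> j) x}"
    obtain r \<psi> z where rz: "x = cylindrical r \<psi> z" "r \<ge> 0" using ex by blast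
    have "\<forall>j\<in>{1..n}. z * sin \<theta> - r * cos \<theta> * cos (\<psi> - \<phi> j) > 0" using x rz(1) cyl by simp
    with rz show "x \<in> polyhedral_angle n \<phi> \<theta>" unfolding polyhedral_angle_def by blast
  qed
qed

definition face_normal :: "real \<Rightarrow> real \<Rightarrow> real^3" where
  "face_normal \<theta> \<psi> = vector [- cos \<theta> * cos \<psi>, - cos \<theta> * sin \<psi>, sin \<theta>]"

lemma face_dist_inner: "face_dist \<theta> \<psi> x = face_normal \<theta> \<psi> \<bullet> x"
  by (simp add: face_dist_def dir_form_def face_normal_def inner_vec_def sum_3 vector_3 algebra_simps)

lemma norm_face_normal: "norm (face_normal \<theta> \<psi>) = 1"
proof -
  have "face_normal \<theta> \<psi> \<bullet> face_normal \<theta> \<psi>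
      = (cos \<theta>)\<^sup>2 * (cos \<psi>)\<^sup>2 + (cos \<theta>)\<^sup>2 * (sin \<psi>)\<^sup>2 + (sin \<theta>)\<^sup>2"
    by (simp add: face_normal_def inner_vec_def sum_3 vector_3 power2_eq_square algebra_simps)
  also have "\<dots> = (cos \<theta>)\<^sup>2 * ((cos \<psi>)\<^sup>2 + (sin \<psi>)\<^sup>2) + (sin \<theta>)\<^sup>2"
    by (simp only: distrib_left)
  also have "\<dots> = 1" by simp
  finally show ?thesis by (simp add: norm_eq_sqrt_inner)
qed

lemma open_polyhedral_angle: "open (polyhedral_angle n \<phi> \<theta>)"
proof -
  have "polyhedral_angle n \<phi> \<theta> = (\<Inter>j\<in>{1..n}. {x. 0 < face_dist \<theta> (\<phi> j) x})"
    by (auto simp: polyhedral_angle_eq)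
  then show ?thesis by (auto intro!: open_Collect_less continuous_face_dist)
qed

text \<open>The point of the plane of a face nearest to \<open>x\<close> is outside the open angle, so the segment to it meets the
  boundary; conversely a boundary point is on the wrong side of some face.\<close>

lemma polyhedral_layer_eq:
  assumes "1 \<le> n"
  shows "polyhedral_layer n \<phi> \<theta> = {x. (\<forall>j\<in>{1..n}. 0 < face_dist \<theta> (\<phi> j) x) \<and> (\<exists>j\<in>{1..n}. face_dist \<theta> (\<phi> j) x < 1)}"
proof -
  let ?P = "polyhedral_angle n \<phi> \<theta>"
  have main: "infdist x (frontier ?P) \<in> {0<..<1} \<longleftrightarrow> (\<exists>j\<in>{1..n}. face_dist \<theta> (\<phi> j) x < 1)" if x: "x \<in> ?P" for x
  proof -
    have pos: "0 < face_dist \<theta> (\<phi> j) x" if "j \<in> {1..n}" for j using x that by (simp add: polyhedral_angle_eq)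
    have near: "\<exists>y\<in>frontier ?P. dist x y \<le> face_dist \<theta> (\<phi> j) x" if j: "j \<in> {1..n}" for j
    proof -
      let ?d = "face_dist \<theta> (\<phi> j) x"
      define z where "z = x - ?d *\<^sub>R face_normal \<theta> (\<phi> j)"
      have "face_dist \<theta> (\<phi> j) z = ?d - ?d * (norm (face_normal \<theta> (\<phi> j)))\<^sup>2"
        by (simp add: z_def face_dist_inner inner_diff_right dot_square_norm)
      then have "face_dist \<theta> (\<phi> j) z = 0" by (simp add: norm_face_normal)
      then have "z \<notin> ?P" using j by (force simp: polyhedral_angle_eq)
      then have "closed_segment x z \<inter> frontier ?P \<noteq> {}"
        using x by (intro connected_Int_frontier) auto
      then obtain y where y: "y \<in> closed_segment x z" "y \<in> frontier ?P" by blast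
      have "dist x y \<le> dist x z" using segment_bound(1)[OF y(1)] by (simp add: dist_norm norm_minus_commute)
      also have "\<dots> = ?d" using pos[OF j] by (simp add: z_def dist_norm norm_face_normal)
      finally show ?thesis using y(2) by blast
    qed
    have far: "\<exists>j\<in>{1..n}. face_dist \<theta> (\<phi> j) x \<le> dist x y" if y: "y \<in> frontier ?P" for y
    proof -
      have "y \<notin> ?P" using y open_polyhedral_angle by (simp add: frontier_def interior_open)
      then obtain j where j: "j \<in> {1..n}" "face_dist \<theta> (\<phi> j) y \<le> 0" by (auto simp: polyhedral_angle_eq not_less)
      have "face_dist \<theta> (\<phi> j) x - face_dist \<theta> (\<phi> j) y = face_normal \<theta> (\<phi> j) \<bullet> (x - y)"
        by (simp add: face_dist_inner inner_diff_right)
      also have "\<dots> \<le> norm (face_normal \<theta> (\<phi> j)) * norm (x - y)" by (rule norm_cauchy_schwarz)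
      finally have "face_dist \<theta> (\<phi> j) x \<le> dist x y" using j(2) by (simp add: norm_face_normal dist_norm)
      with j(1) show ?thesis by blast
    qed
    have ne: "frontier ?P \<noteq> {}" using near[of 1] assms by auto
    obtain y where y: "y \<in> frontier ?P" "infdist x (frontier ?P) = dist x y"
      using infdist_attains_inf[OF frontier_closed ne] by blast
    obtain j where j: "j \<in> {1..n}" "face_dist \<theta> (\<phi> j) x \<le> dist x y" using far[OF y(1)] by blast
    have "infdist x (frontier ?P) < 1" if i: "i \<in> {1..n}" "face_dist \<theta> (\<phi> i) x < 1" for i
    proof -
      obtain y' where "y' \<in> frontier ?P" "dist x y' \<le> face_dist \<theta> (\<phi> i) x" using near[OF i(1)] by blast
      then show ?thesis using infdist_le[of y' "frontier ?P" x] i(2) by linarith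
    qed
    moreover have "0 < infdist x (frontier ?P)" using j(2) pos[OF j(1)] y(2) by linarith
    moreover have "face_dist \<theta> (\<phi> j) x < 1" if "infdist x (frontier ?P) < 1" using that y(2) j(2) by simp
    ultimately show ?thesis using j(1) by auto
  qed
  show ?thesis unfolding polyhedral_layer_def using main by (auto simp: polyhedral_angle_eq)
qed

lemma open_polyhedral_layer:
  assumes "1 \<le> n"
  shows "open (polyhedral_layer n \<phi> \<theta>)"
proof -
  have "polyhedral_layer n \<phi> \<theta> = polyhedral_angle n \<phi> \<theta> \<inter> (\<Union>j\<in>{1..n}. {x. face_dist \<theta> (\<phi> j) x < 1})"
    by (auto simp: polyhedral_layer_eq[OF assms] polyhedral_angle_eq)
  then show ?thesis
    by (auto intro!: open_Int open_polyhedral_angle open_UN open_Collect_less continuous_face_dist)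
qed

lemma C_k_coordinate: "C_k k (\<lambda>x::real^'n. complex_of_real (x $ i))"
proof (cases k)
  case 0
  then show ?thesis by (simp add: continuous_on_of_real continuous_on_component)
next
  case (Suc m)
  have d: "((\<lambda>x::real^'n. complex_of_real (x $ i)) has_derivative (\<lambda>h. complex_of_real (h $ i))) (at x)" for x
    by (intro has_derivative_of_real bounded_linear_imp_has_derivative bounded_linear_vec_nth)
  have "partial_deriv l (\<lambda>x::real^'n. complex_of_real (x $ i)) = (\<lambda>x. complex_of_real (axis l 1 $ i))" for l
    by (rule ext) (rule partial_deriv_eq[OF d])
  then show ?thesis unfolding Suc C_k.simps(2) using d by (auto simp: differentiable_def C_k_const)
qed

lemma test_square_integrable:
  assumes "f \<in> test_functions UNIV"
  shows "integrable lebesgue (\<lambda>x. (cmod (f x))\<^sup>2)"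
  using test_functions_L2[OF _ assms] by (simp add: L2_def lebesgue_on_UNIV_eq)

lemma test_functions_UNIV: "f \<in> test_functions \<Omega> \<Longrightarrow> f \<in> test_functions UNIV"
  using test_functions_mono[of \<Omega> UNIV] by auto

section \<open>The contraction between two layers\<close>

locale layer_map =
  fixes n :: nat and \<phi> :: "nat \<Rightarrow> real" and \<theta> \<sigma> \<delta> :: real
  assumes n: "1 \<le> n" and angles: "0 < \<theta>" "\<theta> < \<sigma>" "\<sigma> < pi / 2" and \<delta>: "0 < \<delta>"
begin

definition "\<kappa> = cos \<sigma> / cos \<theta>"
definition "\<beta> = sin \<theta> / sin \<sigma>"
definition "\<gamma> = ((cos \<theta>)\<^sup>2 - (cos \<sigma>)\<^sup>2) / (cos \<theta> * sin \<sigma>)"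

lemma trig_pos: "0 < cos \<theta>" "0 < cos \<sigma>" "0 < sin \<theta>" "0 < sin \<sigma>" "cos \<sigma> < cos \<theta>"
  using angles by (auto intro!: cos_gt_zero sin_gt_zero cos_monotone_0_pi)

lemma consts_pos: "0 < \<kappa>" "\<kappa> < 1" "0 < \<beta>" "0 \<le> \<gamma>"
proof -
  have "(cos \<sigma>)\<^sup>2 \<le> (cos \<theta>)\<^sup>2" using trig_pos by (intro power_mono) auto
  then show "0 < \<kappa>" "\<kappa> < 1" "0 < \<beta>" "0 \<le> \<gamma>" using trig_pos by (simp_all add: \<kappa>_def \<beta>_def \<gamma>_def)
qed

text \<open>\<open>smax\<close> is a smooth substitute for the maximum of the linear forms \<open>dir_form (\<phi> j)\<close>, off by at most
  \<open>\<delta> ln n\<close>; its gradient is their convex combination with the coefficients \<open>weight j\<close>.\<close>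

definition expo :: "nat \<Rightarrow> real^3 \<Rightarrow> real" where
  "expo j x = exp (dir_form (\<phi> j) x / \<delta>)"

definition total :: "real^3 \<Rightarrow> real" where
  "total x = (\<Sum>j\<in>{1..n}. expo j x)"

definition smax :: "real^3 \<Rightarrow> real" where
  "smax x = \<delta> * ln (total x)"

definition weight :: "nat \<Rightarrow> real^3 \<Rightarrow> real" where
  "weight j x = expo j x / total x"

lemma expo_pos: "0 < expo j x" by (simp add: expo_def)

lemma total_pos: "0 < total x"
  unfolding total_def using n by (intro sum_pos) (auto simp: expo_pos)

lemma weight_nonneg: "0 \<le> weight j x"
  unfolding weight_def using expo_pos total_pos by (simp add: less_imp_le)

lemma weight_sum: "(\<Sum>j\<in>{1..n}. weight j x) = 1"
  unfolding weight_def using total_pos[of x] by (simp add: total_def flip: sum_divide_distrib)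

lemma dir_form_le_smax:
  assumes "j \<in> {1..n}"
  shows "dir_form (\<phi> j) x \<le> smax x"
proof -
  have "expo j x \<le> total x" unfolding total_def
    using assms by (intro member_le_sum) (auto simp: expo_pos less_imp_le)
  then have "ln (expo j x) \<le> ln (total x)" using expo_pos total_pos by simp
  then have "dir_form (\<phi> j) x / \<delta> \<le> ln (total x)" by (simp add: expo_def)
  then show ?thesis using \<delta> by (simp add: smax_def divide_le_eq mult.commute)
qed

lemma smax_le:
  assumes "\<And>i. i \<in> {1..n} \<Longrightarrow> dir_form (\<phi> i) x \<le> m"
  shows "smax x \<le> m + \<delta> * ln (real n)"
proof -
  have "expo i x \<le> exp (m / \<delta>)" if "i \<in> {1..n}" for i
    using assms[OF that] \<delta> by (simp add: expo_def divide_right_mono)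
  then have "total x \<le> (\<Sum>i\<in>{1..n}. exp (m / \<delta>))" unfolding total_def by (rule sum_mono)
  also have "\<dots> = real n * exp (m / \<delta>)" by simp
  finally have "ln (total x) \<le> ln (real n * exp (m / \<delta>))" using total_pos[of x] n by simp
  also have "\<dots> = ln (real n) + m / \<delta>" using n by (simp add: ln_mult)
  finally have "\<delta> * ln (total x) \<le> \<delta> * (ln (real n) + m / \<delta>)" using \<delta> by simp
  then show ?thesis using \<delta> by (simp add: smax_def algebra_simps)
qed

lemma expo_derivative: "(expo j has_derivative (\<lambda>h. expo j x * (dir_form (\<phi> j) h / \<delta>))) (at x)"
  unfolding expo_def[abs_def] using \<delta>
  by (auto intro!: derivative_eq_intros dir_form_derivative)

lemma total_derivative: "(total has_derivative (\<lambda>h. \<Sum>j\<in>{1..n}. expo j x * (dir_form (\<phi> j) h / \<delta>))) (at x)"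
  unfolding total_def[abs_def] by (intro has_derivative_sum expo_derivative)

lemma smax_derivative: "(smax has_derivative (\<lambda>h. \<Sum>j\<in>{1..n}. weight j x * dir_form (\<phi> j) h)) (at x)"
proof -
  have "((\<lambda>x. \<delta> * ln (total x)) has_derivative
      (\<lambda>h. \<delta> * ((\<Sum>j\<in>{1..n}. expo j x * (dir_form (\<phi> j) h / \<delta>)) * inverse (total x)))) (at x)"
    by (intro has_derivative_mult_right has_derivative_ln total_derivative total_pos)
  moreover have "\<delta> * ((\<Sum>j\<in>{1..n}. expo j x * (dir_form (\<phi> j) h / \<delta>)) * inverse (total x))
      = (\<Sum>j\<in>{1..n}. weight j x * dir_form (\<phi> j) h)" for h
    unfolding sum_distrib_left sum_distrib_right
    using \<delta> total_pos[of x] by (intro sum.cong refl) (simp add: weight_def field_simps)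
  ultimately show ?thesis by (simp add: smax_def[abs_def])
qed

lemma weight_derivative:
  "(weight j has_derivative (\<lambda>h. weight j x * (dir_form (\<phi> j) h - (\<Sum>i\<in>{1..n}. weight i x * dir_form (\<phi> i) h)) / \<delta>)) (at x)"
proof -
  have t: "total x \<noteq> 0" using total_pos[of x] by simp
  have "((\<lambda>x. expo j x / total x) has_derivative
      (\<lambda>h. (expo j x * (dir_form (\<phi> j) h / \<delta>) * total x - expo j x * (\<Sum>i\<in>{1..n}. expo i x * (dir_form (\<phi> i) h / \<delta>))) / (total x * total x))) (at x)"
    by (rule has_derivative_divide'[OF expo_derivative total_derivative t])
  moreover have "(expo j x * (dir_form (\<phi> j) h / \<delta>) * total x - expo j x * (\<Sum>i\<in>{1..n}. expo i x * (dir_form (\<phi> i) h / \<delta>))) / (total x * total x)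
      = weight j x * (dir_form (\<phi> j) h - (\<Sum>i\<in>{1..n}. weight i x * dir_form (\<phi> i) h)) / \<delta>" for h
  proof -
    define s where "s = (\<Sum>i\<in>{1..n}. expo i x * dir_form (\<phi> i) h)"
    have 1: "(\<Sum>i\<in>{1..n}. expo i x * (dir_form (\<phi> i) h / \<delta>)) = s / \<delta>"
      by (simp add: s_def sum_divide_distrib)
    have 2: "(\<Sum>i\<in>{1..n}. weight i x * dir_form (\<phi> i) h) = s / total x"
      by (simp add: s_def weight_def sum_divide_distrib)
    show ?thesis unfolding 1 2 unfolding weight_def using \<delta> t by (simp add: field_simps)
  qed
  ultimately show ?thesis by (simp add: weight_def[abs_def])
qed

text \<open>The partial derivatives of the weights are polynomials in the weights.\<close>

lemma C_k_weight: "C_k k (\<lambda>x. complex_of_real (weight j x))"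
proof (induction k arbitrary: j)
  case 0
  have "isCont (weight j) x" for x using has_derivative_continuous[OF weight_derivative] .
  then have "continuous_on UNIV (weight j)" by (intro continuous_at_imp_continuous_on ballI)
  then show ?case by (simp add: continuous_on_of_real)
next
  case (Suc k)
  have d: "((\<lambda>x. complex_of_real (weight j x)) has_derivative
      (\<lambda>h. complex_of_real (weight j x * (dir_form (\<phi> j) h - (\<Sum>i\<in>{1..n}. weight i x * dir_form (\<phi> i) h)) / \<delta>))) (at x)" for x
    by (rule has_derivative_of_real[OF weight_derivative])
  have pd: "partial_deriv l (\<lambda>x. complex_of_real (weight j x))
      = (\<lambda>x. complex_of_real (weight j x) * (complex_of_real (dir_form (\<phi> j) (axis l 1) / \<delta>)
          + complex_of_real (- 1 / \<delta>) * (\<Sum>i\<in>{1..n}. complex_of_real (weight i x) * complex_of_real (dir_form (\<phi> i) (axis l 1)))))" for l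
    using \<delta> by (intro ext) (simp add: partial_deriv_eq[OF d] field_simps)
  show ?case unfolding C_k.simps(2)
  proof (intro conjI allI)
    show "(\<lambda>x. complex_of_real (weight j x)) differentiable (at x)" for x using d by (auto simp: differentiable_def)
    show "C_k k (partial_deriv l (\<lambda>x. complex_of_real (weight j x)))" for l
      unfolding pd by (intro C_k_mult C_k_add C_k_sum C_k_const Suc.IH)
  qed
qed

lemma smax_partial:
  "partial_deriv l (\<lambda>x. complex_of_real (smax x)) x = (\<Sum>j\<in>{1..n}. complex_of_real (weight j x) * complex_of_real (dir_form (\<phi> j) (axis l 1)))"
  by (simp add: partial_deriv_eq[OF has_derivative_of_real[OF smax_derivative]])

lemma continuous_smax: "continuous_on S smax"
  by (intro continuous_at_imp_continuous_on ballI has_derivative_continuous[OF smax_derivative])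

lemma C_k_smax: "C_k k (\<lambda>x. complex_of_real (smax x))"
proof (cases k)
  case 0
  then show ?thesis by (simp add: continuous_on_of_real continuous_smax)
next
  case (Suc m)
  have pd: "partial_deriv l (\<lambda>x. complex_of_real (smax x))
    = (\<lambda>x. \<Sum>j\<in>{1..n}. complex_of_real (weight j x) * complex_of_real (dir_form (\<phi> j) (axis l 1)))" for l
    by (rule ext) (rule smax_partial)
  show ?thesis unfolding Suc C_k.simps(2)
  proof (intro conjI allI)
    show "(\<lambda>x. complex_of_real (smax x)) differentiable (at x)" for x
      using has_derivative_of_real[OF smax_derivative] by (auto simp: differentiable_def)
    show "C_k m (partial_deriv l (\<lambda>x. complex_of_real (smax x)))" for l
      unfolding pd by (intro C_k_sum C_k_mult C_k_const C_k_weight)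
  qed
qed

text \<open>With the exact maximum in place of \<open>smax\<close> this map would preserve the distance to the boundary; the
  coefficients \<open>\<beta>\<close> and \<open>\<gamma>\<close> are determined by that.\<close>

definition \<Phi> :: "real^3 \<Rightarrow> real^3" where
  "\<Phi> x = (\<kappa> * x $ 1) *\<^sub>R axis 1 1 + (\<kappa> * x $ 2) *\<^sub>R axis 2 1 + (\<beta> * x $ 3 - \<gamma> * smax x) *\<^sub>R axis 3 1"

definition \<Phi>inv :: "real^3 \<Rightarrow> real^3" where
  "\<Phi>inv y = (y $ 1 / \<kappa>) *\<^sub>R axis 1 1 + (y $ 2 / \<kappa>) *\<^sub>R axis 2 1
     + ((y $ 3 + \<gamma> * smax (y /\<^sub>R \<kappa>)) / \<beta>) *\<^sub>R axis 3 1"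

lemma \<Phi>_components: "\<Phi> x $ 1 = \<kappa> * x $ 1" "\<Phi> x $ 2 = \<kappa> * x $ 2" "\<Phi> x $ 3 = \<beta> * x $ 3 - \<gamma> * smax x"
  by (simp_all add: \<Phi>_def axis_def)

lemma \<Phi>inv_components: "\<Phi>inv y $ 1 = y $ 1 / \<kappa>" "\<Phi>inv y $ 2 = y $ 2 / \<kappa>"
    "\<Phi>inv y $ 3 = (y $ 3 + \<gamma> * smax (y /\<^sub>R \<kappa>)) / \<beta>"
  by (simp_all add: \<Phi>inv_def axis_def)

lemma smax_cong: "x $ 1 = y $ 1 \<Longrightarrow> x $ 2 = y $ 2 \<Longrightarrow> smax x = smax y"
  by (simp add: smax_def total_def expo_def dir_form_def)

lemma \<Phi>inv_\<Phi>: "\<Phi>inv (\<Phi> x) = x"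
proof -
  have "smax (\<Phi> x /\<^sub>R \<kappa>) = smax x"
    using consts_pos by (intro smax_cong) (auto simp: \<Phi>_components)
  then show ?thesis
    using consts_pos by (simp add: vec_eq_iff forall_3 \<Phi>inv_components \<Phi>_components)
qed

lemma \<Phi>_\<Phi>inv: "\<Phi> (\<Phi>inv y) = y"
proof -
  have "smax (\<Phi>inv y) = smax (y /\<^sub>R \<kappa>)"
    using consts_pos by (intro smax_cong) (auto simp: \<Phi>inv_components divide_inverse mult.commute)
  then show ?thesis
    using consts_pos by (simp add: vec_eq_iff forall_3 \<Phi>inv_components \<Phi>_components)
qed

lemma continuous_\<Phi>inv: "continuous_on S \<Phi>inv"
proof -
  have "continuous_on S (\<lambda>y. smax (y /\<^sub>R \<kappa>))"
    by (rule continuous_on_compose2[OF continuous_smax[of UNIV]]) (auto intro!: continuous_intros)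
  then show ?thesis unfolding \<Phi>inv_def[abs_def] using consts_pos by (intro continuous_intros) auto
qed

lemma face_dist_\<Phi>:
  "face_dist \<theta> (\<phi> j) x = face_dist \<sigma> (\<phi> j) (\<Phi> x) + \<gamma> * sin \<sigma> * (smax x - dir_form (\<phi> j) x)"
proof -
  have 1: "dir_form (\<phi> j) (\<Phi> x) = \<kappa> * dir_form (\<phi> j) x"
    by (simp add: dir_form_def \<Phi>_components algebra_simps)
  have 2: "\<beta> * sin \<sigma> = sin \<theta>" using trig_pos by (simp add: \<beta>_def)
  have "\<gamma> * sin \<sigma> = ((cos \<theta>)\<^sup>2 - (cos \<sigma>)\<^sup>2) / cos \<theta>" using trig_pos by (simp add: \<gamma>_def)
  then have 3: "\<gamma> * sin \<sigma> + cos \<sigma> * \<kappa> = cos \<theta>" using trig_pos by (simp add: \<kappa>_def field_simps power2_eq_square)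
  have "face_dist \<sigma> (\<phi> j) (\<Phi> x) + \<gamma> * sin \<sigma> * (smax x - dir_form (\<phi> j) x)
      = x $ 3 * (\<beta> * sin \<sigma>) - (\<gamma> * sin \<sigma> + cos \<sigma> * \<kappa>) * dir_form (\<phi> j) x"
    by (simp add: face_dist_def 1 \<Phi>_components algebra_simps)
  then show ?thesis unfolding 2 3 by (simp add: face_dist_def)
qed

text \<open>\<open>\<Phi>\<close> may underestimate the distance to the boundary, but by no more than \<open>\<gamma> sin \<sigma> \<delta> ln n\<close>; the room for
  this is expressed by moving \<open>\<Phi> x\<close> upwards by \<open>s\<close> inside the layer.\<close>

lemma \<Phi>_preimage_layer:
  assumes y: "\<Phi> x \<in> polyhedral_layer n \<phi> \<sigma>" and s: "\<Phi> x + s *\<^sub>R axis 3 1 \<in> polyhedral_layer n \<phi> \<sigma>"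
    and small: "\<gamma> * sin \<sigma> * (\<delta> * ln (real n)) \<le> s * sin \<sigma>"
  shows "x \<in> polyhedral_layer n \<phi> \<theta>"
proof -
  have g: "0 \<le> \<gamma> * sin \<sigma>" using consts_pos trig_pos by simp
  have pos: "0 < face_dist \<theta> (\<phi> j) x" if j: "j \<in> {1..n}" for j
  proof -
    have "0 < face_dist \<sigma> (\<phi> j) (\<Phi> x)" using y j by (simp add: polyhedral_layer_eq[OF n])
    moreover have "0 \<le> \<gamma> * sin \<sigma> * (smax x - dir_form (\<phi> j) x)"
      using dir_form_le_smax[OF j, of x] by (intro mult_nonneg_nonneg[OF g]) simp
    ultimately show ?thesis unfolding face_dist_\<Phi> by linarith
  qed
  obtain j0 where j0: "j0 \<in> {1..n}" "face_dist \<sigma> (\<phi> j0) (\<Phi> x + s *\<^sub>R axis 3 1) < 1"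
    using s by (auto simp: polyhedral_layer_eq[OF n])
  have "face_dist \<sigma> (\<phi> j0) (\<Phi> x + s *\<^sub>R axis 3 1) = face_dist \<sigma> (\<phi> j0) (\<Phi> x) + s * sin \<sigma>"
    by (simp add: face_dist_def dir_form_def axis_def algebra_simps)
  with j0(2) have d0: "face_dist \<sigma> (\<phi> j0) (\<Phi> x) < 1 - s * sin \<sigma>" by linarith
  have "(\<lambda>j. dir_form (\<phi> j) x) ` {1..n} \<noteq> {}" using n by auto
  then have "Max ((\<lambda>j. dir_form (\<phi> j) x) ` {1..n}) \<in> (\<lambda>j. dir_form (\<phi> j) x) ` {1..n}" by (intro Max_in) auto
  then obtain m where m: "m \<in> {1..n}" "Max ((\<lambda>j. dir_form (\<phi> j) x) ` {1..n}) = dir_form (\<phi> m) x" by auto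
  have max: "dir_form (\<phi> i) x \<le> dir_form (\<phi> m) x" if "i \<in> {1..n}" for i
    using that by (simp flip: m(2))
  have "face_dist \<sigma> (\<phi> m) (\<Phi> x) \<le> face_dist \<sigma> (\<phi> j0) (\<Phi> x)"
  proof -
    have "dir_form (\<phi> j) (\<Phi> x) = \<kappa> * dir_form (\<phi> j) x" for j
      by (simp add: dir_form_def \<Phi>_components algebra_simps)
    then show ?thesis using max[OF j0(1)] consts_pos trig_pos by (simp add: face_dist_def)
  qed
  moreover have "\<gamma> * sin \<sigma> * (smax x - dir_form (\<phi> m) x) \<le> \<gamma> * sin \<sigma> * (\<delta> * ln (real n))"
    using smax_le[OF max] g by (intro mult_left_mono) auto
  ultimately have "face_dist \<theta> (\<phi> m) x < 1" unfolding face_dist_\<Phi> using d0 small by linarith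
  with m(1) pos show ?thesis by (auto simp: polyhedral_layer_eq[OF n])
qed

lemma \<Phi>_component_eqs:
  "(\<lambda>x. complex_of_real (\<Phi> x $ 1)) = (\<lambda>x. complex_of_real \<kappa> * complex_of_real (x $ 1))"
  "(\<lambda>x. complex_of_real (\<Phi> x $ 2)) = (\<lambda>x. complex_of_real \<kappa> * complex_of_real (x $ 2))"
  "(\<lambda>x. complex_of_real (\<Phi> x $ 3)) = (\<lambda>x. complex_of_real \<beta> * complex_of_real (x $ 3) + complex_of_real (- \<gamma>) * complex_of_real (smax x))"
  by (simp_all add: \<Phi>_components)

lemma C_k_\<Phi>: "C_k k (\<lambda>x. complex_of_real (\<Phi> x $ l))"
proof -
  have "l = 1 \<or> l = 2 \<or> l = 3" by (rule exhaust_3)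
  then show ?thesis
    by (elim disjE; simp only: \<Phi>_component_eqs) (intro C_k_add C_k_scale C_k_coordinate C_k_smax)+
qed

lemma \<Phi>_derivative:
  "(\<Phi> has_derivative (\<lambda>h. (\<kappa> * h $ 1) *\<^sub>R axis 1 1 + (\<kappa> * h $ 2) *\<^sub>R axis 2 1
     + (\<beta> * h $ 3 - \<gamma> * (\<Sum>j\<in>{1..n}. weight j x * dir_form (\<phi> j) h)) *\<^sub>R axis 3 1)) (at x within S)"
proof -
  have nth: "((\<lambda>x::real^3. x $ i) has_derivative (\<lambda>h. h $ i)) (at x)" for i
    by (intro bounded_linear_imp_has_derivative bounded_linear_vec_nth)
  have "(\<Phi> has_derivative (\<lambda>h. (\<kappa> * h $ 1) *\<^sub>R axis 1 1 + (\<kappa> * h $ 2) *\<^sub>R axis 2 1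
     + (\<beta> * h $ 3 - \<gamma> * (\<Sum>j\<in>{1..n}. weight j x * dir_form (\<phi> j) h)) *\<^sub>R axis 3 1)) (at x)"
    unfolding \<Phi>_def[abs_def]
    by (intro has_derivative_add has_derivative_scaleR_left has_derivative_diff has_derivative_mult_right nth smax_derivative)
  then show ?thesis by (rule has_derivative_at_withinI)
qed

definition "grad1 x = (\<Sum>j\<in>{1..n}. weight j x * cos (\<phi> j))"
definition "grad2 x = (\<Sum>j\<in>{1..n}. weight j x * sin (\<phi> j))"

lemma grad_le: "(grad1 x)\<^sup>2 + (grad2 x)\<^sup>2 \<le> 1"
proof -
  let ?z = "\<Sum>j\<in>{1..n}. complex_of_real (weight j x) * cis (\<phi> j)"
  have "cmod ?z \<le> (\<Sum>j\<in>{1..n}. cmod (complex_of_real (weight j x) * cis (\<phi> j)))" by (rule norm_sum)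
  also have "\<dots> = 1" using weight_nonneg weight_sum by (simp add: norm_mult)
  finally have "(cmod ?z)\<^sup>2 \<le> 1" by (simp add: power_le_one)
  moreover have "(cmod ?z)\<^sup>2 = (Re ?z)\<^sup>2 + (Im ?z)\<^sup>2" by (rule cmod_power2)
  ultimately show ?thesis by (simp add: grad1_def grad2_def Re_sum Im_sum)
qed

lemma smax_partials:
  "partial_deriv 1 (\<lambda>x. complex_of_real (smax x)) x = complex_of_real (grad1 x)"
  "partial_deriv 2 (\<lambda>x. complex_of_real (smax x)) x = complex_of_real (grad2 x)"
  "partial_deriv 3 (\<lambda>x. complex_of_real (smax x)) x = 0"
  unfolding smax_partial by (simp_all add: grad1_def grad2_def dir_form_def axis_def)

lemma det_\<Phi>:
  "det (matrix (\<lambda>h::real^3. (\<kappa> * h $ 1) *\<^sub>R axis 1 1 + (\<kappa> * h $ 2) *\<^sub>R axis 2 1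
     + (\<beta> * h $ 3 - \<gamma> * (\<Sum>j\<in>{1..n}. weight j x * dir_form (\<phi> j) h)) *\<^sub>R (axis 3 1 :: real^3))) = \<kappa> * \<kappa> * \<beta>"
  by (simp add: det_3 matrix_def axis_def dir_form_def)

text \<open>The substitution rule for several variables is about vector-valued functions, hence the detour through
  the one-dimensional space \<open>real^1\<close>.\<close>

lemma change_of_variables:
  fixes g :: "real^3 \<Rightarrow> real"
  assumes "integrable lebesgue g" "integrable lebesgue (\<lambda>x. g (\<Phi> x))"
  shows "(LINT x|lebesgue. g (\<Phi> x)) = (LINT x|lebesgue. g x) / (\<kappa> * \<kappa> * \<beta>)"
proof -
  let ?D = "\<lambda>x h::real^3. (\<kappa> * h $ 1) *\<^sub>R axis 1 1 + (\<kappa> * h $ 2) *\<^sub>R axis 2 1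
     + (\<beta> * h $ 3 - \<gamma> * (\<Sum>j\<in>{1..n}. weight j x * dir_form (\<phi> j) h)) *\<^sub>R (axis 3 1 :: real^3)"
  let ?v = "\<lambda>t::real. t *\<^sub>R (axis 1 1 :: real^1)"
  have bl: "bounded_linear ?v" by (rule bounded_linear_scaleR_left)
  have c: "0 < \<kappa> * \<kappa> * \<beta>" using consts_pos by simp
  have surj: "\<Phi> ` UNIV = UNIV" using \<Phi>_\<Phi>inv by (metis surjI)
  have inj: "inj_on \<Phi> UNIV" using \<Phi>inv_\<Phi> by (metis injI)
  have abs: "(\<lambda>x. ?v (g x)) absolutely_integrable_on UNIV"
    using integrable_bounded_linear[OF bl assms(1)] by (simp add: set_integrable_def)
  have "integral (\<Phi> ` UNIV) (\<lambda>x. ?v (g x)) = integral UNIV (\<lambda>x. \<bar>det (matrix (?D x))\<bar> *\<^sub>R ?v (g (\<Phi> x)))"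
    by (rule integral_change_of_variables[OF _ \<Phi>_derivative inj]) (use abs surj in auto)
  then have eq: "integral UNIV (\<lambda>x. ?v (g x)) = integral UNIV (\<lambda>x. (\<kappa> * \<kappa> * \<beta>) *\<^sub>R ?v (g (\<Phi> x)))"
    unfolding surj det_\<Phi> using c by simp
  have lin: "integral UNIV (\<lambda>x. ?v (h x)) = ?v (LINT x|lebesgue. h x)" if "integrable lebesgue h" for h
    using integral_lebesgue[OF integrable_bounded_linear[OF bl that]] integral_bounded_linear[OF bl that] by simp
  have "?v (LINT x|lebesgue. g x) = (\<kappa> * \<kappa> * \<beta>) *\<^sub>R ?v (LINT x|lebesgue. g (\<Phi> x))"
    using eq lin[OF assms(1)] lin[OF assms(2)] by (simp only: integral_cmul)
  then have "(LINT x|lebesgue. g x) = (\<kappa> * \<kappa> * \<beta>) * (LINT x|lebesgue. g (\<Phi> x))"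
    by (simp add: vec_eq_iff axis_def)
  moreover have "\<kappa> * \<kappa> * \<beta> \<noteq> 0" using c by linarith
  ultimately show ?thesis by (metis nonzero_mult_div_cancel_left)
qed

text \<open>Here \<open>(p, q)\<close> is the gradient of the smoothed maximum.  With \<open>\<tau> = cot \<sigma>\<close> the difference of the two sides is
  \<open>(1 - \<kappa>\<^sup>2)\<close> times the squared length of \<open>(a, b) + \<tau> c (p, q)\<close>, plus multiples of \<open>1 - p\<^sup>2 - q\<^sup>2\<close> with
  nonnegative coefficients.\<close>

lemma contraction_real:
  fixes a b c p q :: real
  assumes "p\<^sup>2 + q\<^sup>2 \<le> 1"
  shows "(\<kappa> * a - \<gamma> * p * c)\<^sup>2 + (\<kappa> * b - \<gamma> * q * c)\<^sup>2 + (\<beta> * c)\<^sup>2 \<le> a\<^sup>2 + b\<^sup>2 + c\<^sup>2"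
proof -
  define \<tau> where "\<tau> = cos \<sigma> / sin \<sigma>"
  have 1: "\<kappa> * \<gamma> = (1 - \<kappa>\<^sup>2) * \<tau>"
    using trig_pos by (simp add: \<kappa>_def \<gamma>_def \<tau>_def field_simps power2_eq_square)
  have 2: "1 - \<beta>\<^sup>2 - \<gamma>\<^sup>2 = (1 - \<kappa>\<^sup>2) * \<tau>\<^sup>2"
  proof -
    have s: "(sin \<theta>)\<^sup>2 = 1 - (cos \<theta>)\<^sup>2" "(sin \<sigma>)\<^sup>2 = 1 - (cos \<sigma>)\<^sup>2" by (simp_all add: sin_squared_eq)
    have "(1 - \<beta>\<^sup>2 - \<gamma>\<^sup>2) * ((cos \<theta>)\<^sup>2 * (sin \<sigma>)\<^sup>2)
        = (cos \<theta>)\<^sup>2 * (sin \<sigma>)\<^sup>2 - (cos \<theta>)\<^sup>2 * (sin \<theta>)\<^sup>2 - ((cos \<theta>)\<^sup>2 - (cos \<sigma>)\<^sup>2)\<^sup>2"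
      using trig_pos by (simp add: \<beta>_def \<gamma>_def power_divide power_mult_distrib field_simps)
    also have "\<dots> = ((cos \<theta>)\<^sup>2 - (cos \<sigma>)\<^sup>2) * (cos \<sigma>)\<^sup>2" unfolding s by (simp add: power2_eq_square algebra_simps)
    also have "\<dots> = (1 - \<kappa>\<^sup>2) * \<tau>\<^sup>2 * ((cos \<theta>)\<^sup>2 * (sin \<sigma>)\<^sup>2)"
      using trig_pos by (simp add: \<kappa>_def \<tau>_def power_divide field_simps)
    finally show ?thesis using trig_pos by simp
  qed
  have "a\<^sup>2 + b\<^sup>2 + c\<^sup>2 - ((\<kappa> * a - \<gamma> * p * c)\<^sup>2 + (\<kappa> * b - \<gamma> * q * c)\<^sup>2 + (\<beta> * c)\<^sup>2)
      = (1 - \<kappa>\<^sup>2) * (a\<^sup>2 + b\<^sup>2) + 2 * (\<kappa> * \<gamma>) * c * (p * a + q * b) + c\<^sup>2 * (1 - \<beta>\<^sup>2 - \<gamma>\<^sup>2)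
        + \<gamma>\<^sup>2 * c\<^sup>2 * (1 - (p\<^sup>2 + q\<^sup>2))"
    by (simp add: power2_eq_square algebra_simps)
  also have "\<dots> = (1 - \<kappa>\<^sup>2) * ((a + \<tau> * p * c)\<^sup>2 + (b + \<tau> * q * c)\<^sup>2 + \<tau>\<^sup>2 * c\<^sup>2 * (1 - (p\<^sup>2 + q\<^sup>2)))
        + \<gamma>\<^sup>2 * c\<^sup>2 * (1 - (p\<^sup>2 + q\<^sup>2))"
    unfolding 1 2 by (simp add: power2_eq_square algebra_simps)
  also have "\<dots> \<ge> 0"
  proof -
    have "0 \<le> 1 - \<kappa>\<^sup>2" using consts_pos by (simp add: power_le_one)
    then show ?thesis using assms by (intro add_nonneg_nonneg mult_nonneg_nonneg) auto
  qed
  finally show ?thesis by linarith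
qed

lemma contraction:
  fixes a b c :: complex and p q :: real
  assumes "p\<^sup>2 + q\<^sup>2 \<le> 1"
  shows "(cmod (\<kappa> * a - \<gamma> * p * c))\<^sup>2 + (cmod (\<kappa> * b - \<gamma> * q * c))\<^sup>2 + (cmod (\<beta> * c))\<^sup>2
    \<le> (cmod a)\<^sup>2 + (cmod b)\<^sup>2 + (cmod c)\<^sup>2"
  using contraction_real[OF assms, of "Re a" "Re c" "Re b"] contraction_real[OF assms, of "Im a" "Im c" "Im b"]
  unfolding cmod_power2 by simp

lemma \<Phi>_test_function:
  assumes f: "f \<in> test_functions UNIV" and K: "compact K" "\<And>x. x \<notin> K \<Longrightarrow> f x = 0"
    and sub: "\<And>x. \<Phi> x \<in> K \<Longrightarrow> x \<in> \<Omega>"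
  shows "(\<lambda>x. f (\<Phi> x)) \<in> test_functions \<Omega>"
proof (rule test_functionsI)
  show "C_k k (\<lambda>x. f (\<Phi> x))" for k
    by (rule C_k_comp[OF test_functions_C_k[OF f] C_k_\<Phi>])
  show "compact (\<Phi>inv ` K)" by (intro compact_continuous_image continuous_\<Phi>inv K)
  show "\<Phi>inv ` K \<subseteq> \<Omega>" using sub \<Phi>_\<Phi>inv by (metis image_subsetI)
  show "f (\<Phi> x) = 0" if "x \<notin> \<Phi>inv ` K" for x
    using that \<Phi>inv_\<Phi>[of x] by (intro K(2)) (metis imageI)
qed

lemma \<Phi>_test_UNIV:
  assumes "f \<in> test_functions UNIV"
  shows "(\<lambda>x. f (\<Phi> x)) \<in> test_functions UNIV"
proof -
  obtain K where K: "compact K" "\<forall>x. x \<notin> K \<longrightarrow> f x = 0" using test_functions_support[OF assms] by blast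
  show ?thesis by (rule \<Phi>_test_function[OF assms K(1)]) (use K(2) in simp_all)
qed

lemma norm_\<Phi>:
  assumes "f \<in> test_functions UNIV"
  shows "(LINT x|lebesgue. (cmod (f (\<Phi> x)))\<^sup>2) = (LINT x|lebesgue. (cmod (f x))\<^sup>2) / (\<kappa> * \<kappa> * \<beta>)"
  by (rule change_of_variables) (intro test_square_integrable assms \<Phi>_test_UNIV)+

lemma \<Phi>_partials:
  assumes f: "f \<in> test_functions UNIV"
  shows "partial_deriv 1 (\<lambda>x. f (\<Phi> x)) x = \<kappa> * partial_deriv 1 f (\<Phi> x) - \<gamma> * grad1 x * partial_deriv 3 f (\<Phi> x)"
    and "partial_deriv 2 (\<lambda>x. f (\<Phi> x)) x = \<kappa> * partial_deriv 2 f (\<Phi> x) - \<gamma> * grad2 x * partial_deriv 3 f (\<Phi> x)"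
    and "partial_deriv 3 (\<lambda>x. f (\<Phi> x)) x = \<beta> * partial_deriv 3 f (\<Phi> x)"
proof -
  have d\<Phi>: "\<Phi> differentiable (at x)" using \<Phi>_derivative[of x UNIV] by (auto simp: differentiable_def)
  have co: "((\<lambda>x::real^3. complex_of_real (x $ i)) has_derivative (\<lambda>h. complex_of_real (h $ i))) (at x)" for i
    by (intro has_derivative_of_real bounded_linear_imp_has_derivative bounded_linear_vec_nth)
  have sm: "(smax has_derivative (\<lambda>h. \<Sum>j\<in>{1..n}. weight j x * dir_form (\<phi> j) h)) (at x)" by (rule smax_derivative)
  have p12: "partial_deriv i (\<lambda>x::real^3. complex_of_real \<kappa> * complex_of_real (x $ l)) x = complex_of_real \<kappa> * complex_of_real (axis i 1 $ l)" for i l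
    by (rule partial_deriv_eq[OF has_derivative_mult_right[OF co]])
  have p3: "partial_deriv i (\<lambda>x. complex_of_real \<beta> * complex_of_real (x $ 3) + complex_of_real (- \<gamma>) * complex_of_real (smax x)) x
      = complex_of_real \<beta> * complex_of_real (axis i 1 $ 3) + complex_of_real (- \<gamma>) * partial_deriv i (\<lambda>x. complex_of_real (smax x)) x" for i
    unfolding partial_deriv_eq[OF has_derivative_add[OF has_derivative_mult_right[OF co] has_derivative_mult_right[OF has_derivative_of_real[OF sm]]]]
      partial_deriv_eq[OF has_derivative_of_real[OF sm]] ..
  have chain: "partial_deriv i (\<lambda>x. f (\<Phi> x)) x
      = partial_deriv 1 f (\<Phi> x) * (complex_of_real \<kappa> * complex_of_real (axis i 1 $ 1))
      + partial_deriv 2 f (\<Phi> x) * (complex_of_real \<kappa> * complex_of_real (axis i 1 $ 2))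
      + partial_deriv 3 f (\<Phi> x) * (complex_of_real \<beta> * complex_of_real (axis i 1 $ 3)
          + complex_of_real (- \<gamma>) * partial_deriv i (\<lambda>x. complex_of_real (smax x)) x)" for i
    unfolding partial_deriv_comp[where \<Phi>=\<Phi>, OF test_functions_differentiable[OF f] d\<Phi>] sum_3 \<Phi>_component_eqs p12 p3 ..
  show "partial_deriv 1 (\<lambda>x. f (\<Phi> x)) x = \<kappa> * partial_deriv 1 f (\<Phi> x) - \<gamma> * grad1 x * partial_deriv 3 f (\<Phi> x)"
    and "partial_deriv 2 (\<lambda>x. f (\<Phi> x)) x = \<kappa> * partial_deriv 2 f (\<Phi> x) - \<gamma> * grad2 x * partial_deriv 3 f (\<Phi> x)"
    and "partial_deriv 3 (\<lambda>x. f (\<Phi> x)) x = \<beta> * partial_deriv 3 f (\<Phi> x)"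
    unfolding chain smax_partials by (simp_all add: axis_def algebra_simps)
qed

lemma energy_\<Phi>:
  assumes f: "f \<in> test_functions UNIV"
  shows "(\<Sum>i\<in>UNIV. LINT x|lebesgue. (cmod (partial_deriv i (\<lambda>x. f (\<Phi> x)) x))\<^sup>2)
    \<le> (\<Sum>i\<in>UNIV. LINT x|lebesgue. (cmod (partial_deriv i f x))\<^sup>2) / (\<kappa> * \<kappa> * \<beta>)"
proof -
  let ?F = "\<lambda>x. f (\<Phi> x)"
  have iF: "integrable lebesgue (\<lambda>x. (cmod (partial_deriv i ?F x))\<^sup>2)" for i
    by (intro test_square_integrable test_functions_partial \<Phi>_test_UNIV f)
  have pf: "partial_deriv i f \<in> test_functions UNIV" for i by (rule test_functions_partial[OF f])
  have ip: "integrable lebesgue (\<lambda>x. (cmod (partial_deriv i f (\<Phi> x)))\<^sup>2)" for i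
    by (rule test_square_integrable[OF \<Phi>_test_UNIV[OF pf]])
  have "(\<Sum>i\<in>UNIV. LINT x|lebesgue. (cmod (partial_deriv i ?F x))\<^sup>2)
      = (LINT x|lebesgue. (\<Sum>i\<in>UNIV. (cmod (partial_deriv i ?F x))\<^sup>2))"
    by (rule Bochner_Integration.integral_sum[symmetric]) (rule iF)
  also have "\<dots> \<le> (LINT x|lebesgue. (\<Sum>i\<in>UNIV. (cmod (partial_deriv i f (\<Phi> x)))\<^sup>2))"
  proof (rule integral_mono)
    show "integrable lebesgue (\<lambda>x. \<Sum>i\<in>UNIV. (cmod (partial_deriv i ?F x))\<^sup>2)"
      "integrable lebesgue (\<lambda>x. \<Sum>i\<in>UNIV. (cmod (partial_deriv i f (\<Phi> x)))\<^sup>2)"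
      by (intro Bochner_Integration.integrable_sum iF ip)+
    show "(\<Sum>i\<in>UNIV. (cmod (partial_deriv i ?F x))\<^sup>2) \<le> (\<Sum>i\<in>UNIV. (cmod (partial_deriv i f (\<Phi> x)))\<^sup>2)" for x
      unfolding sum_3 \<Phi>_partials[OF f] by (rule contraction[OF grad_le])
  qed
  also have "\<dots> = (\<Sum>i\<in>UNIV. LINT x|lebesgue. (cmod (partial_deriv i f (\<Phi> x)))\<^sup>2)"
    by (rule Bochner_Integration.integral_sum) (rule ip)
  also have "\<dots> = (\<Sum>i\<in>UNIV. LINT x|lebesgue. (cmod (partial_deriv i f x))\<^sup>2) / (\<kappa> * \<kappa> * \<beta>)"
    unfolding sum_divide_distrib by (intro sum.cong refl norm_\<Phi> pf)
  finally show ?thesis .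
qed

end

section \<open>Monotonicity of the eigenvalues\<close>

text \<open>The supports lie in a compact part of the layer, so there is a common \<open>s > 0\<close> by which they can be moved
  upwards inside the layer; \<open>\<delta>\<close> is then chosen so that the error of the smoothed maximum is covered
  by \<open>s\<close>.\<close>

lemma layer_transport:
  fixes g :: "nat \<Rightarrow> real^3 \<Rightarrow> complex"
  assumes n: "1 \<le> n" and angles: "0 < \<theta>" "\<theta> < \<sigma>" "\<sigma> < pi / 2"
    and g: "\<And>i. i < j \<Longrightarrow> g i \<in> test_functions (polyhedral_layer n \<phi> \<sigma>)"
  obtains \<delta> where "layer_map n \<theta> \<sigma> \<delta>"
    "\<And>i. i < j \<Longrightarrow> (\<lambda>x. g i (layer_map.\<Phi> n \<phi> \<theta> \<sigma> \<delta> x)) \<in> test_functions (polyhedral_layer n \<phi> \<theta>)"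
proof -
  let ?\<Omega> = "polyhedral_layer n \<phi> \<sigma>"
  have "\<forall>i. \<exists>K. i < j \<longrightarrow> compact K \<and> K \<subseteq> ?\<Omega> \<and> (\<forall>x. x \<notin> K \<longrightarrow> g i x = 0)"
    using test_functions_support[OF g] by blast
  then obtain K where K: "\<And>i. i < j \<Longrightarrow> compact (K i)" "\<And>i. i < j \<Longrightarrow> K i \<subseteq> ?\<Omega>"
    "\<And>i x. i < j \<Longrightarrow> x \<notin> K i \<Longrightarrow> g i x = 0" by metis
  have "compact (\<Union>i\<in>{..<j}. K i)" by (intro compact_UN) (use K(1) in auto)
  moreover have "(\<Union>i\<in>{..<j}. K i) \<subseteq> ?\<Omega>" using K(2) by blast
  ultimately obtain e where e: "e > 0" "(\<Union>x\<in>(\<Union>i\<in>{..<j}. K i). ball x e) \<subseteq> ?\<Omega>"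
    using compact_subset_open_imp_ball_epsilon_subset[OF _ open_polyhedral_layer[OF n]] by metis
  define s where "s = e / 2"
  \<comment> \<open>This is \<open>\<gamma>\<close>, which depends only on the angles; \<open>\<delta>\<close> has to be fixed before the map exists.\<close>
  define c where "c = ((cos \<theta>)\<^sup>2 - (cos \<sigma>)\<^sup>2) / (cos \<theta> * sin \<sigma>)"
  define b where "b = \<bar>c\<bar> * ln (real n) + 1"
  define \<delta> where "\<delta> = s / b"
  have s: "s > 0" using e by (simp add: s_def)
  have b: "b > 0" using n by (simp add: b_def add_nonneg_pos)
  have \<delta>: "\<delta> > 0" using s b by (simp add: \<delta>_def)
  interpret layer_map n \<phi> \<theta> \<sigma> \<delta> by (unfold_locales) (use n angles \<delta> in auto)
  have "\<gamma> * (\<delta> * ln (real n)) \<le> b * \<delta>"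
  proof -
    have "\<gamma> = c" by (simp only: \<gamma>_def c_def)
    then have "\<gamma> * ln (real n) \<le> \<bar>c\<bar> * ln (real n)" using n by (intro mult_right_mono) auto
    then have "\<gamma> * ln (real n) \<le> b" by (simp add: b_def)
    then have "(\<gamma> * ln (real n)) * \<delta> \<le> b * \<delta>" using \<delta> by (intro mult_right_mono) auto
    then show ?thesis by (simp add: mult_ac)
  qed
  also have "\<dots> = s" using b by (simp add: \<delta>_def)
  finally have "\<gamma> * (\<delta> * ln (real n)) * sin \<sigma> \<le> s * sin \<sigma>" using trig_pos by simp
  then have small: "\<gamma> * sin \<sigma> * (\<delta> * ln (real n)) \<le> s * sin \<sigma>" by (simp add: mult_ac)
  have "(\<lambda>x. g i (\<Phi> x)) \<in> test_functions (polyhedral_layer n \<phi> \<theta>)" if i: "i < j" for i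
  proof (rule \<Phi>_test_function[OF test_functions_UNIV[OF g[OF i]] K(1)[OF i] K(3)[OF i]])
    fix x assume x: "\<Phi> x \<in> K i"
    show "x \<in> polyhedral_layer n \<phi> \<theta>"
    proof (rule \<Phi>_preimage_layer[OF _ _ small])
      show "\<Phi> x \<in> ?\<Omega>" using x K(2)[OF i] by blast
      have "\<Phi> x + s *\<^sub>R axis 3 1 \<in> ball (\<Phi> x) e" using s e(1) by (simp add: dist_norm norm_axis_1 s_def)
      then show "\<Phi> x + s *\<^sub>R axis 3 1 \<in> ?\<Omega>" using e(2) x i by blast
    qed
  qed
  then show thesis by (rule that[OF layer_map_axioms])
qed

theorem mainTheorem2:
  fixes n k :: nat and \<phi> :: "nat \<Rightarrow> real" and \<theta> \<sigma> :: real
  assumes "n \<ge> 3" and "admissible_directions n \<phi>"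
    and "0 < \<theta>" and "\<theta> < \<sigma>" and "\<sigma> < pi / 2"
    and "at_least_eigenvalues (polyhedral_layer n \<phi> \<theta>) k"
    and "at_least_eigenvalues (polyhedral_layer n \<phi> \<sigma>) k"
  shows "\<forall>j\<in>{1..k}. dirichlet_eigenvalue (polyhedral_layer n \<phi> \<theta>) j
                    \<le> dirichlet_eigenvalue (polyhedral_layer n \<phi> \<sigma>) j"
proof (intro ballI leI notI)
  have n: "1 \<le> n" using assms(1) by simp
  define \<Omega>1 where "\<Omega>1 = polyhedral_layer n \<phi> \<theta>"
  define \<Omega>2 where "\<Omega>2 = polyhedral_layer n \<phi> \<sigma>"
  have open1: "open \<Omega>1" and open2: "open \<Omega>2"
    unfolding \<Omega>1_def \<Omega>2_def by (intro open_polyhedral_layer n)+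
  have m1: "\<Omega>1 \<in> sets lebesgue" and m2: "\<Omega>2 \<in> sets lebesgue" using open1 open2 by simp_all
  interpret F1: form_operator "lebesgue_on \<Omega>1" "H10 \<Omega>1" "dirichlet_form \<Omega>1"
    by (rule dirichlet_form_operator[OF open1])
  interpret F2: form_operator "lebesgue_on \<Omega>2" "H10 \<Omega>2" "dirichlet_form \<Omega>2"
    by (rule dirichlet_form_operator[OF open2])
  have A1: "F1.A = dirichlet_laplacian \<Omega>1" by (rule dirichlet_laplacian_eq[OF open1])
  have A2: "F2.A = dirichlet_laplacian \<Omega>2" by (rule dirichlet_laplacian_eq[OF open2])
  fix j assume j: "j \<in> {1..k}"
  let ?l1 = "nth_eigenvalue (lebesgue_on \<Omega>1) F1.A j" and ?l2 = "nth_eigenvalue (lebesgue_on \<Omega>2) F2.A j"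
  assume "dirichlet_eigenvalue (polyhedral_layer n \<phi> \<sigma>) j < dirichlet_eigenvalue (polyhedral_layer n \<phi> \<theta>) j"
  then have less: "?l2 < ?l1" unfolding A1 A2 unfolding \<Omega>1_def \<Omega>2_def .
  have j1: "1 \<le> j" using j by simp
  have "enat j \<le> enat k" using j by simp
  then have count1: "enat j \<le> eigen_count (lebesgue_on \<Omega>1) F1.A {t. ereal t < threshold (lebesgue_on \<Omega>1) F1.A}"
    and count2: "enat j \<le> eigen_count (lebesgue_on \<Omega>2) F2.A {t. ereal t < threshold (lebesgue_on \<Omega>2) F2.A}"
    using assms(6,7) unfolding A1 A2 unfolding \<Omega>1_def \<Omega>2_def has_eigenvalues_below_threshold_def
    by (blast intro: order_trans)+
  obtain e t where et: "F2.eigenfamily j e t" "\<forall>i<j. t i \<in> {..?l2}"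
    using F2.eigen_count_family[OF F2.nth_eigenvalue_props(2)[OF j1 count2]] by blast
  have "0 \<le> t 0"
  proof (rule F2.eigenvalue_nonneg)
    show "(e 0, \<lambda>x. complex_of_real (t 0) * e 0 x) \<in> F2.A" using et(1) j1 by (auto simp: F2.eigenfamily_def)
    show "F2.nrm (e 0) = 1" using et(1) j1 by (intro orthonormal_norm[of _ j]) (auto simp: F2.eigenfamily_def)
  qed
  then have l2_nonneg: "0 \<le> ?l2" using et(2) j1 by force
  \<comment> \<open>Half of the gap between the two eigenvalues pays for the approximation by test functions.\<close>
  define \<eta> where "\<eta> = (?l1 - ?l2) / 2"
  have \<eta>: "0 < \<eta>" "?l2 + \<eta> < ?l1" using less by (simp_all add: \<eta>_def field_simps)
  have "\<exists>g. (\<forall>i<j. g i \<in> test_functions \<Omega>2) \<and> L2_independent (lebesgue_on \<Omega>2) j g \<and>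
    (\<forall>c. Re (dirichlet_form \<Omega>2 (\<lambda>x. \<Sum>i<j. c i * g i x) (\<lambda>x. \<Sum>i<j. c i * g i x))
        \<le> (?l2 + \<eta>) * (F2.nrm (\<lambda>x. \<Sum>i<j. c i * g i x))\<^sup>2)" (is "\<exists>g. ?good g")
  proof (rule F2.approximate_family[OF et(1) _ l2_nonneg _ _ \<eta>(1)])
    show "t i \<le> ?l2" if "i < j" for i using et(2) that by simp
    show "test_functions \<Omega>2 \<subseteq> H10 \<Omega>2" using test_functions_H10[OF open2] by blast
    show "\<exists>f\<in>test_functions \<Omega>2. F2.nrm (\<lambda>x. u x - f x) \<le> \<epsilon> \<and> F2.energy (\<lambda>x. u x - f x) \<le> \<epsilon>"
      if "u \<in> H10 \<Omega>2" "0 < \<epsilon>" for u \<epsilon>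
      unfolding F2.energy_def by (rule H10_approximation[OF that])
    show "\<exists>g. ?good g"
      if "\<And>i. i < j \<Longrightarrow> g i \<in> test_functions \<Omega>2" "L2_independent (lebesgue_on \<Omega>2) j g"
        "\<And>c. Re (dirichlet_form \<Omega>2 (\<lambda>x. \<Sum>i<j. c i * g i x) (\<lambda>x. \<Sum>i<j. c i * g i x))
          \<le> (?l2 + \<eta>) * (F2.nrm (\<lambda>x. \<Sum>i<j. c i * g i x))\<^sup>2" for g
      by (intro exI[of _ g] conjI allI impI that)
  qed
  then obtain g where "?good g" by blast
  then have g: "\<And>i. i < j \<Longrightarrow> g i \<in> test_functions \<Omega>2" "L2_independent (lebesgue_on \<Omega>2) j g"
    "\<And>c. Re (dirichlet_form \<Omega>2 (\<lambda>x. \<Sum>i<j. c i * g i x) (\<lambda>x. \<Sum>i<j. c i * g i x))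
        \<le> (?l2 + \<eta>) * (F2.nrm (\<lambda>x. \<Sum>i<j. c i * g i x))\<^sup>2" by blast+
  obtain \<delta> where lm: "layer_map n \<theta> \<sigma> \<delta>"
    and trans: "\<And>i. i < j \<Longrightarrow> (\<lambda>x. g i (layer_map.\<Phi> n \<phi> \<theta> \<sigma> \<delta> x)) \<in> test_functions \<Omega>1"
    using layer_transport[OF n assms(3-5), of j g \<phi>] g(1) unfolding \<Omega>1_def \<Omega>2_def by metis
  interpret L: layer_map n \<phi> \<theta> \<sigma> \<delta> by (rule lm)
  define w where "w i = (\<lambda>x. g i (L.\<Phi> x))" for i
  have w: "w i \<in> test_functions \<Omega>1" if "i < j" for i using trans[OF that] by (simp add: w_def)
  let ?G = "\<lambda>c x. \<Sum>i<j. c i * g i x" and ?W = "\<lambda>c x. \<Sum>i<j. c i * w i x"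
  have comb: "(\<lambda>x. \<Sum>i<j'. c i * f i x) \<in> test_functions \<Omega>"
    if "\<And>i. i < j' \<Longrightarrow> f i \<in> test_functions \<Omega>" for j' :: nat and f and c :: "nat \<Rightarrow> complex" and \<Omega> :: "(real^3) set"
    using that
  proof (induction j')
    case (Suc j')
    have "(\<lambda>x. 1 * (\<Sum>i<j'. c i * f i x) + c j' * f j' x) \<in> test_functions \<Omega>"
      by (intro test_functions_lin Suc) auto
    then show ?case by simp
  qed (simp add: test_functions_zero)
  have G: "?G c \<in> test_functions \<Omega>2" for c using g(1) by (rule comb)
  have W: "?W c \<in> test_functions \<Omega>1" for c using w by (rule comb)
  let ?c = "L.\<kappa> * L.\<kappa> * L.\<beta>"
  have cpos: "0 < ?c" using L.consts_pos by simp
  have norm_W: "(F1.nrm (?W c))\<^sup>2 = (F2.nrm (?G c))\<^sup>2 / ?c" for c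
    unfolding L2_norm_test[OF m1 W] L2_norm_test[OF m2 G] unfolding w_def
    by (rule L.norm_\<Phi>[OF test_functions_UNIV[OF G]])
  have energy_W: "Re (dirichlet_form \<Omega>1 (?W c) (?W c)) \<le> Re (dirichlet_form \<Omega>2 (?G c) (?G c)) / ?c" for c
    unfolding dirichlet_form_test[OF open1 W] dirichlet_form_test[OF open2 G] unfolding w_def
    by (rule L.energy_\<Phi>[OF test_functions_UNIV[OF G]])
  have le: "Re (dirichlet_form \<Omega>1 (?W c) (?W c)) \<le> (?l2 + \<eta>) * (F1.nrm (?W c))\<^sup>2" for c
  proof -
    have "Re (dirichlet_form \<Omega>1 (?W c) (?W c)) \<le> ((?l2 + \<eta>) * (F2.nrm (?G c))\<^sup>2) / ?c"
      by (rule order_trans[OF energy_W divide_right_mono[OF g(3)]]) (use cpos in simp)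
    then show ?thesis unfolding norm_W by simp
  qed
  have indep: "L2_independent (lebesgue_on \<Omega>1) j w"
    unfolding L2_independent_def
  proof (intro allI impI)
    fix c :: "nat \<Rightarrow> complex" and i
    assume ae: "AE x in lebesgue_on \<Omega>1. ?W c x = 0" and i: "i < j"
    have "F1.nrm (?W c) = 0" using ae L2_norm_eq_0[OF test_functions_L2[OF m1 W]] by blast
    then have "(F2.nrm (?G c))\<^sup>2 / ?c = 0" using norm_W[of c] by simp
    then have "F2.nrm (?G c) = 0" using L.consts_pos by simp
    then have "AE x in lebesgue_on \<Omega>2. ?G c x = 0" using L2_norm_eq_0[OF test_functions_L2[OF m2 G]] by blast
    then show "c i = 0" using g(2) i unfolding L2_independent_def by blast
  qed
  have thr: "ereal (?l2 + \<eta>) < threshold (lebesgue_on \<Omega>1) F1.A"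
    using F1.nth_eigenvalue_props(1)[OF j1 count1] \<eta>(2) by (meson ereal_less_eq(3) le_less_trans less_imp_le)
  have "enat j \<le> eigen_count (lebesgue_on \<Omega>1) F1.A {..?l2 + \<eta>}"
    by (rule F1.minmax_upper[OF thr _ indep le]) (rule test_functions_H10[OF open1 w])
  then have "?l1 \<le> ?l2 + \<eta>" by (rule F1.nth_eigenvalue_props(3)[OF j1 count1 thr])
  then show False using \<eta>(2) by simp
qed

end
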